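(* Let $1<p<\infty$, $\omega\in\mathcal{D}$ and $f\in L^1_{\omega_{\log}}$. Then the little Hankel operator $h^\omega_{\overline{f}}:A^p_\omega\to\overline{A^p_\omega}$ is bounded if and only if there exists $n_0=n_0(\omega)\in\mathbb{N}$ (depending only on $\omega$) such that, for each $n\ge n_0$, the function $\nu(z)=(1-|z|)^n$ satisfies $V_{\omega,\nu}(f)\in L^\infty$. Moreover, for each fixed $n\ge n_0$ and $\nu(z)=(1-|z|)^n$, $$\|V_{\omega,\nu}(f)\|_{L^\infty}\asymp\|h^\omega_{\overline{f}}\|_{A^p_\omega\to\overline{A^p_\omega}},$$ where the constants of comparison do not depend on $f$.
   Context: $\mathbb{D}$ is the open unit disc, $dA(z)=\frac{dx\,dy}{\pi}$, $\mathcal{H}(\mathbb{D})$ is the space of analytic functions in $\mathbb{D}$, and $H^\infty$ is the space of bounded analytic functions in $\mathbb{D}$. A radial weight is a non-negative function $\omega\in L^1([0,1))$ extended to $\mathbb{D}$ by $\omega(z)=\omega(|z|)$; it is always assumed that $\widehat{\omega}(z)=\int_{|z|}^1\omega(s)\,ds>0$ for all $z\in\mathbb{D}$. Moments: $\omega_x=\int_0^1r^x\omega(r)\,dr$. Classes: $\omega\in\widehat{\mathcal{D}}$ if there is $C>1$ with $\widehat{\omega}(r)\le C\widehat{\omega}\left(\frac{1+r}{2}\right)$ for all $0\le r<1$; $\omega\in\mathcal{M}$ if there are $C>1$, $K>1$ with $\omega_x\ge C\omega_{Kx}$ for all $x\ge1$; $\omega\in\check{\mathcal{D}}$ if there are $K>1$,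 $C>1$ with $\widehat{\omega}(r)\ge C\widehat{\omega}\left(1-\frac{1-r}{K}\right)$ for all $0\le r<1$. Then $\mathcal{D}=\widehat{\mathcal{D}}\cap\mathcal{M}=\widehat{\mathcal{D}}\cap\check{\mathcal{D}}$ (the equality is known). $L^p_\omega$ is the Lebesgue space on $\mathbb{D}$ with respect to $\omega\,dA$, $A^p_\omega=L^p_\omega\cap\mathcal{H}(\mathbb{D})$, and $\overline{A^p_\omega}=\{\overline{g}:g\in A^p_\omega\}$ with the $L^p_\omega$-norm. $B^\omega_z(\zeta)=\sum_{n=0}^\infty\frac{(\overline{z}\zeta)^n}{2\omega_{2n+1}}$ are the reproducing kernels of $A^2_\omega$. We write $f\in L^1_{\omega_{\log}}$ if $f$ is measurable and $\|f\|_{L^1_{\omega_{\log}}}=\int_{\mathbb{D}}|f(z)|\left(\log\frac{e}{1-|z|}\right)\omega(z)\,dA(z)<\infty$. The little Hankel operator with symbol $f$ is $h^\omega_f(g)(z)=\int_{\mathbb{D}}f(\zeta)g(\zeta)B^\omega_z(\zeta)\omega(\zeta)\,dA(\zeta)$, $z\in\mathbb{D}$. It is well defined for $g\in H^\infty$, which is dense in $A^p_\omega$; boundedness $A^p_\omega\to\overline{A^p_\omega}$ means that $\|h^\omega_f(g)\|_{L^p_\omega}\le C\|g\|_{A^p_\omega}$ for all $g\in H^\infty$, so that it extends boundedly to $A^p_\omega$; the operator norm is the best such $C$. For a radial function $\nu:\mathbb{D}\to[0,\infty)$ such that $\omega\nu$ is a radial weight, and $f\in L^1_\omega$, $$V_{\omega,\nu}(f)(z)=\nu(z)\int_{\mathbb{D}}f(\zeta)\overline{B^{\omega\nu}_z(\zeta)}\,\omega(\zeta)\,dA(\zeta),\quad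 z\in\mathbb{D}.$$ $a\asymp b$ means that each of $a,b$ is at most a constant multiple of the other. *)

theory Defs
  imports "HOL-Analysis.Analysis" "HOL-Probability.Essential_Supremum"
begin

section \<open>Radial weights on the unit disc\<close>

text \<open>
  A radial weight is represented by its radial profile \<open>\<omega> :: real \<Rightarrow> real\<close>, so that the weight on
  the disc is \<open>\<lambda>z. \<omega> (cmod z)\<close>; only the values of the profile on \<open>[0,1)\<close> are ever used.
\<close>

definition weight_tail :: "(real \<Rightarrow> real) \<Rightarrow> real \<Rightarrow> real" where
  "weight_tail \<omega> r = set_lebesgue_integral lebesgue {r..<1} \<omega>"

definition weight_moment :: "(real \<Rightarrow> real) \<Rightarrow> real \<Rightarrow> real" where
  "weight_moment \<omega> x = set_lebesgue_integral lebesgue {0..<1} (\<lambda>r. r powr x * \<omega> r)"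

definition radial_weight :: "(real \<Rightarrow> real) \<Rightarrow> bool" where
  "radial_weight \<omega> \<longleftrightarrow>
     (\<forall>r\<in>{0..<1}. 0 \<le> \<omega> r) \<and>
     set_integrable lebesgue {0..<1} \<omega> \<and>
     (\<forall>r\<in>{0..<1}. 0 < weight_tail \<omega> r)"

definition upper_doubling :: "(real \<Rightarrow> real) set" where
  "upper_doubling = {\<omega>. radial_weight \<omega> \<and>
     (\<exists>C>1. \<forall>r\<in>{0..<1}. weight_tail \<omega> r \<le> C * weight_tail \<omega> ((1 + r) / 2))}"

definition lower_doubling :: "(real \<Rightarrow> real) set" where
  "lower_doubling = {\<omega>. radial_weight \<omega> \<and>
     (\<exists>K>1. \<exists>C>1. \<forall>r\<in>{0..<1}. weight_tail \<omega> r \<ge> C * weight_tail \<omega> (1 - (1 - r) / K))}"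

definition two_sided_doubling :: "(real \<Rightarrow> real) set" where
  "two_sided_doubling = upper_doubling \<inter> lower_doubling"


section \<open>Function spaces on the unit disc\<close>

text \<open>
  Functions on the disc are total functions \<open>complex \<Rightarrow> complex\<close> whose values outside the
  disc are irrelevant.  The measure below is \<open>dx dy / \<pi>\<close> restricted to the disc.
\<close>

definition disc_area :: "complex measure" where
  "disc_area = density (lebesgue_on (ball 0 1)) (\<lambda>_. ennreal (1 / pi))"

definition Lp_space :: "real \<Rightarrow> (real \<Rightarrow> real) \<Rightarrow> (complex \<Rightarrow> complex) set" where
  "Lp_space p \<omega> = {f. f \<in> borel_measurable disc_area \<and>
     integrable disc_area (\<lambda>z. cmod (f z) powr p * \<omega> (cmod z))}"

definition Lp_norm :: "real \<Rightarrow> (real \<Rightarrow> real) \<Rightarrow> (complex \<Rightarrow> complex) \<Rightarrow> real" where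
  "Lp_norm p \<omega> f = (\<integral>z. cmod (f z) powr p * \<omega> (cmod z) \<partial>disc_area) powr (1 / p)"

definition bergman_space :: "real \<Rightarrow> (real \<Rightarrow> real) \<Rightarrow> (complex \<Rightarrow> complex) set" where
  "bergman_space p \<omega> = {f \<in> Lp_space p \<omega>. f holomorphic_on ball 0 1}"

definition conj_bergman_space :: "real \<Rightarrow> (real \<Rightarrow> real) \<Rightarrow> (complex \<Rightarrow> complex) set" where
  "conj_bergman_space p \<omega> = (\<lambda>g z. cnj (g z)) ` bergman_space p \<omega>"

definition Hinf_space :: "(complex \<Rightarrow> complex) set" where
  "Hinf_space = {g. g holomorphic_on ball 0 1 \<and> bounded (g ` ball 0 1)}"

definition L1_log_space :: "(real \<Rightarrow> real) \<Rightarrow> (complex \<Rightarrow> complex) set" where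
  "L1_log_space \<omega> = {f. f \<in> borel_measurable disc_area \<and>
     integrable disc_area (\<lambda>z. cmod (f z) * ln (exp 1 / (1 - cmod z)) * \<omega> (cmod z))}"

definition Linf_norm :: "(complex \<Rightarrow> complex) \<Rightarrow> ennreal" where
  "Linf_norm f = esssup disc_area (\<lambda>z. ennreal (cmod (f z)))"

definition Linf_space :: "(complex \<Rightarrow> complex) set" where
  "Linf_space = {f. f \<in> borel_measurable disc_area \<and> Linf_norm f < \<infinity>}"


section \<open>Kernels and operators\<close>

definition bergman_kernel :: "(real \<Rightarrow> real) \<Rightarrow> complex \<Rightarrow> complex \<Rightarrow> complex" where
  "bergman_kernel \<omega> z \<zeta> =
     (\<Sum>n. (cnj z * \<zeta>) ^ n / of_real (2 * weight_moment \<omega> (2 * real n + 1)))"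

definition little_hankel ::
  "(real \<Rightarrow> real) \<Rightarrow> (complex \<Rightarrow> complex) \<Rightarrow> (complex \<Rightarrow> complex) \<Rightarrow> complex \<Rightarrow> complex" where
  "little_hankel \<omega> f g z =
     (\<integral>\<zeta>. f \<zeta> * g \<zeta> * bergman_kernel \<omega> z \<zeta> * of_real (\<omega> (cmod \<zeta>)) \<partial>disc_area)"

text \<open>
  The operator is only given by the integral on bounded analytic functions, a dense subspace of
  the Bergman space; \<open>C\<close> is a bound if it is one on that subspace.
\<close>

definition little_hankel_bound ::
  "real \<Rightarrow> (real \<Rightarrow> real) \<Rightarrow> (complex \<Rightarrow> complex) \<Rightarrow> real \<Rightarrow> bool" where
  "little_hankel_bound p \<omega> f C \<longleftrightarrow> 0 \<le> C \<and>
     (\<forall>g\<in>Hinf_space. little_hankel \<omega> f g \<in> conj_bergman_space p \<omega> \<and>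
        Lp_norm p \<omega> (little_hankel \<omega> f g) \<le> C * Lp_norm p \<omega> g)"

definition little_hankel_bounded ::
  "real \<Rightarrow> (real \<Rightarrow> real) \<Rightarrow> (complex \<Rightarrow> complex) \<Rightarrow> bool" where
  "little_hankel_bounded p \<omega> f \<longleftrightarrow> (\<exists>C. little_hankel_bound p \<omega> f C)"

text \<open>The operator norm; it is \<open>\<infinity>\<close>, the infimum of the empty set, for an unbounded operator.\<close>

definition little_hankel_norm ::
  "real \<Rightarrow> (real \<Rightarrow> real) \<Rightarrow> (complex \<Rightarrow> complex) \<Rightarrow> ennreal" where
  "little_hankel_norm p \<omega> f = Inf {ennreal C | C. little_hankel_bound p \<omega> f C}"

definition V_op ::
  "(real \<Rightarrow> real) \<Rightarrow> (real \<Rightarrow> real) \<Rightarrow> (complex \<Rightarrow> complex) \<Rightarrow> complex \<Rightarrow> complex" where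
  "V_op \<omega> \<nu> f z = of_real (\<nu> (cmod z)) *
     (\<integral>\<zeta>. f \<zeta> * cnj (bergman_kernel (\<lambda>r. \<omega> r * \<nu> r) z \<zeta>) * of_real (\<omega> (cmod \<zeta>)) \<partial>disc_area)"

end

theory Submission
  imports Defs "HOL-Complex_Analysis.Complex_Analysis"
begin

text \<open>
  Only the antianalytic moments \<open>\<integral> f(\<zeta>) cnj \<zeta>\<^sup>m \<omega>(\<zeta>) dA\<close> of \<open>f\<close> matter, for the transform and for the
  Hankel operator alike, and with \<open>\<nu> = (1 - r)\<^sup>n\<close> the transform has the same moments as \<open>f\<close>. If it is
  bounded by \<open>M\<close>, the Hankel operator is therefore dominated by \<open>M\<close> times the maximal Bergman
  projection, which is bounded on \<open>L\<^sup>p\<close> by a Schur test with powers of the tail integral of \<open>\<omega>\<close>; the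
  mean of the kernel over the circle of radius \<open>r\<close> is at most a constant times the reciprocal of the
  tail integral at \<open>r\<close>.

  Conversely, pairing the operator with \<open>g = (1 - b z)\<^sup>-\<^sup>L\<close> twice, once in \<open>L\<^sup>p\<close> and once in the dual
  space, bounds \<open>\<integral> f cnj (1 - b z)\<^sup>-\<^sup>2\<^sup>L \<omega> dA\<close>. The transform is a Hadamard product of the power series of
  these numbers with one whose coefficients are the kernel coefficients of \<open>\<omega>\<nu>\<close> divided by
  binomial coefficients, and for \<open>n \<ge> 2L\<close> the circle means of the latter are controlled by the
  same estimate as those of the kernel.
\<close>

section \<open>Rotations and radial integrals on the disc\<close>

text \<open>The exponent L of the overview is \<beta> + 2, where 2^\<beta> is an upper doubling
  constant of \<omega>. The L^p norm of (1 - b z)^-L has the expected size once L p > \<beta> + 1,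
  and this L achieves that for every p > 1 at once; hence the threshold 2 L does not depend on p.
  The obstacle is that the kernel has no closed form. What is available are bounds, in terms of the
  tail at radius 1 - 1/(m + 2), for its m-th coefficient and for the difference of consecutive
  coefficients. Circle means are therefore estimated in L^2, by Parseval, after splitting off 1 / (1
  - w). Lower doubling acts twice: it makes the integral of 1 / ((1 - s) tail(s)) over [0, r] at
  most a constant times 1 / tail(r), so that a bound for the derivative of the kernel passes to the
  kernel without a logarithm, and it makes the tail of \<omega> (1 - r)^n comparable to (1 - r)^n
  times the tail of \<omega>. Polar coordinates are replaced by the law of |z| under the area
  measure and by averaging over rotations.\<close>

text \<open>By Vitali's theorem an open set is, up to a null set, a disjoint union of balls, and a rotation
  maps a ball to a ball of the same radius.\<close>

lemma emeasure_lborel_rotation_open: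
  fixes c :: complex
  assumes c: "cmod c = 1" and S: "open S"
  shows "emeasure lborel ((*) c ` S) = emeasure lborel S"
proof -
  have c0: "c \<noteq> 0" using c by auto
  have img_ball: "(*) c ` ball a r = ball (c * a) r" for a r
  proof -
    have "dist (c * a) (c * x) = dist a x" for x
      using c by (simp add: dist_norm norm_mult flip: right_diff_distrib)
    then have "(*) c ` ball a r \<subseteq> ball (c * a) r" by auto
    moreover have "x \<in> (*) c ` ball a r" if "x \<in> ball (c * a) r" for x
    proof
      show "x = c * (x / c)" using c0 by simp
      have "dist (c * a) x = dist a (x / c)"
        using \<open>dist (c * a) (c * (x / c)) = dist a (x / c)\<close> c0 by simp
      then show "x / c \<in> ball a r" using that by simp
    qed
    ultimately show ?thesis by blast
  qed
  define K where "K = {(a :: complex, r). 0 < r \<and> ball a r \<subseteq> S}"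
  have fine: "\<exists>i. i \<in> K \<and> x \<in> ball (fst i) (snd i) \<and> snd i < d" if "x \<in> S" "0 < d" for x d
  proof -
    obtain e where e: "e > 0" "ball x e \<subseteq> S" using S \<open>x \<in> S\<close> by (auto elim: openE)
    have "ball x (min e (d/2)) \<subseteq> S" using e by auto
    then have "(x, min e (d/2)) \<in> K \<and> x \<in> ball (fst (x, min e (d/2))) (snd (x, min e (d/2)))
       \<and> snd (x, min e (d/2)) < d"
      using e that by (auto simp: K_def)
    then show ?thesis by blast
  qed
  obtain C where C: "countable C" "C \<subseteq> K"
      and disj: "pairwise (\<lambda>i j. disjnt (ball (fst i) (snd i)) (ball (fst j) (snd j))) C"
      and neg: "negligible (S - (\<Union>i\<in>C. ball (fst i) (snd i)))"
    by (rule Vitali_covering_theorem_balls[of S K fst snd, OF fine]) auto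
  define U where "U = (\<Union>i\<in>C. ball (fst i) (snd i))"
  have "ball (fst i) (snd i) \<subseteq> S" if "i \<in> C" for i
  proof -
    have "i \<in> K" using C that by blast
    then show ?thesis by (simp add: K_def case_prod_unfold)
  qed
  then have US: "U \<subseteq> S" by (auto simp: U_def)
  have oU: "open U" by (auto simp: U_def)
  have null: "N \<in> null_sets lborel" if "negligible N" "N \<in> sets borel" for N :: "complex set"
    using that by (simp add: negligible_iff_null_sets null_sets_completion_iff)
  have img_borel: "(*) c ` X \<in> sets borel" if "X \<in> sets borel" for X
  proof -
    have "(*) c ` X = (\<lambda>x. x / c) -` X \<inter> space borel"
    proof safe
      fix x assume "x / c \<in> X"
      then show "x \<in> (*) c ` X" using c0 by (intro image_eqI[of _ _ "x / c"]) auto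
    qed (use c0 in auto)
    moreover have "(\<lambda>x. x / c) \<in> borel \<rightarrow>\<^sub>M borel" by measurable
    ultimately show ?thesis using that by (metis measurable_sets)
  qed
  have dis1: "disjoint_family_on (\<lambda>i. ball (fst i) (snd i)) C"
    using disj by (auto simp: disjoint_family_on_def pairwise_def disjnt_def)
  have dis2: "disjoint_family_on (\<lambda>i. ball (c * fst i) (snd i)) C"
    unfolding disjoint_family_on_def img_ball[symmetric]
    using dis1 c0 by (fastforce simp: disjoint_family_on_def)
  have "emeasure lborel U = (\<integral>\<^sup>+i. emeasure lborel (ball (fst i) (snd i)) \<partial>count_space C)"
    unfolding U_def by (intro emeasure_UN_countable dis1 C) auto
  also have "\<dots> = (\<integral>\<^sup>+i. emeasure lborel (ball (c * fst i) (snd i)) \<partial>count_space C)"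
  proof (intro nn_integral_cong)
    fix i assume "i \<in> space (count_space C)"
    then have "snd i > 0" using C by (auto simp: K_def)
    then show "emeasure lborel (ball (fst i) (snd i)) = emeasure lborel (ball (c * fst i) (snd i))"
      by (simp add: emeasure_ball)
  qed
  also have "\<dots> = emeasure lborel (\<Union>i\<in>C. ball (c * fst i) (snd i))"
    by (intro emeasure_UN_countable[symmetric] dis2 C) auto
  also have "(\<Union>i\<in>C. ball (c * fst i) (snd i)) = (*) c ` U"
    by (simp add: U_def image_UN img_ball)
  finally have eqU: "emeasure lborel U = emeasure lborel ((*) c ` U)" .
  have SU: "S - U \<in> sets borel" using S oU by auto
  have eq1: "emeasure lborel S = emeasure lborel U"
  proof -
    have "emeasure lborel (U \<union> (S - U)) = emeasure lborel U"
      using null[of "S - U"] neg SU oU unfolding U_def[symmetric] by (intro emeasure_Un_null_set) auto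
    moreover have "U \<union> (S - U) = S" using US by auto
    ultimately show ?thesis by simp
  qed
  \<comment> \<open>A linear image of a negligible set is negligible, so the part missed by the
    balls may be discarded after the rotation as well.\<close>
  have eq2: "emeasure lborel ((*) c ` S) = emeasure lborel ((*) c ` U)"
  proof -
    have "negligible ((*) c ` (S - U))"
      using neg unfolding U_def[symmetric]
      by (intro negligible_differentiable_image_negligible) (auto intro!: derivative_intros)
    then have "(*) c ` (S - U) \<in> null_sets lborel" using SU by (intro null img_borel)
    then have "emeasure lborel ((*) c ` U \<union> (*) c ` (S - U)) = emeasure lborel ((*) c ` U)"
      using oU by (intro emeasure_Un_null_set) (auto intro: img_borel)
    moreover have "(*) c ` U \<union> (*) c ` (S - U) = (*) c ` S" using US by auto
    ultimately show ?thesis by simp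
  qed
  show ?thesis using eq1 eq2 eqU by simp
qed

text \<open>Boxes are open and determine Lebesgue measure, so invariance on open sets extends to all
  Borel sets.\<close>

lemma distr_lborel_rotation:
  fixes c :: complex
  assumes c: "cmod c = 1"
  shows "distr lborel lborel ((*) c) = lborel"
proof (rule lborel_eqI[symmetric])
  have c0: "c \<noteq> 0" using c by auto
  fix l u :: complex assume lu: "\<And>b. b \<in> Basis \<Longrightarrow> l \<bullet> b \<le> u \<bullet> b"
  have eq: "(*) c -` box l u \<inter> space lborel = (*) (inverse c) ` box l u"
  proof safe
    fix x assume "c * x \<in> box l u"
    then show "x \<in> (*) (inverse c) ` box l u" using c0 by (intro image_eqI[of _ _ "c * x"]) auto
  qed (use c0 in \<open>auto simp: mult.assoc[symmetric]\<close>)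
  have "emeasure (distr lborel lborel ((*) c)) (box l u) = emeasure lborel ((*) c -` box l u \<inter> space lborel)"
    by (rule emeasure_distr) auto
  also have "\<dots> = emeasure lborel (box l u)"
    unfolding eq by (rule emeasure_lborel_rotation_open) (use c in \<open>auto simp: norm_inverse\<close>)
  finally show "emeasure (distr lborel lborel ((*) c)) (box l u) = (\<Prod>b\<in>Basis. (u - l) \<bullet> b)"
    using lu by (simp add: emeasure_lborel_box)
qed auto

lemma distr_lebesgue_rotation:
  fixes c :: complex
  assumes c: "cmod c = 1"
  shows "distr lebesgue lebesgue ((*) c) = lebesgue"
proof -
  have "distr lebesgue lborel ((*) c) = lborel"
    using distr_lborel_rotation[OF c] by (subst distr_completion) auto
  then show ?thesis
    using completion.completion_distr_eq[of "(*) c" lborel lborel]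
    by (simp add: measurable_completion)
qed

text \<open>Continuity only gives preimages of Borel sets. For Lebesgue sets on both sides preimages
  of null sets have to be null, which invariance of the measure supplies.\<close>

lemma measurable_lebesgue_rotation:
  fixes c :: complex
  assumes c: "cmod c = 1"
  shows "(*) c \<in> lebesgue \<rightarrow>\<^sub>M lebesgue"
proof -
  have *: "distr lebesgue lborel ((*) c) = lborel"
    using distr_lborel_rotation[OF c] by (subst distr_completion) auto
  show ?thesis
    by (rule completion.measurable_completion2) (auto simp: measurable_completion *)
qed

section \<open>The normalised area measure and the law of the modulus\<close>

lemma space_disc_area [simp]: "space disc_area = ball 0 1"
  by (simp add: disc_area_def)

lemma sets_disc_area: "A \<in> sets disc_area \<longleftrightarrow> A \<in> sets lebesgue \<and> A \<subseteq> ball 0 1"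
  by (auto simp: disc_area_def sets_restrict_space_iff)

lemma emeasure_disc_area:
  "A \<in> sets disc_area \<Longrightarrow> emeasure disc_area A = ennreal (1 / pi) * emeasure lebesgue A"
  unfolding sets_disc_area
  by (simp add: disc_area_def emeasure_density_const sets_restrict_space_iff emeasure_restrict_space)

lemma measurable_disc_area_borel: "f \<in> borel \<rightarrow>\<^sub>M N \<Longrightarrow> f \<in> disc_area \<rightarrow>\<^sub>M N"
  unfolding disc_area_def
  by (simp add: measurable_completion measurable_restrict_space1)

lemma measurable_disc_area_ident [measurable (raw)]: "(\<lambda>z. z) \<in> borel_measurable disc_area"
  by (rule measurable_disc_area_borel) simp

lemma measurable_disc_rotation:
  assumes "cmod c = 1" shows "(*) c \<in> disc_area \<rightarrow>\<^sub>M disc_area"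
proof (rule measurableI)
  fix A assume A: "A \<in> sets disc_area"
  have "(*) c \<in> lebesgue \<rightarrow>\<^sub>M lebesgue" by (rule measurable_lebesgue_rotation) fact
  then have "(*) c -` A \<in> sets lebesgue" using A unfolding sets_disc_area
    using measurable_sets[of "(*) c" lebesgue lebesgue A] by simp
  then show "(*) c -` A \<inter> space disc_area \<in> sets disc_area"
    unfolding sets_disc_area by (auto intro!: sets.Int)
qed (use assms in \<open>auto simp: norm_mult\<close>)

lemma distr_disc_area_rotation:
  assumes c: "cmod c = 1" shows "distr disc_area disc_area ((*) c) = disc_area"
proof (rule measure_eqI)
  fix A assume A: "A \<in> sets (distr disc_area disc_area ((*) c))"
  then have A': "A \<in> sets disc_area" by simp
  note m = measurable_disc_rotation[OF c]
  have eq: "(*) c -` A \<inter> ball 0 1 = (*) c -` A" using A' c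
    by (auto simp: sets_disc_area norm_mult subset_eq)
  have "(*) c \<in> lebesgue \<rightarrow>\<^sub>M lebesgue" by (rule measurable_lebesgue_rotation) fact
  then have "emeasure lebesgue ((*) c -` A) = emeasure (distr lebesgue lebesgue ((*) c)) A"
    using A' by (subst emeasure_distr) (auto simp: sets_disc_area)
  also have "\<dots> = emeasure lebesgue A" by (simp add: distr_lebesgue_rotation[OF c])
  finally have *: "emeasure lebesgue ((*) c -` A) = emeasure lebesgue A" .
  have "(*) c -` A \<in> sets disc_area" using measurable_sets[OF m A'] eq by simp
  then show "emeasure (distr disc_area disc_area ((*) c)) A = emeasure disc_area A"
    using A' m by (simp add: emeasure_distr eq emeasure_disc_area *)
qed simp

text \<open>Profiles are only Lebesgue measurable, so \<open>cmod\<close> has to be measurable into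
  the Lebesgue sets; completeness takes care of preimages of subsets of Borel null sets.\<close>

lemma complete_disc_area: "complete_measure disc_area"
proof
  fix A B assume "B \<subseteq> A" "A \<in> null_sets disc_area"
  then have "A \<in> null_sets lebesgue" "A \<subseteq> ball 0 1"
    by (auto simp: null_sets_def emeasure_disc_area sets_disc_area)
  then show "B \<in> sets disc_area" using \<open>B \<subseteq> A\<close>
    unfolding sets_disc_area using completion.complete2[of B A lborel] by (metis null_setsD2 order_trans)
qed

lemma emeasure_disc_area_cball:
  assumes "0 \<le> x" "x < 1" shows "emeasure disc_area (cball 0 x) = ennreal (x\<^sup>2)"
proof -
  have "cball 0 x \<in> sets disc_area" using assms by (auto simp: sets_disc_area)
  then have "emeasure disc_area (cball 0 x) = ennreal (1 / pi) * emeasure lborel (cball (0::complex) x)"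
    by (simp add: emeasure_disc_area)
  also have "\<dots> = ennreal (1 / pi) * ennreal (pi * x\<^sup>2)"
    using assms by (simp add: emeasure_cball unit_ball_vol_2)
  finally show ?thesis using assms by (simp flip: ennreal_mult)
qed

lemma emeasure_disc_area_space: "emeasure disc_area (ball 0 1) = 1"
proof -
  have "ball 0 1 \<in> sets disc_area" by (auto simp: sets_disc_area)
  then have "emeasure disc_area (ball 0 1) = ennreal (1 / pi) * emeasure lborel (ball (0::complex) 1)"
    by (simp add: emeasure_disc_area)
  also have "\<dots> = ennreal (1 / pi) * ennreal pi"
    by (simp add: emeasure_ball unit_ball_vol_2)
  finally show ?thesis by (simp flip: ennreal_mult)
qed

text \<open>Both sides are finite measures and agree on every half-line; beyond a radius x in [0,1)
  the mass is 1 - x^2, by the area of a disc. Division by \<pi> makes the total mass one.\<close>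

lemma distr_disc_area_cmod:
  "distr disc_area borel cmod = density lborel (\<lambda>r. ennreal (2 * r) * indicator {0..<1} r)"
    (is "?L = ?R")
proof (rule measure_eqI_lessThan)
  have R: "emeasure ?R {x<..} = ennreal (1 - x\<^sup>2)" if "0 \<le> x" "x < 1" for x
  proof -
    have "emeasure ?R {x<..} = (\<integral>\<^sup>+ r. ennreal (2 * r) * indicator {0..<1} r * indicator {x<..} r \<partial>lborel)"
      by (subst emeasure_density) auto
    also have "\<dots> = (\<integral>\<^sup>+ r. ennreal (2 * r) * indicator {x..1} r \<partial>lborel)"
    proof (rule nn_integral_cong_AE)
      have "AE r in lborel. r \<noteq> 1 \<and> r \<noteq> x" by (intro AE_conjI AE_lborel_singleton)
      then show "AE r in lborel. ennreal (2 * r) * indicator {0..<1} r * indicator {x<..} r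
          = ennreal (2 * r) * indicator {x..1} r"
        by eventually_elim (use that in \<open>auto simp: indicator_def\<close>)
    qed
    also have "\<dots> = ennreal (1\<^sup>2 - x\<^sup>2)"
      using that by (intro nn_integral_FTC_Icc) (auto intro!: derivative_eq_intros)
    finally show ?thesis by simp
  qed
  have R0: "emeasure ?R {x<..} = 1" if "x < 0" for x
  proof -
    have "emeasure ?R {x<..} = (\<integral>\<^sup>+ r. ennreal (2 * r) * indicator {0..<1} r * indicator {x<..} r \<partial>lborel)"
      by (subst emeasure_density) auto
    also have "\<dots> = (\<integral>\<^sup>+ r. ennreal (2 * r) * indicator {0..1} r \<partial>lborel)"
    proof (rule nn_integral_cong_AE)
      have "AE r in lborel. r \<noteq> 1" by (intro AE_lborel_singleton)
      then show "AE r in lborel. ennreal (2 * r) * indicator {0..<1} r * indicator {x<..} r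
          = ennreal (2 * r) * indicator {0..1} r"
        by eventually_elim (use that in \<open>auto simp: indicator_def\<close>)
    qed
    also have "\<dots> = ennreal (1\<^sup>2 - 0\<^sup>2)"
      by (intro nn_integral_FTC_Icc) (auto intro!: derivative_eq_intros)
    finally show ?thesis by simp
  qed
  have R1: "emeasure ?R {x<..} = 0" if "x \<ge> 1" for x
    using that by (subst emeasure_density) (auto simp: indicator_def nn_integral_0_iff_AE)
  have L: "emeasure ?L {x<..} = emeasure disc_area ({z. cmod z > x} \<inter> ball 0 1)" for x
    by (subst emeasure_distr) (auto intro!: arg_cong[where f="emeasure disc_area"])
  show eq: "emeasure ?L {x<..} = emeasure ?R {x<..}" for x
  proof -
    consider "x < 0" | "0 \<le> x" "x < 1" | "x \<ge> 1" by linarith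
    then show ?thesis
    proof cases
      case 1
      then have "{z. cmod z > x} \<inter> ball 0 1 = ball 0 1"
        by (auto intro: less_le_trans[OF _ norm_ge_zero])
      then show ?thesis using 1 by (simp add: L R0 emeasure_disc_area_space)
    next
      case 2
      have s: "cball 0 x \<in> sets disc_area" "ball 0 1 \<in> sets disc_area" using 2 by (auto simp: sets_disc_area)
      have "{z. cmod z > x} \<inter> ball 0 1 = ball 0 1 - cball 0 x" by auto
      then have "emeasure ?L {x<..} = emeasure disc_area (ball 0 1) - emeasure disc_area (cball 0 x)"
        using 2 s by (simp add: L emeasure_Diff emeasure_disc_area_cball subset_eq)
      then show ?thesis using 2
        by (simp add: R emeasure_disc_area_cball emeasure_disc_area_space ennreal_minus flip: ennreal_1)
    next
      case 3
      then have "{z. cmod z > x} \<inter> ball 0 1 = {}" by auto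
      then show ?thesis using 3 by (simp add: L R1)
    qed
  qed
  show "emeasure ?L {x<..} < \<infinity>" for x
    unfolding eq by (cases "x < 0"; cases "x < 1") (auto simp: R R0 R1)
qed auto

text \<open>The law of the modulus has a density, so preimages of null sets are null.\<close>

lemma measurable_cmod_disc: "cmod \<in> disc_area \<rightarrow>\<^sub>M lebesgue"
proof -
  interpret complete_measure disc_area by (rule complete_disc_area)
  show ?thesis
  proof (rule measurable_completion2)
    have "distr disc_area lborel cmod = distr disc_area borel cmod"
      by (rule distr_cong) auto
    then have *: "distr disc_area lborel cmod = density lborel (\<lambda>r. ennreal (2 * r) * indicator {0..<1} r)"
      by (simp add: distr_disc_area_cmod)
    show "null_sets lborel \<subseteq> null_sets (distr disc_area lborel cmod)"
      unfolding *
    proof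
      fix N :: "real set" assume N: "N \<in> null_sets lborel"
      then have "AE r in lborel. r \<notin> N" by (rule AE_not_in)
      then show "N \<in> null_sets (density lborel (\<lambda>r. ennreal (2 * r) * indicator {0..<1} r))"
        using N by (subst null_sets_density_iff) (auto simp: null_sets_def)
    qed
  qed auto
qed

lemma nn_integral_disc_radial:
  fixes \<phi> :: "real \<Rightarrow> ennreal"
  assumes "(\<lambda>r. \<phi> r * indicator {0..<1} r) \<in> borel_measurable lebesgue"
  shows "(\<integral>\<^sup>+z. \<phi> (cmod z) \<partial>disc_area) = (\<integral>\<^sup>+r\<in>{0..<1}. \<phi> r * ennreal (2 * r) \<partial>lebesgue)"
proof -
  \<comment> \<open>The law of \<open>cmod\<close> lives on the Borel sets, so the truncated \<phi>
    is first replaced by an almost everywhere equal Borel function.\<close>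
  obtain g where g[measurable]: "g \<in> borel_measurable lborel"
    and ae: "AE r in lborel. \<phi> r * indicator {0..<1} r = g r"
    using completion_ex_borel_measurable[OF assms] by auto
  let ?R = "density lborel (\<lambda>r. ennreal (2 * r) * indicator {0..<1} r)"
  have "AE r in ?R. \<phi> r * indicator {0..<1} r = g r"
    using ae by (subst AE_density) auto
  then have "AE r in distr disc_area borel cmod. \<phi> r * indicator {0..<1} r = g r"
    unfolding distr_disc_area_cmod .
  then have "AE z in disc_area. \<phi> (cmod z) * indicator {0..<1} (cmod z) = g (cmod z)"
    by (rule AE_distrD[rotated]) simp
  then have "AE z in disc_area. \<phi> (cmod z) = g (cmod z)"
    by (rule AE_mp) (auto simp: indicator_def)
  then have "(\<integral>\<^sup>+z. \<phi> (cmod z) \<partial>disc_area) = (\<integral>\<^sup>+z. g (cmod z) \<partial>disc_area)"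
    by (rule nn_integral_cong_AE)
  also have "\<dots> = (\<integral>\<^sup>+r. g r \<partial>distr disc_area borel cmod)"
    by (subst nn_integral_distr) (use g in auto)
  also have "\<dots> = (\<integral>\<^sup>+r. ennreal (2 * r) * indicator {0..<1} r * g r \<partial>lborel)"
    unfolding distr_disc_area_cmod by (subst nn_integral_density) (use g in auto)
  also have "\<dots> = (\<integral>\<^sup>+r. ennreal (2 * r) * indicator {0..<1} r * g r \<partial>lebesgue)"
    by (rule nn_integral_completion[symmetric])
  also have "\<dots> = (\<integral>\<^sup>+r\<in>{0..<1}. \<phi> r * ennreal (2 * r) \<partial>lebesgue)"
  proof (rule nn_integral_cong_AE)
    show "AE r in lebesgue. ennreal (2 * r) * indicator {0..<1} r * g r
       = \<phi> r * ennreal (2 * r) * indicator {0..<1} r"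
      using AE_completion[OF ae] by (auto simp: indicator_def mult_ac elim!: AE_mp)
  qed
  finally show ?thesis .
qed

section \<open>Power series on circles\<close>

text \<open>Termwise integration, dominated by the sum of the |x n| times the integral of |G|. The
  functions \<open>e n\<close> will be, among others, powers of a circle point, of a conjugated disc
  point, or of z / R on a disc of radius R < 1.\<close>

lemma
  fixes x :: "nat \<Rightarrow> complex" and e :: "nat \<Rightarrow> 'a \<Rightarrow> complex"
  assumes x: "summable (\<lambda>n. norm (x n))" and G: "integrable M G"
    and e[measurable]: "\<And>n. e n \<in> borel_measurable M"
    and e1: "\<And>n z. z \<in> space M \<Longrightarrow> norm (e n z) \<le> 1"
  shows integrable_mult_suminf: "integrable M (\<lambda>z. G z * (\<Sum>n. x n * e n z))"
    and sums_integral_mult_suminf: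
      "(\<lambda>n. x n * (\<integral>z. G z * e n z \<partial>M)) sums (\<integral>z. G z * (\<Sum>n. x n * e n z) \<partial>M)"
proof -
  have [measurable]: "G \<in> borel_measurable M" using G by auto
  have b: "norm (G z * e n z) \<le> norm (G z)" if "z \<in> space M" for n z
    using e1[OF that, of n] by (simp add: norm_mult mult_left_le)
  have ig: "integrable M (\<lambda>z. G z * e n z)" for n
    by (rule Bochner_Integration.integrable_bound[OF G]) (auto intro!: AE_I2 b)
  have i1: "integrable M (\<lambda>z. x n * (G z * e n z))" for n
    using ig by simp
  have s1: "summable (\<lambda>n. norm (x n * e n z))" if "z \<in> space M" for z
    by (rule summable_comparison_test'[OF x, of 0]) (use e1[OF that] in \<open>auto simp: norm_mult mult_left_le\<close>)
  have s2: "summable (\<lambda>n. norm (x n * (G z * e n z)))" if "z \<in> space M" for z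
    using summable_mult[OF s1[OF that], of "norm (G z)"] by (simp add: norm_mult mult_ac)
  have s3: "summable (\<lambda>n. \<integral>z. norm (x n * (G z * e n z)) \<partial>M)"
  proof (rule summable_comparison_test'[OF summable_mult2[OF x, of "\<integral>z. norm (G z) \<partial>M"], of 0])
    fix n
    have "(\<integral>z. norm (x n * (G z * e n z)) \<partial>M) = norm (x n) * (\<integral>z. norm (G z * e n z) \<partial>M)"
      by (simp add: norm_mult)
    also have "\<dots> \<le> norm (x n) * (\<integral>z. norm (G z) \<partial>M)"
      by (intro mult_left_mono integral_mono ig[THEN integrable_norm] integrable_norm G b) auto
    finally show "norm (\<integral>z. norm (x n * (G z * e n z)) \<partial>M) \<le> norm (x n) * (\<integral>z. norm (G z) \<partial>M)"
      by simp
  qed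
  have eq: "(\<Sum>n. x n * (G z * e n z)) = G z * (\<Sum>n. x n * e n z)" if "z \<in> space M" for z
    using suminf_mult[OF summable_norm_cancel[OF s1[OF that]], of "G z"] by (simp add: mult_ac)
  have "integrable M (\<lambda>z. \<Sum>n. x n * (G z * e n z))"
    by (rule integrable_suminf[OF i1 AE_I2 s3]) (rule s2)
  then show "integrable M (\<lambda>z. G z * (\<Sum>n. x n * e n z))"
    by (simp add: eq cong: Bochner_Integration.integrable_cong)
  have "(\<lambda>n. \<integral>z. x n * (G z * e n z) \<partial>M) sums (\<integral>z. (\<Sum>n. x n * (G z * e n z)) \<partial>M)"
    by (rule sums_integral[OF i1 AE_I2 s3]) (rule s2)
  then show "(\<lambda>n. x n * (\<integral>z. G z * e n z \<partial>M)) sums (\<integral>z. G z * (\<Sum>n. x n * e n z) \<partial>M)"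
    by (simp add: eq cong: Bochner_Integration.integral_cong)
qed

text \<open>Parameter space of the circle via \<open>unit_cis\<close>; its total mass is one, so
  integrals over it are means.\<close>

definition unit_interval :: "real measure" where
  "unit_interval = restrict_space lborel {0..1}"

lemma space_unit_interval [simp]: "space unit_interval = {0..1}"
  by (simp add: unit_interval_def)

lemma measurable_unit_interval_ident [measurable (raw)]: "(\<lambda>t. t) \<in> borel_measurable unit_interval"
  unfolding unit_interval_def by (rule measurable_restrict_space1) simp

lemma emeasure_unit_interval: "emeasure unit_interval {0..1} = 1"
  by (simp add: unit_interval_def emeasure_restrict_space)

lemma finite_measure_unit_interval: "finite_measure unit_interval"
  by (rule finite_measureI) (simp add: emeasure_unit_interval)

lemma finite_measure_disc_area: "finite_measure disc_area"
  by (rule finite_measureI) (simp add: emeasure_disc_area_space)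

lemma measure_unit_interval: "measure unit_interval {0..1} = 1"
  by (simp add: measure_def emeasure_unit_interval)

definition unit_cis :: "real \<Rightarrow> complex" where "unit_cis t = cis (2 * pi * t)"

lemma norm_unit_cis [simp]: "norm (unit_cis t) = 1" by (simp add: unit_cis_def)

lemma measurable_unit_cis [measurable]: "unit_cis \<in> borel_measurable borel"
  unfolding unit_cis_def[abs_def]
  by (intro borel_measurable_continuous_onI continuous_intros)

lemma measurable_cnj [measurable]: "cnj \<in> borel_measurable borel"
  by (intro borel_measurable_continuous_onI continuous_intros)

lemma integral_unit_cis_power:
  "(\<integral>t. unit_cis t ^ m * cnj (unit_cis t ^ k) \<partial>unit_interval) = (if m = k then 1 else 0)"
proof (cases "m = k")
  case True
  have "unit_cis t ^ k * cnj (unit_cis t ^ k) = 1" for t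
    using complex_norm_square[of "unit_cis t ^ k"] by (simp add: norm_power)
  then show ?thesis using True by (simp add: measure_unit_interval)
next
  case False
  define d where "d = 2 * pi * (real m - real k)"
  have d0: "d \<noteq> 0" using False by (simp add: d_def)
  have eq: "unit_cis t ^ m * cnj (unit_cis t ^ k) = cis (d * t)" for t
    by (simp add: unit_cis_def Complex.DeMoivre cis_cnj cis_mult d_def algebra_simps)
  have der: "((\<lambda>t. cis (d * t) / (\<i> * d)) has_vector_derivative cis (d * t)) (at t within {0..1})" for t
  proof -
    have "((\<lambda>t. exp (\<i> * of_real d * of_real t) / (\<i> * d)) has_vector_derivative
         exp (\<i> * of_real d * of_real t)) (at t within {0..1})"
      using d0 by (auto intro!: derivative_eq_intros has_vector_derivative_real_field simp: field_simps)
    then show ?thesis by (simp add: cis_conv_exp mult.assoc)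
  qed
  have "(\<integral>t. unit_cis t ^ m * cnj (unit_cis t ^ k) \<partial>unit_interval) = (\<integral>t. indicator {0..1} t *\<^sub>R cis (d * t) \<partial>lborel)"
    unfolding unit_interval_def eq by (rule integral_restrict_space) auto
  also have "\<dots> = cis (d * 1) / (\<i> * d) - cis (d * 0) / (\<i> * d)"
    by (rule integral_FTC_atLeastAtMost) (use der in \<open>auto intro!: continuous_intros\<close>)
  also have "cis (d * 1) = 1"
    using cis_multiple_2pi[of "real m - real k"] by (simp add: d_def mult_ac)
  finally show ?thesis using False by simp
qed

lemma
  fixes x :: "nat \<Rightarrow> complex"
  assumes x: "summable (\<lambda>n. norm (x n))"
  shows integrable_circle_series: "integrable unit_interval (\<lambda>t. \<Sum>n. x n * unit_cis t ^ n)"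
    and integral_circle_series:
      "(\<integral>t. (\<Sum>n. x n * unit_cis t ^ n) * cnj (unit_cis t ^ k) \<partial>unit_interval) = x k"
proof -
  interpret finite_measure unit_interval by (rule finite_measure_unit_interval)
  let ?F = "\<lambda>t. \<Sum>n. x n * unit_cis t ^ n"
  show "integrable unit_interval ?F"
    using integrable_mult_suminf[OF x, of unit_interval "\<lambda>_. 1" "\<lambda>n t. unit_cis t ^ n"]
    by (simp add: norm_power)
  have e: "integrable unit_interval (\<lambda>t. cnj (unit_cis t ^ k))"
    by (rule integrable_const_bound[of _ 1]) (auto simp: norm_power)
  have "(\<lambda>n. x n * (\<integral>t. cnj (unit_cis t ^ k) * unit_cis t ^ n \<partial>unit_interval))
      sums (\<integral>t. cnj (unit_cis t ^ k) * ?F t \<partial>unit_interval)"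
    by (rule sums_integral_mult_suminf[OF x e]) (auto simp: norm_power)
  moreover have "x n * (\<integral>t. cnj (unit_cis t ^ k) * unit_cis t ^ n \<partial>unit_interval) = (if n = k then x k else 0)" for n
    using integral_unit_cis_power[of n k] by (simp add: mult.commute)
  ultimately have "(\<lambda>n. if n = k then x k else 0) sums (\<integral>t. cnj (unit_cis t ^ k) * ?F t \<partial>unit_interval)"
    by simp
  moreover have "(\<lambda>n. if n = k then x k else 0) sums x k" by (rule sums_single)
  ultimately have "(\<integral>t. cnj (unit_cis t ^ k) * ?F t \<partial>unit_interval) = x k" by (rule sums_unique2)
  then show "(\<integral>t. ?F t * cnj (unit_cis t ^ k) \<partial>unit_interval) = x k" by (simp add: mult.commute)
qed

text \<open>In |F|^2 = F * cnj F the second factor is expanded and integrated term by term against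
  the first, whose Fourier coefficients are known from
  \<open>integral_circle_series\<close>.\<close>

lemma circle_parseval:
  fixes x :: "nat \<Rightarrow> complex"
  assumes x: "summable (\<lambda>n. norm (x n))"
  shows "(\<lambda>n. (norm (x n))\<^sup>2) sums (\<integral>t. (norm (\<Sum>n. x n * unit_cis t ^ n))\<^sup>2 \<partial>unit_interval)"
    "integrable unit_interval (\<lambda>t. (norm (\<Sum>n. x n * unit_cis t ^ n))\<^sup>2)"
proof -
  let ?F = "\<lambda>t. \<Sum>n. x n * unit_cis t ^ n"
  note F = integrable_circle_series[OF x]
  have x': "summable (\<lambda>n. norm (cnj (x n)))" using x by simp
  have cF: "cnj (?F t) = (\<Sum>n. cnj (x n) * cnj (unit_cis t ^ n))" for t
  proof -
    have "summable (\<lambda>n. x n * unit_cis t ^ n)"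
      by (rule summable_norm_cancel) (simp add: norm_mult norm_power x)
    then have "(\<lambda>n. cnj (x n * unit_cis t ^ n)) sums cnj (?F t)"
      by (simp add: sums_cnj summable_sums del: complex_cnj_mult complex_cnj_power)
    then show ?thesis by (simp add: sums_iff)
  qed
  have sq: "?F t * (\<Sum>n. cnj (x n) * cnj (unit_cis t ^ n)) = of_real ((norm (?F t))\<^sup>2)" for t
    unfolding cF[symmetric] by (rule complex_norm_square[symmetric])
  have int: "integrable unit_interval (\<lambda>t. ?F t * (\<Sum>n. cnj (x n) * cnj (unit_cis t ^ n)))"
    by (rule integrable_mult_suminf[OF x' F]) (auto simp: norm_power)
  then have "integrable unit_interval (\<lambda>t. complex_of_real ((norm (?F t))\<^sup>2))" unfolding sq .
  then show I: "integrable unit_interval (\<lambda>t. (norm (?F t))\<^sup>2)"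
    using integrable_Re by fastforce
  have "(\<lambda>n. cnj (x n) * (\<integral>t. ?F t * cnj (unit_cis t ^ n) \<partial>unit_interval))
      sums (\<integral>t. ?F t * (\<Sum>n. cnj (x n) * cnj (unit_cis t ^ n)) \<partial>unit_interval)"
    by (rule sums_integral_mult_suminf[OF x' F]) (auto simp: norm_power)
  moreover have "cnj (x n) * (\<integral>t. ?F t * cnj (unit_cis t ^ n) \<partial>unit_interval) = complex_of_real ((norm (x n))\<^sup>2)" for n
    using integral_circle_series[OF x, of n] complex_norm_square[of "x n"] by (simp add: mult.commute)
  ultimately have "(\<lambda>n. complex_of_real ((norm (x n))\<^sup>2)) sums (complex_of_real (\<integral>t. (norm (?F t))\<^sup>2 \<partial>unit_interval))"
    unfolding sq by (simp del: of_real_power)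
  then show "(\<lambda>n. (norm (x n))\<^sup>2) sums (\<integral>t. (norm (?F t))\<^sup>2 \<partial>unit_interval)"
    by (simp only: sums_of_real_iff)
qed

section \<open>Power series in the open unit disc\<close>

definition psum :: "(nat \<Rightarrow> complex) \<Rightarrow> complex \<Rightarrow> complex" where
  "psum x w = (\<Sum>n. x n * w ^ n)"

text \<open>Absolute convergence is built in because termwise integration asks for it;
  \<open>disc_coeffsI\<close> obtains it from plain convergence at all points of the disc.\<close>

definition disc_coeffs :: "(nat \<Rightarrow> complex) \<Rightarrow> bool" where
  "disc_coeffs x \<longleftrightarrow> (\<forall>w. norm w < 1 \<longrightarrow> summable (\<lambda>n. norm (x n * w ^ n)))"

lemma disc_coeffsD: "disc_coeffs x \<Longrightarrow> norm w < 1 \<Longrightarrow> summable (\<lambda>n. norm (x n * w ^ n))"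
  by (simp add: disc_coeffs_def)

lemma disc_coeffs_sums: "disc_coeffs x \<Longrightarrow> norm w < 1 \<Longrightarrow> (\<lambda>n. x n * w ^ n) sums psum x w"
  unfolding psum_def by (rule summable_sums[OF summable_norm_cancel[OF disc_coeffsD]])

lemma disc_coeffsI:
  assumes "\<And>w. norm w < 1 \<Longrightarrow> summable (\<lambda>n. x n * w ^ n)"
  shows "disc_coeffs x"
  unfolding disc_coeffs_def
proof safe
  fix w :: complex assume w: "norm w < 1"
  define r where "r = (1 + norm w) / 2"
  have r: "norm w < r" "r < 1" "0 < r" using w norm_ge_zero[of w] by (auto simp: r_def add_pos_nonneg)
  have "summable (\<lambda>n. x n * of_real r ^ n)" using r by (intro assms) auto
  then show "summable (\<lambda>n. norm (x n * w ^ n))" by (rule powser_insidea) (use r in auto)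
qed

lemma disc_coeffs_diffs: "disc_coeffs x \<Longrightarrow> disc_coeffs (diffs x)"
  by (intro disc_coeffsI termdiff_converges[where K=1]) (auto intro: summable_norm_cancel[OF disc_coeffsD])

text \<open>The factor n + 1 arises by differentiating the series shifted by one place.\<close>

lemma disc_coeffs_mult_Suc:
  assumes "disc_coeffs x" shows "disc_coeffs (\<lambda>n. of_nat (Suc n) * x n)"
proof -
  define y where "y n = (if n = 0 then 0 else x (n - 1))" for n
  have "disc_coeffs y"
  proof (rule disc_coeffsI)
    fix w :: complex assume "norm w < 1"
    then have "summable (\<lambda>n. w * (x n * w ^ n))"
      using assms by (intro summable_mult summable_norm_cancel[OF disc_coeffsD])
    then have "summable (\<lambda>n. y (Suc n) * w ^ Suc n)" by (simp add: y_def mult_ac)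
    then show "summable (\<lambda>n. y n * w ^ n)" by (subst (asm) summable_Suc_iff)
  qed
  moreover have "diffs y = (\<lambda>n. of_nat (Suc n) * x n)" by (simp add: diffs_def y_def)
  ultimately show ?thesis using disc_coeffs_diffs[of y] by simp
qed

lemma disc_coeffs_le:
  assumes "disc_coeffs y" "\<And>n. norm (x n) \<le> norm (y n)" shows "disc_coeffs x"
  unfolding disc_coeffs_def
proof safe
  fix w :: complex assume "norm w < 1"
  then show "summable (\<lambda>n. norm (x n * w ^ n))"
    by (intro summable_comparison_test'[OF disc_coeffsD[OF assms(1)], of w 0])
       (use assms(2) in \<open>auto simp: norm_mult intro!: mult_right_mono\<close>)
qed

lemma disc_coeffs_power: "disc_coeffs (\<lambda>n. of_nat (Suc n) ^ s)"
proof (induction s)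
  case 0
  have "disc_coeffs (\<lambda>n. 1)" by (rule disc_coeffsI) (simp add: summable_geometric)
  then show ?case by simp
next
  case (Suc s)
  from disc_coeffs_mult_Suc[OF this] show ?case by simp
qed

lemma disc_coeffs_poly_bound:
  assumes "\<And>n. norm (x n) \<le> A * real (Suc n) ^ s"
  shows "disc_coeffs x"
proof (rule disc_coeffs_le)
  show "disc_coeffs (\<lambda>n. of_real A * of_nat (Suc n) ^ s)"
    unfolding disc_coeffs_def
    using disc_coeffsD[OF disc_coeffs_power[of s], THEN summable_mult, of _ "norm A"]
    by (simp add: norm_mult mult_ac)
  show "norm (x n) \<le> norm (complex_of_real A * of_nat (Suc n) ^ s)" for n
  proof -
    have "A * real (Suc n) ^ s \<le> \<bar>A\<bar> * real (Suc n) ^ s" by (intro mult_right_mono) auto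
    also have "\<dots> = norm (complex_of_real A * of_nat (Suc n) ^ s)"
      by (simp only: norm_mult norm_power norm_of_real norm_of_nat)
    finally show ?thesis using assms[of n] by linarith
  qed
qed

lemma measurable_psum [measurable]: "psum x \<in> borel_measurable borel"
  unfolding psum_def[abs_def] by measurable

lemma holomorphic_psum: "disc_coeffs x \<Longrightarrow> psum x holomorphic_on ball 0 1"
  by (rule power_series_holomorphic[where a=x]) (use disc_coeffs_sums in auto)

lemma holomorphic_eq_psum:
  assumes "g holomorphic_on ball 0 1"
  obtains x where "disc_coeffs x" "\<And>w. norm w < 1 \<Longrightarrow> g w = psum x w"
proof -
  define x where "x n = (deriv ^^ n) g 0 / fact n" for n
  have s: "(\<lambda>n. x n * w ^ n) sums g w" if "norm w < 1" for w
    using holomorphic_power_series[OF assms, of w] that by (simp add: x_def)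
  show ?thesis
  proof
    show "disc_coeffs x" using s by (intro disc_coeffsI) (auto simp: sums_iff)
    show "g w = psum x w" if "norm w < 1" for w using s[OF that] by (simp add: psum_def sums_iff)
  qed
qed

text \<open>The coefficients of (1 - w) times the series with coefficients x.\<close>

definition coeff_diff :: "(nat \<Rightarrow> complex) \<Rightarrow> nat \<Rightarrow> complex" where
  "coeff_diff x n = (if n = 0 then x 0 else x n - x (n - 1))"

lemma coeff_diff_sums:
  assumes "disc_coeffs x" "norm w < 1"
  shows "(\<lambda>n. coeff_diff x n * w ^ n) sums ((1 - w) * psum x w)"
proof -
  have s: "(\<lambda>n. x n * w ^ n) sums psum x w" using disc_coeffs_sums assms .
  have "(\<lambda>n. if n = 0 then 0 else x (n - 1) * w ^ n) sums (w * psum x w)"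
  proof -
    have "(\<lambda>n. w * (x n * w ^ n)) sums (w * psum x w)" by (rule sums_mult[OF s])
    then have "(\<lambda>n. (if Suc n = 0 then 0 else x (Suc n - 1) * w ^ Suc n)) sums (w * psum x w)"
      by (simp add: mult_ac)
    then show ?thesis by (subst (asm) sums_Suc_iff) simp
  qed
  from sums_diff[OF s this]
  have "(\<lambda>n. x n * w ^ n - (if n = 0 then 0 else x (n - 1) * w ^ n)) sums (psum x w - w * psum x w)" .
  moreover have "(\<lambda>n. x n * w ^ n - (if n = 0 then 0 else x (n - 1) * w ^ n)) = (\<lambda>n. coeff_diff x n * w ^ n)"
    by (auto simp: coeff_diff_def algebra_simps)
  ultimately show ?thesis by (simp add: algebra_simps)
qed

lemma disc_coeffs_coeff_diff: "disc_coeffs x \<Longrightarrow> disc_coeffs (coeff_diff x)"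
  using coeff_diff_sums by (intro disc_coeffsI) (auto simp: sums_iff)

lemma psum_coeff_diff: "disc_coeffs x \<Longrightarrow> norm w < 1 \<Longrightarrow> psum (coeff_diff x) w = (1 - w) * psum x w"
  using coeff_diff_sums[of x w] by (simp add: psum_def sums_iff)

text \<open>Takes values in \<open>ennreal\<close>, so no integrability has to be carried along. It
  is attached to a point w rather than to its radius because it will be evaluated at products a *
  z.\<close>

definition circle_mean :: "(complex \<Rightarrow> complex) \<Rightarrow> complex \<Rightarrow> ennreal" where
  "circle_mean F w = (\<integral>\<^sup>+t. ennreal (norm (F (w * unit_cis t))) \<partial>unit_interval)"

lemma nn_integral_psum_square:
  assumes "disc_coeffs x" "norm w < 1"
  shows "(\<integral>\<^sup>+t. ennreal ((norm (psum x (w * unit_cis t)))\<^sup>2) \<partial>unit_interval) = ennreal (\<Sum>n. (norm (x n) * norm w ^ n)\<^sup>2)"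
proof -
  have x: "summable (\<lambda>n. norm (x n * w ^ n))" using disc_coeffsD assms .
  have eq: "psum x (w * unit_cis t) = (\<Sum>n. (x n * w ^ n) * unit_cis t ^ n)" for t
    by (simp add: psum_def power_mult_distrib mult_ac)
  show ?thesis unfolding eq
    using circle_parseval[OF x]
    by (subst nn_integral_eq_integral) (auto simp: sums_iff norm_mult norm_power)
qed

text \<open>Cauchy--Schwarz after multiplying and dividing by \<open>1 - w\<close>: Parseval evaluates the mean square
  of \<open>1 / (1 - w)\<close>, and multiplication by \<open>1 - w\<close> turns coefficients into differences.\<close>

lemma circle_mean_square_le:
  assumes x: "disc_coeffs x" and w: "norm w < 1"
  shows "(circle_mean (psum x) w)\<^sup>2 \<le> ennreal (1 / (1 - (norm w)\<^sup>2)) * ennreal (\<Sum>n. (norm (coeff_diff x n) * norm w ^ n)\<^sup>2)"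
proof -
  have one: "disc_coeffs (\<lambda>_. 1)"
    by (rule disc_coeffs_poly_bound[where A=1 and s=0]) simp
  have n1: "norm (w * unit_cis t) < 1" for t using w by (simp add: norm_mult)
  have g: "psum (\<lambda>_. 1) u = 1 / (1 - u)" if "norm u < 1" for u
    using suminf_geometric[OF that] by (simp add: psum_def)
  have "(circle_mean (psum x) w)\<^sup>2 = (\<integral>\<^sup>+t. ennreal (norm (psum (\<lambda>_. 1) (w * unit_cis t))) * ennreal (norm (psum (coeff_diff x) (w * unit_cis t))) \<partial>unit_interval)\<^sup>2"
  proof -
    have "norm (psum x (w * unit_cis t)) = norm (psum (\<lambda>_. 1) (w * unit_cis t)) * norm (psum (coeff_diff x) (w * unit_cis t))" for t
    proof -
      have "w * unit_cis t \<noteq> 1" using n1[of t] by auto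
      then show ?thesis using n1[of t] by (simp add: g psum_coeff_diff[OF x] norm_mult[symmetric])
    qed
    then show ?thesis by (simp add: circle_mean_def ennreal_mult)
  qed
  also have "\<dots> \<le> (\<integral>\<^sup>+t. ennreal (norm (psum (\<lambda>_. 1) (w * unit_cis t))) ^ 2 \<partial>unit_interval)
      * (\<integral>\<^sup>+t. ennreal (norm (psum (coeff_diff x) (w * unit_cis t))) ^ 2 \<partial>unit_interval)"
    by (rule Cauchy_Schwarz_nn_integral) measurable
  also have "\<dots> = ennreal (\<Sum>n. (norm (1::complex) * norm w ^ n)\<^sup>2) * ennreal (\<Sum>n. (norm (coeff_diff x n) * norm w ^ n)\<^sup>2)"
    using nn_integral_psum_square[OF one w] nn_integral_psum_square[OF disc_coeffs_coeff_diff[OF x] w]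
    by (simp add: ennreal_power)
  also have "(\<Sum>n. (norm (1::complex) * norm w ^ n)\<^sup>2) = 1 / (1 - (norm w)\<^sup>2)"
    using suminf_geometric[of "(norm w)\<^sup>2"] w by (simp add: power_mult[symmetric] mult.commute power_strict_decreasing abs_square_less_1)
  finally show ?thesis .
qed

text \<open>The fundamental theorem of calculus on the segment from 0 to w, obtained termwise from
  the value 1 / (n + 1) of the integral of s^n over [0,1].\<close>

lemma psum_eq_integral_diffs:
  assumes x: "disc_coeffs x" and w: "norm w < 1"
  shows "psum x w = x 0 + w * (\<integral>s. psum (diffs x) (of_real s * w) \<partial>unit_interval)"
proof -
  interpret finite_measure unit_interval by (rule finite_measure_unit_interval)
  have d: "summable (\<lambda>n. norm (diffs x n * w ^ n))" using disc_coeffsD[OF disc_coeffs_diffs[OF x] w] .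
  have pow: "(\<integral>s. complex_of_real s ^ n \<partial>unit_interval) = 1 / of_nat (Suc n)" for n
  proof -
    have "(\<integral>s. complex_of_real s ^ n \<partial>unit_interval) = complex_of_real (\<integral>s. s ^ n \<partial>unit_interval)"
      by (simp flip: of_real_power)
    also have "(\<integral>s. s ^ n \<partial>unit_interval) = (\<integral>s. indicator {0..1} s *\<^sub>R s ^ n \<partial>lborel)"
      unfolding unit_interval_def by (rule integral_restrict_space) auto
    also have "\<dots> = 1 ^ Suc n / Suc n - 0 ^ Suc n / Suc n"
    proof (rule integral_FTC_atLeastAtMost)
      show "((\<lambda>s. s ^ Suc n / real (Suc n)) has_vector_derivative s ^ n) (at s within {0..1})" for s
        unfolding has_real_derivative_iff_has_vector_derivative[symmetric]
        by (rule derivative_eq_intros refl | simp)+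
    qed (auto intro!: continuous_intros)
    finally show ?thesis by simp
  qed
  have "(\<lambda>n. (diffs x n * w ^ n) * (\<integral>s. 1 * complex_of_real s ^ n \<partial>unit_interval))
      sums (\<integral>s. 1 * (\<Sum>n. (diffs x n * w ^ n) * complex_of_real s ^ n) \<partial>unit_interval)"
    by (rule sums_integral_mult_suminf[OF d]) (auto simp: norm_power power_le_one)
  then have "(\<lambda>n. x (Suc n) * w ^ n) sums (\<integral>s. psum (diffs x) (of_real s * w) \<partial>unit_interval)"
    by (simp add: pow diffs_def psum_def power_mult_distrib mult_ac field_simps del: of_nat_Suc)
  then have "(\<lambda>n. w * (x (Suc n) * w ^ n)) sums (w * (\<integral>s. psum (diffs x) (of_real s * w) \<partial>unit_interval))"
    by (rule sums_mult)
  then have "(\<lambda>n. x (Suc n) * w ^ Suc n) sums (w * (\<integral>s. psum (diffs x) (of_real s * w) \<partial>unit_interval))"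
    by (simp add: mult_ac)
  then have "(\<lambda>n. x n * w ^ n) sums (w * (\<integral>s. psum (diffs x) (of_real s * w) \<partial>unit_interval) + x 0 * w ^ 0)"
    by (rule sums_Suc)
  then show ?thesis by (simp add: psum_def sums_iff add.commute)
qed

lemma sigma_finite_unit_interval: "sigma_finite_measure unit_interval"
  using finite_measure_unit_interval by (simp add: finite_measure_def)

lemma sigma_finite_disc_area: "sigma_finite_measure disc_area"
  using finite_measure_disc_area by (simp add: finite_measure_def)

text \<open>The triangle inequality in \<open>psum_eq_integral_diffs\<close>, followed by Tonelli to
  exchange the integral along the radius with the mean over the circle.\<close>

lemma circle_mean_le_diffs:
  assumes x: "disc_coeffs x" and w: "norm w < 1"
  shows "circle_mean (psum x) w \<le> ennreal (norm (x 0)) + ennreal (norm w) *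
           (\<integral>\<^sup>+s. circle_mean (psum (diffs x)) (of_real s * w) \<partial>unit_interval)"
proof -
  interpret U: sigma_finite_measure unit_interval by (rule sigma_finite_unit_interval)
  interpret UU: pair_sigma_finite unit_interval unit_interval ..
  have [measurable]: "(\<lambda>q. fst q) \<in> borel_measurable (unit_interval \<Otimes>\<^sub>M unit_interval)"
      "(\<lambda>q. snd q) \<in> borel_measurable (unit_interval \<Otimes>\<^sub>M unit_interval)"
    by (rule measurable_compose[OF measurable_fst measurable_unit_interval_ident]
        measurable_compose[OF measurable_snd measurable_unit_interval_ident])+
  have [measurable]: "(\<lambda>q. ennreal (norm (psum (diffs x) (of_real (snd q) * w * unit_cis (fst q)))))
      \<in> borel_measurable (unit_interval \<Otimes>\<^sub>M unit_interval)"
    by measurable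
  have [measurable]: "(\<lambda>t. \<integral>\<^sup>+s. ennreal (norm (psum (diffs x) (of_real s * w * unit_cis t))) \<partial>unit_interval)
      \<in> borel_measurable unit_interval"
    by (rule U.borel_measurable_nn_integral) (simp add: case_prod_unfold)
  have pt: "ennreal (norm (psum x (w * unit_cis t))) \<le> ennreal (norm (x 0)) + ennreal (norm w) *
      (\<integral>\<^sup>+s. ennreal (norm (psum (diffs x) (of_real s * w * unit_cis t))) \<partial>unit_interval)" for t
  proof -
    have n1: "norm (w * unit_cis t) < 1" using w by (simp add: norm_mult)
    have m: "ennreal (norm (\<integral>s. psum (diffs x) (of_real s * (w * unit_cis t)) \<partial>unit_interval)) \<le>
        (\<integral>\<^sup>+s. ennreal (norm (psum (diffs x) (of_real s * (w * unit_cis t)))) \<partial>unit_interval)"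
    \<comment> \<open>In the other case the integral has the default value 0 and the estimate is
      trivial.\<close>
    proof (cases "integrable unit_interval (\<lambda>s. psum (diffs x) (of_real s * (w * unit_cis t)))")
      case True
      then show ?thesis by (intro integral_norm_bound_ennreal)
    qed (simp add: not_integrable_integral_eq)
    have "norm (psum x (w * unit_cis t)) \<le> norm (x 0) + norm w * norm (\<integral>s. psum (diffs x) (of_real s * (w * unit_cis t)) \<partial>unit_interval)"
      unfolding psum_eq_integral_diffs[OF x n1]
      by (rule order_trans[OF norm_triangle_ineq]) (simp add: norm_mult)
    then have "ennreal (norm (psum x (w * unit_cis t))) \<le> ennreal (norm (x 0)) + ennreal (norm w) * ennreal (norm (\<integral>s. psum (diffs x) (of_real s * (w * unit_cis t)) \<partial>unit_interval))"
      by (simp add: ennreal_mult[symmetric] ennreal_plus[symmetric] del: ennreal_plus)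
    also have "\<dots> \<le> ennreal (norm (x 0)) + ennreal (norm w) *
        (\<integral>\<^sup>+s. ennreal (norm (psum (diffs x) (of_real s * (w * unit_cis t)))) \<partial>unit_interval)"
      by (intro add_left_mono mult_left_mono m) auto
    finally show ?thesis by (simp add: mult.assoc)
  qed
  have "circle_mean (psum x) w \<le> (\<integral>\<^sup>+t. ennreal (norm (x 0)) + ennreal (norm w) *
      (\<integral>\<^sup>+s. ennreal (norm (psum (diffs x) (of_real s * w * unit_cis t))) \<partial>unit_interval) \<partial>unit_interval)"
    unfolding circle_mean_def by (intro nn_integral_mono pt)
  also have "\<dots> = ennreal (norm (x 0)) + ennreal (norm w) *
      (\<integral>\<^sup>+t. (\<integral>\<^sup>+s. ennreal (norm (psum (diffs x) (of_real s * w * unit_cis t))) \<partial>unit_interval) \<partial>unit_interval)"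
    by (subst nn_integral_add) (auto simp: nn_integral_cmult emeasure_unit_interval)
  also have "(\<integral>\<^sup>+t. (\<integral>\<^sup>+s. ennreal (norm (psum (diffs x) (of_real s * w * unit_cis t))) \<partial>unit_interval) \<partial>unit_interval)
     = (\<integral>\<^sup>+s. circle_mean (psum (diffs x)) (of_real s * w) \<partial>unit_interval)"
    unfolding circle_mean_def by (rule UU.Fubini') measurable
  finally show ?thesis .
qed

section \<open>Averaging over rotations\<close>

lemma nn_integral_disc_rotation:
  assumes f: "f \<in> borel_measurable disc_area" and c: "norm c = 1"
  shows "(\<integral>\<^sup>+z. f (c * z) \<partial>disc_area) = (\<integral>\<^sup>+z. f z \<partial>disc_area)"
  using nn_integral_distr[OF measurable_disc_rotation[OF c], of f] f
  by (simp add: distr_disc_area_rotation[OF c])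

lemma integral_disc_rotation:
  fixes f :: "complex \<Rightarrow> complex"
  assumes f: "f \<in> borel_measurable disc_area" and c: "norm c = 1"
  shows "(\<integral>z. f (c * z) \<partial>disc_area) = (\<integral>z. f z \<partial>disc_area)"
  using integral_distr[OF measurable_disc_rotation[OF c] f]
  by (simp add: distr_disc_area_rotation[OF c])

text \<open>The left side does not change when z is replaced by \<open>unit_cis t\<close> * z, so it
  equals its own mean over t; Tonelli moves that mean inside, where only F still depends on
  t.\<close>

lemma nn_integral_disc_circle_mean:
  assumes F[measurable]: "F \<in> borel_measurable borel"
    and \<phi>[measurable]: "(\<lambda>z. \<phi> (norm z) :: ennreal) \<in> borel_measurable disc_area"
  shows "(\<integral>\<^sup>+z. ennreal (norm (F (a * z))) * \<phi> (norm z) \<partial>disc_area) =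
    (\<integral>\<^sup>+z. circle_mean F (a * z) * \<phi> (norm z) \<partial>disc_area)"
proof -
  interpret U: sigma_finite_measure unit_interval by (rule sigma_finite_unit_interval)
  interpret D: sigma_finite_measure disc_area by (rule sigma_finite_disc_area)
  interpret pair_sigma_finite disc_area unit_interval ..
  have [measurable]: "(\<lambda>q. fst q) \<in> borel_measurable (disc_area \<Otimes>\<^sub>M unit_interval)"
      "(\<lambda>q. unit_cis (snd q)) \<in> borel_measurable (disc_area \<Otimes>\<^sub>M unit_interval)"
      "(\<lambda>q. \<phi> (norm (fst q))) \<in> borel_measurable (disc_area \<Otimes>\<^sub>M unit_interval)"
    by (rule measurable_compose[OF measurable_fst measurable_disc_area_ident]
        measurable_compose[OF measurable_snd measurable_compose[OF measurable_unit_interval_ident measurable_unit_cis]]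
        measurable_compose[OF measurable_fst \<phi>])+
  have "(\<integral>\<^sup>+z. ennreal (norm (F (a * z))) * \<phi> (norm z) \<partial>disc_area) =
    (\<integral>\<^sup>+t. (\<integral>\<^sup>+z. ennreal (norm (F (a * z))) * \<phi> (norm z) \<partial>disc_area) \<partial>unit_interval)"
    by (simp add: emeasure_unit_interval)
  also have "\<dots> = (\<integral>\<^sup>+t. (\<integral>\<^sup>+z. ennreal (norm (F (a * (unit_cis t * z)))) * \<phi> (norm (unit_cis t * z)) \<partial>disc_area) \<partial>unit_interval)"
    by (intro nn_integral_cong nn_integral_disc_rotation[symmetric]) auto
  also have "\<dots> = (\<integral>\<^sup>+t. (\<integral>\<^sup>+z. ennreal (norm (F (a * z * unit_cis t))) * \<phi> (norm z) \<partial>disc_area) \<partial>unit_interval)"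
    by (simp add: norm_mult mult_ac)
  also have "\<dots> = (\<integral>\<^sup>+z. (\<integral>\<^sup>+t. ennreal (norm (F (a * z * unit_cis t))) * \<phi> (norm z) \<partial>unit_interval) \<partial>disc_area)"
    by (rule Fubini') measurable
  also have "\<dots> = (\<integral>\<^sup>+z. circle_mean F (a * z) * \<phi> (norm z) \<partial>disc_area)"
    unfolding circle_mean_def by (intro nn_integral_cong nn_integral_multc) measurable
  finally show ?thesis .
qed

lemma integral_disc_monomials_orthogonal:
  fixes g :: "real \<Rightarrow> complex"
  assumes g[measurable]: "(\<lambda>z. g (norm z)) \<in> borel_measurable disc_area" and "m \<noteq> k"
  shows "(\<integral>z. z ^ m * cnj z ^ k * g (norm z) \<partial>disc_area) = 0"
proof -
  \<comment> \<open>Rotation by the angle d multiplies z^m cnj(z)^k by exp(i (m - k) d) = -1, so the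
    integral equals its negative.\<close>
  define d where "d = pi / (real m - real k)"
  define c where "c = cis d"
  have c: "norm c = 1" by (simp add: c_def)
  have "(real m - real k) * d = pi" using \<open>m \<noteq> k\<close> by (simp add: d_def)
  then have "real m * d - real k * d = pi" by (simp add: left_diff_distrib)
  then have cc: "c ^ m * cnj c ^ k = -1"
    by (simp add: c_def Complex.DeMoivre cis_cnj cis_mult)
  define I where "I = (\<integral>z. z ^ m * cnj z ^ k * g (norm z) \<partial>disc_area)"
  have "I = (\<integral>z. (c * z) ^ m * cnj (c * z) ^ k * g (norm (c * z)) \<partial>disc_area)"
    unfolding I_def by (rule integral_disc_rotation[symmetric, OF _ c]) measurable
  also have "\<dots> = (\<integral>z. (c ^ m * cnj c ^ k) * (z ^ m * cnj z ^ k * g (norm z)) \<partial>disc_area)"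
    by (simp add: norm_mult c power_mult_distrib mult_ac)
  also have "\<dots> = - I" unfolding cc I_def by simp
  finally show ?thesis unfolding I_def by simp
qed

text \<open>Serves both as an exhaustion of the disc and as the radius at which the tail governs the
  moment of order 2 j + 1. The shift by 2 keeps it strictly between 0 and 1 already at j =
  0.\<close>

definition inner_radius :: "nat \<Rightarrow> real" where "inner_radius j = 1 - 1 / real (j + 2)"

lemma inner_radius_bounds: "0 < inner_radius j" "inner_radius j < 1"
  by (auto simp: inner_radius_def field_simps)

lemma inner_radius_tendsto: "inner_radius \<longlonglongrightarrow> 1"
proof -
  have "(\<lambda>j. 1 - 1 / real (j + 2)) \<longlonglongrightarrow> 1 - 0"
    by (intro tendsto_intros LIMSEQ_ignore_initial_segment[OF lim_1_over_n])
  then show ?thesis by (simp add: inner_radius_def[abs_def])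
qed

lemma inner_radius_eventually: "norm (z::complex) < 1 \<Longrightarrow> eventually (\<lambda>j. norm z \<le> inner_radius j) sequentially"
  using order_tendstoD(1)[OF inner_radius_tendsto, of "norm z"] by (auto elim: eventually_mono)

lemma integrable_disc_times_bounded:
  fixes D :: "complex \<Rightarrow> complex"
  assumes D: "integrable disc_area D" and [measurable]: "h \<in> borel_measurable disc_area"
    and b: "\<And>z. norm z < 1 \<Longrightarrow> norm (h z) \<le> B"
  shows "integrable disc_area (\<lambda>z. D z * h z)"
proof (rule Bochner_Integration.integrable_bound)
  show "integrable disc_area (\<lambda>z. of_real B * D z)" using D by simp
  have [measurable]: "D \<in> borel_measurable disc_area" using D by auto
  show "(\<lambda>z. D z * h z) \<in> borel_measurable disc_area" by measurable
  have "norm (D z * h z) \<le> norm (of_real B * D z)" if "norm z < 1" for z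
  proof -
    have "norm (D z) * norm (h z) \<le> norm (D z) * \<bar>B\<bar>"
      using b[OF that] by (intro mult_left_mono) auto
    then show ?thesis by (simp add: norm_mult mult.commute)
  qed
  then show "AE z in disc_area. norm (D z * h z) \<le> norm (of_real B * D z)"
    by (intro AE_I2) auto
qed

text \<open>Integrability is given only for the product of the sum with the weight, which does not
  allow termwise integration over the whole disc. On the disc of radius
  \<open>inner_radius j\<close> it is allowed, orthogonality leaves the k-th term, and dominated
  convergence removes the cutoff.\<close>

lemma integral_psum_monomial:
  fixes g :: "real \<Rightarrow> real"
  assumes x: "disc_coeffs x"
    and g: "integrable disc_area (\<lambda>z. complex_of_real (g (norm z)))"
    and u: "integrable disc_area (\<lambda>z. psum x z * complex_of_real (g (norm z)))"
  shows "(\<integral>z. psum x z * cnj z ^ k * of_real (g (norm z)) \<partial>disc_area) =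
     x k * (\<integral>z. of_real (norm z ^ (2 * k) * g (norm z)) \<partial>disc_area)"
proof -
  have [measurable]: "(\<lambda>z. complex_of_real (g (norm z))) \<in> borel_measurable disc_area" using g by auto
  define S where "S j z = (indicator {z. norm z \<le> inner_radius j} z :: complex)" for j and z :: complex
  have [measurable]: "S j \<in> borel_measurable borel" for j unfolding S_def by measurable
  have S1: "norm (S j z) \<le> 1" for j z by (simp add: S_def indicator_def)
  have Slim: "(\<lambda>j. S j z) \<longlonglongrightarrow> 1" if "norm z < 1" for z :: complex
  proof (rule tendsto_eventually)
    show "eventually (\<lambda>j. S j z = 1) sequentially"
      using inner_radius_eventually[OF that] by eventually_elim (simp add: S_def)
  qed
  have pw: "norm (cnj z ^ k) \<le> 1" if "norm z < 1" for z
    using that by (simp add: norm_power power_le_one)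
  have i1: "integrable disc_area (\<lambda>z. psum x z * of_real (g (norm z)) * cnj z ^ k)"
    by (rule integrable_disc_times_bounded[OF u _ pw]) measurable
  have i2: "integrable disc_area (\<lambda>z. complex_of_real (g (norm z)) * (complex_of_real (norm z) ^ (2 * k)))"
    by (rule integrable_disc_times_bounded[OF g, where B=1]) (auto simp: norm_power power_le_one)
  have eq: "(\<integral>z. S j z * (psum x z * of_real (g (norm z)) * cnj z ^ k) \<partial>disc_area) =
      x k * (\<integral>z. S j z * (of_real (g (norm z)) * of_real (norm z) ^ (2 * k)) \<partial>disc_area)" for j
  proof -
    let ?R = "complex_of_real (inner_radius j)"
    have R: "0 < inner_radius j" "inner_radius j < 1" using inner_radius_bounds by auto
    have sm: "summable (\<lambda>n. norm (x n * ?R ^ n))" by (rule disc_coeffsD[OF x]) (use R in auto)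
    have G: "integrable disc_area (\<lambda>z. of_real (g (norm z)) * (S j z * cnj z ^ k))"
      by (rule integrable_disc_times_bounded[OF g, where B=1])
         (auto simp: norm_mult S_def indicator_def pw)
    have e1: "norm (S j z * (z / ?R) ^ n) \<le> 1" for n z
      using R by (auto simp: S_def indicator_def norm_power norm_divide intro!: power_le_one)
    \<comment> \<open>Powers of z are rescaled to powers of z / R, which the cutoff
      \<open>S j\<close> keeps bounded by one; the factors R^n go into the coefficients and make
      them summable.\<close>
    have "(\<lambda>n. (x n * ?R ^ n) * (\<integral>z. of_real (g (norm z)) * (S j z * cnj z ^ k) * (S j z * (z / ?R) ^ n) \<partial>disc_area))
      sums (\<integral>z. of_real (g (norm z)) * (S j z * cnj z ^ k) * (\<Sum>n. (x n * ?R ^ n) * (S j z * (z / ?R) ^ n)) \<partial>disc_area)"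
      by (rule sums_integral_mult_suminf[OF sm G _ e1]) measurable
    moreover have "of_real (g (norm z)) * (S j z * cnj z ^ k) * (\<Sum>n. (x n * ?R ^ n) * (S j z * (z / ?R) ^ n))
        = S j z * (psum x z * of_real (g (norm z)) * cnj z ^ k)" for z
      using R by (auto simp: S_def indicator_def psum_def power_divide)
    moreover have "(x n * ?R ^ n) * (\<integral>z. of_real (g (norm z)) * (S j z * cnj z ^ k) * (S j z * (z / ?R) ^ n) \<partial>disc_area)
        = (if n = k then x k * (\<integral>z. S j z * (of_real (g (norm z)) * of_real (norm z) ^ (2 * k)) \<partial>disc_area) else 0)" for n
    proof -
      have "(x n * ?R ^ n) * (\<integral>z. of_real (g (norm z)) * (S j z * cnj z ^ k) * (S j z * (z / ?R) ^ n) \<partial>disc_area)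
         = x n * (\<integral>z. ?R ^ n * (of_real (g (norm z)) * (S j z * cnj z ^ k) * (S j z * (z / ?R) ^ n)) \<partial>disc_area)"
        by simp
      also have "(\<lambda>z. ?R ^ n * (of_real (g (norm z)) * (S j z * cnj z ^ k) * (S j z * (z / ?R) ^ n)))
         = (\<lambda>z. z ^ n * cnj z ^ k * (of_real (g (norm z)) * of_bool (norm z \<le> inner_radius j)))"
        using R by (auto simp: S_def indicator_def power_divide fun_eq_iff)
      finally have *: "(x n * ?R ^ n) * (\<integral>z. of_real (g (norm z)) * (S j z * cnj z ^ k) * (S j z * (z / ?R) ^ n) \<partial>disc_area)
         = x n * (\<integral>z. z ^ n * cnj z ^ k * (of_real (g (norm z)) * of_bool (norm z \<le> inner_radius j)) \<partial>disc_area)" .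
      show ?thesis
      proof (cases "n = k")
        case True
        have "z ^ k * cnj z ^ k = of_real (norm z) ^ (2 * k)" for z
          by (metis complex_norm_square of_real_power power_mult power_mult_distrib)
        then have "(\<lambda>z. z ^ k * cnj z ^ k * (complex_of_real (g (norm z)) * of_bool (norm z \<le> inner_radius j))) =
            (\<lambda>z. S j z * (of_real (g (norm z)) * of_real (norm z) ^ (2 * k)))"
          by (auto simp: S_def indicator_def fun_eq_iff)
        then show ?thesis unfolding * using True by simp
      next
        case False
        have m: "(\<lambda>z. complex_of_real (g (norm z)) * of_bool (norm z \<le> inner_radius j)) \<in> borel_measurable disc_area"
          by measurable
        show ?thesis unfolding *
          using False integral_disc_monomials_orthogonal[of "\<lambda>r. complex_of_real (g r) * of_bool (r \<le> inner_radius j)", OF m False]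
          by simp
      qed
    qed
    ultimately have "(\<lambda>n. if n = k then x k * (\<integral>z. S j z * (of_real (g (norm z)) * of_real (norm z) ^ (2 * k)) \<partial>disc_area) else 0)
        sums (\<integral>z. S j z * (psum x z * of_real (g (norm z)) * cnj z ^ k) \<partial>disc_area)" by simp
    moreover have "(\<lambda>n. if n = k then x k * (\<integral>z. S j z * (of_real (g (norm z)) * of_real (norm z) ^ (2 * k)) \<partial>disc_area) else 0)
        sums (x k * (\<integral>z. S j z * (of_real (g (norm z)) * of_real (norm z) ^ (2 * k)) \<partial>disc_area))"
      by (rule sums_single)
    ultimately show ?thesis by (rule sums_unique2)
  qed
  have dom: "(\<lambda>j. \<integral>z. S j z * h z \<partial>disc_area) \<longlonglongrightarrow> (\<integral>z. h z \<partial>disc_area)" if "integrable disc_area h" for h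
  proof (rule integral_dominated_convergence)
    have [measurable]: "h \<in> borel_measurable disc_area" using that by auto
    show "(\<lambda>z. S j z * h z) \<in> borel_measurable disc_area" for j by measurable
    show "integrable disc_area (\<lambda>z. norm (h z))" using that by simp
    show "AE z in disc_area. norm (S j z * h z) \<le> norm (h z)" for j
      using S1 by (intro AE_I2) (auto simp: norm_mult mult_left_le_one_le)
    show "AE z in disc_area. (\<lambda>j. S j z * h z) \<longlonglongrightarrow> h z"
    proof (intro AE_I2)
      fix z :: complex assume "z \<in> space disc_area"
      then have "(\<lambda>j. S j z * h z) \<longlonglongrightarrow> 1 * h z" by (intro tendsto_intros Slim) auto
      then show "(\<lambda>j. S j z * h z) \<longlonglongrightarrow> h z" by simp
    qed
  qed (use that in auto)
  have "(\<lambda>j. x k * (\<integral>z. S j z * (of_real (g (norm z)) * of_real (norm z) ^ (2 * k)) \<partial>disc_area)) \<longlonglongrightarrow>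
      x k * (\<integral>z. of_real (g (norm z)) * of_real (norm z) ^ (2 * k) \<partial>disc_area)"
    by (intro tendsto_intros dom i2)
  moreover have "(\<lambda>j. x k * (\<integral>z. S j z * (of_real (g (norm z)) * of_real (norm z) ^ (2 * k)) \<partial>disc_area)) \<longlonglongrightarrow>
      (\<integral>z. psum x z * of_real (g (norm z)) * cnj z ^ k \<partial>disc_area)"
    unfolding eq[symmetric] by (rule dom[OF i1])
  ultimately have "(\<integral>z. psum x z * of_real (g (norm z)) * cnj z ^ k \<partial>disc_area) =
      x k * (\<integral>z. of_real (g (norm z)) * of_real (norm z) ^ (2 * k) \<partial>disc_area)"
    using LIMSEQ_unique by blast
  then show ?thesis by (simp add: mult_ac)
qed

section \<open>Bounded analytic functions and vanishing moments\<close>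

lemma Hinf_measurable:
  assumes "g \<in> Hinf_space" shows "g \<in> borel_measurable disc_area"
proof -
  have "continuous_on (ball 0 1) g" using assms
    by (auto simp: Hinf_space_def intro: holomorphic_on_imp_continuous_on)
  then have "g \<in> borel_measurable (lebesgue_on (ball 0 1))"
    by (intro continuous_imp_measurable_on_sets_lebesgue) auto
  then show ?thesis by (simp add: disc_area_def)
qed

lemma Hinf_bounded:
  assumes "g \<in> Hinf_space" obtains B where "0 \<le> B" "\<And>z. norm z < 1 \<Longrightarrow> norm (g z) \<le> B"
proof -
  from assms obtain B where "\<And>z. z \<in> ball 0 1 \<Longrightarrow> norm (g z) \<le> B"
    unfolding Hinf_space_def bounded_iff by blast
  then show ?thesis using that[of "max 0 B"] by (force simp: le_max_iff_disj)
qed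

text \<open>The power series of a dilate z \<mapsto> g(R z) with R < 1 converges absolutely up to
  the circle, so its conjugate can be integrated term by term against D. As R tends to 1 the dilates
  converge pointwise and stay below the bound of g.\<close>

lemma integral_cnj_Hinf_eq_0:
  fixes D :: "complex \<Rightarrow> complex"
  assumes D: "integrable disc_area D" and z: "\<And>k. (\<integral>z. D z * cnj z ^ k \<partial>disc_area) = 0"
    and g: "g \<in> Hinf_space"
  shows "(\<integral>z. D z * cnj (g z) \<partial>disc_area) = 0"
proof -
  have [measurable]: "D \<in> borel_measurable disc_area" using D by auto
  note [measurable] = Hinf_measurable[OF g]
  have hol: "g holomorphic_on ball 0 1" using g by (simp add: Hinf_space_def)
  obtain x where x: "disc_coeffs x" "\<And>w. norm w < 1 \<Longrightarrow> g w = psum x w"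
    using holomorphic_eq_psum[OF hol] by blast
  obtain B where B: "0 \<le> B" "\<And>z. norm z < 1 \<Longrightarrow> norm (g z) \<le> B" using Hinf_bounded[OF g] by blast
  let ?R = "\<lambda>j. complex_of_real (inner_radius j)"
  have R1: "norm (?R j * z) < 1" if "norm z < 1" for j z
    using mult_strict_mono'[of "inner_radius j" 1 "norm z" 1] inner_radius_bounds[of j] that
    by (simp add: norm_mult)
  have zero: "(\<integral>z. D z * cnj (psum x (?R j * z)) \<partial>disc_area) = 0" for j
  proof -
    have sm: "summable (\<lambda>n. norm (cnj (x n * ?R j ^ n)))"
      using disc_coeffsD[OF x(1), of "?R j"] inner_radius_bounds[of j] by (simp add: norm_mult)
    have "(\<lambda>n. cnj (x n * ?R j ^ n) * (\<integral>z. D z * cnj z ^ n \<partial>disc_area)) sums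
      (\<integral>z. D z * (\<Sum>n. cnj (x n * ?R j ^ n) * cnj z ^ n) \<partial>disc_area)"
      by (rule sums_integral_mult_suminf[OF sm D]) (auto simp: norm_power power_le_one)
    then have "(\<integral>z. D z * (\<Sum>n. cnj (x n * ?R j ^ n) * cnj z ^ n) \<partial>disc_area) = 0"
      by (simp add: z sums_iff)
    moreover have "(\<Sum>n. cnj (x n * ?R j ^ n) * cnj z ^ n) = cnj (psum x (?R j * z))" if "norm z < 1" for z
    proof -
      have "(\<lambda>n. cnj (x n * (?R j * z) ^ n)) sums cnj (psum x (?R j * z))"
        using disc_coeffs_sums[OF x(1) R1[OF that, of j]] unfolding sums_cnj .
      then show ?thesis by (simp add: sums_iff power_mult_distrib mult_ac)
    qed
    then have "(\<integral>z. D z * cnj (psum x (?R j * z)) \<partial>disc_area)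
        = (\<integral>z. D z * (\<Sum>n. cnj (x n * ?R j ^ n) * cnj z ^ n) \<partial>disc_area)"
      by (intro Bochner_Integration.integral_cong) auto
    ultimately show ?thesis by simp
  qed
  have "(\<lambda>j. \<integral>z. D z * cnj (psum x (?R j * z)) \<partial>disc_area) \<longlonglongrightarrow> (\<integral>z. D z * cnj (g z) \<partial>disc_area)"
  proof (rule integral_dominated_convergence)
    show "(\<lambda>z. D z * cnj (psum x (?R j * z))) \<in> borel_measurable disc_area" for j by measurable
    show "(\<lambda>z. D z * cnj (g z)) \<in> borel_measurable disc_area" by measurable
    show "integrable disc_area (\<lambda>z. norm (D z) * B)" using D by simp
    show "AE z in disc_area. norm (D z * cnj (psum x (?R j * z))) \<le> norm (D z) * B" for j
      using B(2)[OF R1] x(2)[OF R1] by (intro AE_I2) (auto simp: norm_mult intro!: mult_left_mono)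
    show "AE z in disc_area. (\<lambda>j. D z * cnj (psum x (?R j * z))) \<longlonglongrightarrow> D z * cnj (g z)"
    proof (intro AE_I2)
      fix z assume "z \<in> space disc_area"
      then have z: "norm z < 1" by simp
      have "(\<lambda>j. ?R j * z) \<longlonglongrightarrow> of_real 1 * z" by (intro tendsto_intros inner_radius_tendsto)
      moreover have "continuous (at z) g"
        using continuous_on_eq_continuous_at[of "ball 0 1" g] hol z
        by (auto intro: holomorphic_on_imp_continuous_on)
      ultimately have "(\<lambda>j. g (?R j * z)) \<longlonglongrightarrow> g z" by (auto intro: isCont_tendsto_compose)
      then have "(\<lambda>j. psum x (?R j * z)) \<longlonglongrightarrow> g z" using x(2)[OF R1[OF z]] by simp
      then show "(\<lambda>j. D z * cnj (psum x (?R j * z))) \<longlonglongrightarrow> D z * cnj (g z)" by (intro tendsto_intros)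
    qed
  qed
  then show ?thesis unfolding zero by (simp add: LIMSEQ_const_iff)
qed

section \<open>Radial weights and their moments\<close>

text \<open>The factor 2 r of the area measure is left out here; it reappears in
  \<open>nn_integral_disc_weight\<close>. The base measure is Lebesgue because the profile need not
  be Borel.\<close>

definition radial_measure :: "(real \<Rightarrow> real) \<Rightarrow> real measure" where
  "radial_measure \<omega> = density lebesgue (\<lambda>r. ennreal (indicator {0..<1} r * \<omega> r))"

text \<open>Agrees with \<^const>\<open>weight_tail\<close> only on \<open>[0, \<infinity>)\<close>: for negative arguments the latter also
  integrates the profile outside \<open>[0, 1)\<close>, whereas \<open>tail\<close> is antimonotone on the whole line.\<close>

definition tail :: "(real \<Rightarrow> real) \<Rightarrow> real \<Rightarrow> real" where
  "tail \<omega> r = measure (radial_measure \<omega>) {r..}"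

lemma space_radial_measure [simp]: "space (radial_measure \<omega>) = UNIV"
  by (simp add: radial_measure_def)

lemma sets_radial_measure: "sets (radial_measure \<omega>) = sets lebesgue"
  by (simp add: radial_measure_def)

lemma borel_sets_radial_measure [measurable, simp]: "A \<in> sets borel \<Longrightarrow> A \<in> sets (radial_measure \<omega>)"
  by (simp add: sets_radial_measure)

lemma measurable_lebesgue_borel: "f \<in> borel_measurable borel \<Longrightarrow> f \<in> borel_measurable lebesgue"
  by (rule measurable_completion) simp

lemma measurable_radial_measure_ident [measurable (raw)]: "(\<lambda>r. r) \<in> borel_measurable (radial_measure \<omega>)"
  using measurable_lebesgue_borel[of "\<lambda>r. r"] by (simp add: radial_measure_def)

text \<open>The power is at least exp(-2), since (1 + 1/(m + 1))^(m + 1) \<le> e, and e \<le> 3.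
  Hence r^(2 m + 1) is bounded below on the interval from \<open>inner_radius m\<close> to
  1.\<close>

lemma inner_radius_power_ge: "1 / 9 \<le> inner_radius m ^ (2 * m + 1)"
proof -
  have e: "(1 + 1 / real (m + 1)) ^ (m + 1) \<le> exp 1"
  proof -
    have "(1 + 1 / real (m + 1)) ^ (m + 1) \<le> exp (1 / real (m + 1)) ^ (m + 1)"
      by (intro power_mono exp_ge_add_one_self) auto
    also have "\<dots> = exp (real (m + 1) * (1 / real (m + 1)))" by (rule exp_of_nat_mult[symmetric])
    finally show ?thesis by simp
  qed
  have i: "inner_radius m = 1 / (1 + 1 / real (m + 1))" by (simp add: inner_radius_def field_simps)
  have "1 / 9 \<le> 1 / exp (1::real) ^ 2"
    using power_mono[of "exp (1::real)" 3 2] exp_le by (simp add: field_simps)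
  also have "\<dots> \<le> 1 / ((1 + 1 / real (m + 1)) ^ (m + 1)) ^ 2"
    using e by (intro divide_left_mono power_mono) (auto intro!: mult_pos_pos zero_less_power add_pos_nonneg)
  also have "\<dots> = inner_radius m ^ (2 * (m + 1))"
    by (simp only: i power_one_over power_mult[symmetric] mult.commute)
  also have "\<dots> \<le> inner_radius m ^ (2 * m + 1)"
    using inner_radius_bounds[of m] by (intro power_decreasing) auto
  finally show ?thesis .
qed

text \<open>The power r^m is the smallest of the m + 1 terms r^0, ..., r^m, whose sum times 1 - r
  telescopes to 1 - r^(m + 1).\<close>

lemma power_times_one_minus_le: "0 \<le> r \<Longrightarrow> r \<le> 1 \<Longrightarrow> r ^ m * (1 - r) \<le> 1 / real (m + 1)" for r :: real
proof -
  assume r: "0 \<le> r" "r \<le> 1"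
  have "real (m + 1) * (r ^ m * (1 - r)) = (\<Sum>i\<le>m. r ^ m * (1 - r))" by simp
  also have "\<dots> \<le> (\<Sum>i\<le>m. r ^ i * (1 - r))"
    using r by (intro sum_mono mult_right_mono power_decreasing) auto
  also have "\<dots> = 1 - r ^ Suc m"
    unfolding sum_distrib_right[symmetric] using sum_gp_basic[of r m] by (simp only: mult.commute)
  also have "\<dots> \<le> 1" using r by simp
  finally show ?thesis by (simp add: field_simps)
qed

lemma exp_fact_bound: "0 \<le> (x::real) \<Longrightarrow> x ^ n \<le> fact n * exp x"
proof -
  assume x: "0 \<le> x"
  have "(\<Sum>k\<in>{n}. x ^ k /\<^sub>R fact k) \<le> exp x"
    unfolding exp_def by (rule sum_le_suminf) (use summable_exp_generic[of x] x in auto)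
  then show ?thesis by (simp add: field_simps)
qed

text \<open>Finds the dyadic shell that contains x; the shell j = 0 also takes every smaller x,
  which is why it has no lower bound.\<close>

lemma dyadic_level:
  fixes x y :: real
  assumes "0 < y" obtains j :: nat where "x \<le> 2 ^ Suc j * y" "j = 0 \<or> 2 ^ j * y < x"
proof -
  obtain n :: nat where "x / y < 2 ^ n" using real_arch_pow[of 2 "x / y"] by auto
  then have ex: "\<exists>j. x \<le> 2 ^ Suc j * y" using assms 
  proof (intro exI[of _ n])
    have "x < 2 ^ n * y" using \<open>x / y < 2 ^ n\<close> assms by (simp add: field_simps)
    also have "\<dots> \<le> 2 ^ Suc n * y" using assms by simp
    finally show "x \<le> 2 ^ Suc n * y" by simp
  qed
  define j where "j = (LEAST j. x \<le> 2 ^ Suc j * y)"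
  have "x \<le> 2 ^ Suc j * y" unfolding j_def by (rule LeastI_ex[OF ex])
  moreover have "j = 0 \<or> 2 ^ j * y < x"
  proof (cases j)
    case (Suc i)
    then have "\<not> x \<le> 2 ^ Suc i * y" using not_less_Least[of i "\<lambda>j. x \<le> 2 ^ Suc j * y"] unfolding j_def by simp
    then show ?thesis using Suc by simp
  qed simp
  ultimately show ?thesis using that by blast
qed

section \<open>Tails and moments of a radial weight\<close>

locale weight =
  fixes \<omega> :: "real \<Rightarrow> real"
  assumes radial_weight: "radial_weight \<omega>"
begin

lemma nonneg: "0 \<le> r \<Longrightarrow> r < 1 \<Longrightarrow> 0 \<le> \<omega> r"
  using radial_weight by (auto simp: radial_weight_def)

lemma integrable_profile: "integrable lebesgue (\<lambda>r. indicator {0..<1} r * \<omega> r)"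
  using radial_weight by (simp add: radial_weight_def set_integrable_def)

lemma measurable_profile: "(\<lambda>r. indicator {0..<1} r * \<omega> r) \<in> borel_measurable lebesgue"
  using integrable_profile by auto

lemma measurable_profile_ennreal: "(\<lambda>r. ennreal (indicator {0..<1} r * \<omega> r)) \<in> borel_measurable lebesgue"
  by (rule measurable_compose[OF measurable_profile measurable_ennreal])

lemma AE_profile_nonneg: "AE r in M. 0 \<le> indicator {0..<1} r * \<omega> r"
  by (intro AE_I2) (auto simp: indicator_def nonneg)

lemma emeasure_radial: "A \<in> sets lebesgue \<Longrightarrow>
    emeasure (radial_measure \<omega>) A = (\<integral>\<^sup>+r. ennreal (indicator {0..<1} r * \<omega> r) * indicator A r \<partial>lebesgue)"
  unfolding radial_measure_def by (rule emeasure_density[OF measurable_profile_ennreal])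

lemma finite_measure_radial: "finite_measure (radial_measure \<omega>)"
proof (rule finite_measureI)
  have "emeasure (radial_measure \<omega>) UNIV = (\<integral>\<^sup>+r. ennreal (indicator {0..<1} r * \<omega> r) \<partial>lebesgue)"
    by (subst emeasure_radial) auto
  also have "\<dots> \<noteq> \<infinity>"
    using nn_integral_eq_integral[OF integrable_profile AE_profile_nonneg] by simp
  finally show "emeasure (radial_measure \<omega>) (space (radial_measure \<omega>)) \<noteq> \<infinity>" by simp
qed

sublocale radial: finite_measure "radial_measure \<omega>" by (rule finite_measure_radial)

lemma integral_radial:
  fixes f :: "real \<Rightarrow> real"
  assumes "f \<in> borel_measurable borel"
  shows "(\<integral>r. f r \<partial>radial_measure \<omega>) = set_lebesgue_integral lebesgue {0..<1} (\<lambda>r. f r * \<omega> r)"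
proof -
  have "(\<integral>r. f r \<partial>radial_measure \<omega>) = (\<integral>r. (indicator {0..<1} r * \<omega> r) *\<^sub>R f r \<partial>lebesgue)"
    unfolding radial_measure_def
    by (rule integral_density[OF measurable_lebesgue_borel[OF assms] measurable_profile AE_profile_nonneg])
  then show ?thesis by (simp add: set_lebesgue_integral_def mult_ac)
qed

lemma nn_integral_radial:
  assumes "f \<in> borel_measurable borel"
  shows "(\<integral>\<^sup>+r. f r \<partial>radial_measure \<omega>) = (\<integral>\<^sup>+r. ennreal (indicator {0..<1} r * \<omega> r) * f r \<partial>lebesgue)"
  unfolding radial_measure_def
  by (rule nn_integral_density[OF measurable_profile_ennreal measurable_lebesgue_borel[OF assms]])

lemma AE_radial: "AE r in radial_measure \<omega>. 0 \<le> r \<and> r < 1"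
proof -
  have "AE r in lebesgue. 0 < ennreal (indicator {0..<1} r * \<omega> r) \<longrightarrow> 0 \<le> r \<and> r < 1"
    by (rule AE_I2) (simp add: indicator_def)
  then show ?thesis
    unfolding radial_measure_def by (subst AE_density[OF measurable_profile_ennreal])
qed

lemma weight_tail_eq: "0 \<le> r \<Longrightarrow> weight_tail \<omega> r = tail \<omega> r"
proof -
  assume r: "0 \<le> r"
  have "tail \<omega> r = (\<integral>x. indicator {r..} x \<partial>radial_measure \<omega>)" by (simp add: tail_def)
  also have "\<dots> = set_lebesgue_integral lebesgue {0..<1} (\<lambda>x. indicator {r..} x * \<omega> x)"
    by (rule integral_radial) simp
  also have "\<dots> = weight_tail \<omega> r"
    unfolding weight_tail_def set_lebesgue_integral_def
    using r by (intro Bochner_Integration.integral_cong) (auto simp: indicator_def)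
  finally show ?thesis by simp
qed

lemma emeasure_tail: "emeasure (radial_measure \<omega>) {r..} = ennreal (tail \<omega> r)"
  unfolding tail_def by (rule radial.emeasure_eq_measure)

lemma tail_antimono: "r \<le> s \<Longrightarrow> tail \<omega> s \<le> tail \<omega> r"
  unfolding tail_def by (intro radial.finite_measure_mono) auto

lemma tail_pos: "r < 1 \<Longrightarrow> 0 < tail \<omega> r"
proof -
  assume "r < 1"
  then have "0 < weight_tail \<omega> (max 0 r)" using radial_weight by (simp add: radial_weight_def)
  then show ?thesis using weight_tail_eq[of "max 0 r"] tail_antimono[of r "max 0 r"] by simp
qed

lemma measurable_tail [measurable]: "tail \<omega> \<in> borel_measurable borel"
proof -
  have "(\<lambda>r. - tail \<omega> r) \<in> borel_measurable borel"
    by (intro borel_measurable_mono) (auto simp: mono_def tail_antimono)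
  then have "(\<lambda>r. - (- tail \<omega> r)) \<in> borel_measurable borel" by (rule borel_measurable_uminus)
  then show ?thesis by simp
qed

text \<open>The tail decreases, so the set is an interval with infimum a. Its part strictly beyond a
  is exhausted from the right, and the point a itself has no mass because the measure has a density.
  Thus \<open>tail\<close> is distributed at most like a uniform variable, which is the input of the
  Schur test.\<close>

lemma emeasure_tail_le:
  assumes "0 < y"
  shows "emeasure (radial_measure \<omega>) {r. 0 \<le> r \<and> r < 1 \<and> tail \<omega> r \<le> y} \<le> ennreal y"
proof -
  let ?\<mu> = "radial_measure \<omega>"
  define S where "S = {r. 0 \<le> r \<and> r < 1 \<and> tail \<omega> r \<le> y}"
  show ?thesis
  proof (cases "S = {}")
    case True then show ?thesis unfolding S_def[symmetric] by simp
  next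
    case False
    have bdd: "bdd_below S" by (auto simp: S_def intro: bdd_belowI[of _ 0])
    define a where "a = Inf S"
    have a0: "0 \<le> a" unfolding a_def using False by (intro cInf_greatest) (auto simp: S_def)
    \<comment> \<open>For each n some point b of the set lies below a + 1 / (n + 1), so the mass of
      \<open>A n\<close> is at most the tail at b.\<close>
    define A where "A n = {r. a + 1 / real (Suc n) \<le> r \<and> r < 1}" for n :: nat
    have Am: "A n \<in> sets ?\<mu>" for n unfolding A_def by simp
    have An: "emeasure ?\<mu> (A n) \<le> ennreal y" for n
    proof (cases "a + 1 / real (Suc n) < 1")
      case True
      have "a < a + 1 / real (Suc n)" by simp
      then obtain b where b: "b \<in> S" "b < a + 1 / real (Suc n)"
        using cInf_lessD[OF False, of "a + 1 / real (Suc n)"] unfolding a_def by blast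
      have "emeasure ?\<mu> (A n) \<le> emeasure ?\<mu> {b..}"
        using b by (intro emeasure_mono) (auto simp: A_def)
      also have "\<dots> \<le> ennreal y" unfolding emeasure_tail using b by (auto simp: S_def intro: ennreal_leI)
      finally show ?thesis .
    next
      case False
      then have "A n = {}" by (auto simp: A_def)
      then show ?thesis by simp
    qed
    have inc: "incseq A"
    proof (rule incseq_SucI)
      fix n show "A n \<subseteq> A (Suc n)"
        unfolding A_def by (auto simp: frac_le elim!: order_trans[rotated])
    qed
    have "emeasure ?\<mu> S \<le> emeasure ?\<mu> ({a} \<union> (\<Union>n. A n))"
    proof (rule emeasure_mono)
      show "S \<subseteq> {a} \<union> (\<Union>n. A n)"
      proof
        fix r assume r: "r \<in> S"
        then have "a \<le> r" unfolding a_def using bdd by (rule cInf_lower)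
        show "r \<in> {a} \<union> (\<Union>n. A n)"
        proof (cases "r = a")
          case False
          then obtain n where "inverse (real (Suc n)) < r - a"
            using reals_Archimedean[of "r - a"] \<open>a \<le> r\<close> by auto
          then have "r \<in> A n" using r by (auto simp: A_def S_def inverse_eq_divide)
          then show ?thesis by auto
        qed simp
      qed
    qed (use Am in \<open>intro sets.Un sets.countable_UN; auto\<close>)
    also have "\<dots> \<le> emeasure ?\<mu> {a} + emeasure ?\<mu> (\<Union>n. A n)"
      using Am by (intro emeasure_subadditive) auto
    also have "emeasure ?\<mu> {a} = 0"
    proof -
      have "AE r in lebesgue. r \<noteq> a" using AE_completion[OF AE_lborel_singleton[of a]] .
      then have "(\<integral>\<^sup>+r. ennreal (indicator {0..<1} r * \<omega> r) * indicator {a} r \<partial>lebesgue) = (\<integral>\<^sup>+r. 0 \<partial>(lebesgue :: real measure))"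
        by (intro nn_integral_cong_AE) (auto simp: indicator_def elim: eventually_mono)
      then show ?thesis by (subst emeasure_radial) auto
    qed
    also have "emeasure ?\<mu> (\<Union>n. A n) = (SUP n. emeasure ?\<mu> (A n))"
      using Am inc by (intro SUP_emeasure_incseq[symmetric]) auto
    also have "\<dots> \<le> ennreal y" by (intro SUP_least An)
    finally show ?thesis by (simp add: S_def)
  qed
qed

text \<open>The layers may overlap: every point needs just one layer with a good bound, and then f
  is at most the sum of \<open>c j\<close> times the indicators.\<close>

lemma nn_integral_le_layers:
  assumes [measurable]: "f \<in> borel_measurable borel" "\<And>j. A j \<in> sets borel"
    and f: "\<And>r. 0 \<le> r \<Longrightarrow> r < 1 \<Longrightarrow> f r \<noteq> 0 \<Longrightarrow> \<exists>j::nat. r \<in> A j \<and> f r \<le> ennreal (c j)"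
    and A: "\<And>j. emeasure (radial_measure \<omega>) (A j) \<le> ennreal (d j)"
    and nn: "\<And>j. 0 \<le> c j" "\<And>j. 0 \<le> d j"
    and s: "(\<lambda>j. c j * d j) sums S"
  shows "(\<integral>\<^sup>+r. f r \<partial>radial_measure \<omega>) \<le> ennreal S"
proof -
  have "(\<integral>\<^sup>+r. f r \<partial>radial_measure \<omega>) \<le> (\<integral>\<^sup>+r. (\<Sum>j. ennreal (c j) * indicator (A j) r) \<partial>radial_measure \<omega>)"
  proof (rule nn_integral_mono_AE)
    show "AE r in radial_measure \<omega>. f r \<le> (\<Sum>j. ennreal (c j) * indicator (A j) r)"
      using AE_radial
    proof eventually_elim
      case (elim r)
      show ?case
      proof (cases "f r = 0")
      case False
      then obtain j where j: "r \<in> A j" "f r \<le> ennreal (c j)" using f[of r] elim by auto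
      have "f r \<le> (\<Sum>j\<in>{j}. ennreal (c j) * indicator (A j) r)" using j by simp
      also have "\<dots> \<le> (\<Sum>j. ennreal (c j) * indicator (A j) r)"
        by (rule sum_le_suminf) auto
      finally show ?thesis .
      qed simp
    qed
  qed
  also have "\<dots> = (\<Sum>j. ennreal (c j) * emeasure (radial_measure \<omega>) (A j))"
    by (subst nn_integral_suminf) (auto simp: nn_integral_cmult_indicator)
  also have "\<dots> \<le> (\<Sum>j. ennreal (c j * d j))"
    using nn by (intro suminf_le) (auto simp: ennreal_mult intro!: mult_left_mono A)
  also have "\<dots> = ennreal S"
    using s nn by (simp add: suminf_ennreal2 sums_iff)
  finally show ?thesis .
qed

text \<open>Natural exponents avoid \<open>powr\<close>. The kernel uses the exponents 2 n + 1, and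
  for these \<open>weight_moment_eq\<close> identifies the two notions.\<close>

definition moment :: "nat \<Rightarrow> real" where
  "moment k = (\<integral>r. r ^ k \<partial>radial_measure \<omega>)"

lemma integrable_radial_bounded:
  fixes f :: "real \<Rightarrow> real"
  assumes [measurable]: "f \<in> borel_measurable borel" and b: "\<And>r. 0 \<le> r \<Longrightarrow> r < 1 \<Longrightarrow> \<bar>f r\<bar> \<le> B"
  shows "integrable (radial_measure \<omega>) f"
proof (rule radial.integrable_const_bound)
  show "AE r in radial_measure \<omega>. norm (f r) \<le> B"
    using AE_radial by eventually_elim (use b in auto)
qed measurable

lemma integrable_power: "integrable (radial_measure \<omega>) (\<lambda>r. r ^ k)"
  by (rule integrable_radial_bounded[where B=1]) (auto simp: power_le_one)

lemma weight_moment_eq: "weight_moment \<omega> (2 * real n + 1) = moment (2 * n + 1)"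
proof -
  have "moment (2 * n + 1) = set_lebesgue_integral lebesgue {0..<1} (\<lambda>r. r ^ (2 * n + 1) * \<omega> r)"
    unfolding moment_def by (rule integral_radial) simp
  also have "\<dots> = weight_moment \<omega> (2 * real n + 1)"
    unfolding weight_moment_def
  proof (rule set_lebesgue_integral_cong)
    show "\<forall>r. r \<in> {0..<1} \<longrightarrow> r ^ (2 * n + 1) * \<omega> r = r powr (2 * real n + 1) * \<omega> r"
    proof safe
      fix r :: real assume "r \<in> {0..<1}"
      have "r powr (2 * real n + 1) = r ^ (2 * n + 1)"
      proof (cases "r = 0")
        case False
        then show ?thesis using \<open>r \<in> {0..<1}\<close> powr_realpow[of r "2 * n + 1"] by (simp add: add.commute)
      qed simp
      then show "r ^ (2 * n + 1) * \<omega> r = r powr (2 * real n + 1) * \<omega> r" by simp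
    qed
  qed simp
  finally show ?thesis by simp
qed

lemma moment_mono:
  assumes "k \<le> l" shows "moment l \<le> moment k"
  unfolding moment_def
proof (rule integral_mono_AE[OF integrable_power integrable_power])
  show "AE r in radial_measure \<omega>. r ^ l \<le> r ^ k"
    using AE_radial by eventually_elim (use assms in \<open>auto intro: power_decreasing\<close>)
qed

text \<open>Only the radii beyond \<open>inner_radius m\<close> are kept; there the integrand is at
  least 1/9 by \<open>inner_radius_power_ge\<close>.\<close>

lemma moment_ge: "tail \<omega> (inner_radius m) / 9 \<le> moment (2 * m + 1)"
proof -
  have "tail \<omega> (inner_radius m) / 9 = (\<integral>r. 1/9 * indicator {inner_radius m..} r \<partial>radial_measure \<omega>)"
    by (simp add: tail_def)
  also have "\<dots> \<le> (\<integral>r. r ^ (2 * m + 1) \<partial>radial_measure \<omega>)"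
  proof (rule integral_mono_AE[OF _ integrable_power])
    show "integrable (radial_measure \<omega>) (\<lambda>r. 1/9 * indicator {inner_radius m..} r :: real)"
      by (rule integrable_radial_bounded[where B=1]) (auto simp: indicator_def)
    show "AE r in radial_measure \<omega>. 1/9 * indicator {inner_radius m..} r \<le> r ^ (2 * m + 1)"
      using AE_radial
    proof eventually_elim
      case (elim r)
      show ?case
      proof (cases "inner_radius m \<le> r")
        case True
        have "1 / 9 \<le> r ^ (2 * m + 1)"
          using inner_radius_power_ge[of m] power_mono[OF True, of "2 * m + 1"] inner_radius_bounds[of m] by linarith
        then show ?thesis using True by simp
      next
        case False
        then show ?thesis using elim by (simp add: indicator_def)
      qed
    qed
  qed
  finally show ?thesis by (simp add: moment_def)
qed

lemma moment_pos: "0 < moment (2 * m + 1)"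
  using moment_ge[of m] tail_pos[of "inner_radius m"] inner_radius_bounds[of m] by simp

end

text \<open>The constant is a power of two because each step halves the distance to the circle: the
  tail then changes at most like the \<beta>-th power of the ratio of the distances.\<close>

locale upper_doubling_weight = weight +
  fixes \<beta> :: nat
  assumes doubling: "0 \<le> r \<Longrightarrow> r < 1 \<Longrightarrow> tail \<omega> r \<le> 2 ^ \<beta> * tail \<omega> ((1 + r) / 2)"
begin

lemma tail_iterate:
  assumes "0 \<le> r" "r < 1" "0 \<le> \<rho>" "\<rho> < 1" "1 - r \<le> 2 ^ j * (1 - \<rho>)"
  shows "tail \<omega> r \<le> 2 ^ (\<beta> * j) * tail \<omega> \<rho>"
  using assms
proof (induction j arbitrary: r)
  case 0 then show ?case by (auto intro: tail_antimono)
next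
  case (Suc j)
  have "tail \<omega> r \<le> 2 ^ \<beta> * tail \<omega> ((1 + r) / 2)" using doubling Suc.prems by simp
  also have "\<dots> \<le> 2 ^ \<beta> * (2 ^ (\<beta> * j) * tail \<omega> \<rho>)"
    using Suc.prems by (intro mult_left_mono Suc.IH) (auto simp: field_simps)
  finally show ?case by (simp add: power_add)
qed

text \<open>Dyadic layers of (1 - r) / (1 - \<rho>): on the j-th the integrand is at most (2^j (1 -
  \<rho>))^(-\<gamma>), and its mass is at most 2^(\<beta> (j + 1)) times the tail at \<rho>. The
  products form a geometric series of ratio 2^(\<beta> - \<gamma>) < 1.\<close>

lemma layer_integral:
  assumes \<gamma>: "real \<beta> < \<gamma>"
  obtains C where "0 < C" "\<And>\<rho>. 0 \<le> \<rho> \<Longrightarrow> \<rho> < 1 \<Longrightarrow>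
    (\<integral>\<^sup>+r. ennreal ((1 - \<rho> * r) powr (- \<gamma>)) \<partial>radial_measure \<omega>) \<le> ennreal (C * (tail \<omega> \<rho> * (1 - \<rho>) powr (- \<gamma>)))"
proof -
  define q where "q = 2 powr (real \<beta> - \<gamma>)"
  have q: "0 < q" "q < 1" using \<gamma> by (auto simp: q_def powr_less_one)
  define C where "C = 2 ^ \<beta> / (1 - q)"
  have C: "0 < C" using q by (simp add: C_def)
  have main: "(\<integral>\<^sup>+r. ennreal ((1 - \<rho> * r) powr (- \<gamma>)) \<partial>radial_measure \<omega>) \<le> ennreal (C * (tail \<omega> \<rho> * (1 - \<rho>) powr (- \<gamma>)))"
    if \<rho>: "0 \<le> \<rho>" "\<rho> < 1" for \<rho>
  proof (rule nn_integral_le_layers)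
    \<comment> \<open>The maximum keeps the left endpoint in [0,1), where doubling is
      available.\<close>
    let ?A = "\<lambda>j::nat. {max 0 (1 - 2 ^ Suc j * (1 - \<rho>))..}"
    let ?c = "\<lambda>j::nat. (2 ^ j * (1 - \<rho>)) powr (- \<gamma>)"
    let ?d = "\<lambda>j::nat. 2 ^ (\<beta> * Suc j) * tail \<omega> \<rho>"
    show "\<exists>j. r \<in> ?A j \<and> ennreal ((1 - \<rho> * r) powr (- \<gamma>)) \<le> ennreal (?c j)" if r: "0 \<le> r" "r < 1" for r
    proof -
      obtain j :: nat where j: "1 - r \<le> 2 ^ Suc j * (1 - \<rho>)" "j = 0 \<or> 2 ^ j * (1 - \<rho>) < 1 - r"
        using dyadic_level[of "1 - \<rho>" "1 - r"] \<rho> by auto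
      have "\<rho> * r \<le> r" "\<rho> * r \<le> \<rho>" using \<rho> r by (auto simp: mult_left_le mult_left_le_one_le)
      then have "2 ^ j * (1 - \<rho>) \<le> 1 - \<rho> * r" using j(2) by auto
      then have "(1 - \<rho> * r) powr (- \<gamma>) \<le> ?c j"
        using \<rho> \<gamma> by (intro powr_mono2') auto
      then show ?thesis using j r by (intro exI[of _ j]) (auto intro: ennreal_leI)
    qed
    show "emeasure (radial_measure \<omega>) (?A j) \<le> ennreal (?d j)" for j
      unfolding emeasure_tail
      using \<rho> by (intro ennreal_leI tail_iterate) (auto simp: max_def)
    show "(\<lambda>j. ?c j * ?d j) sums (C * (tail \<omega> \<rho> * (1 - \<rho>) powr (- \<gamma>)))"
    proof -
      have "?c j * ?d j = (2 ^ \<beta> * tail \<omega> \<rho> * (1 - \<rho>) powr (- \<gamma>)) * q ^ j" for j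
      proof -
        have "(2 ^ j) powr (- \<gamma>) * 2 ^ (\<beta> * j) = q ^ j"
          by (simp add: q_def powr_realpow[symmetric] powr_powr powr_add[symmetric] algebra_simps)
        moreover have "?c j * ?d j = (2 ^ \<beta> * tail \<omega> \<rho> * (1 - \<rho>) powr (- \<gamma>)) * ((2 ^ j) powr (- \<gamma>) * 2 ^ (\<beta> * j))"
          using \<rho> by (simp add: powr_mult power_add)
        ultimately show ?thesis by simp
      qed
      then have "(\<lambda>j. ?c j * ?d j) = (\<lambda>j. (2 ^ \<beta> * tail \<omega> \<rho> * (1 - \<rho>) powr (- \<gamma>)) * q ^ j)" by (rule ext)
      moreover have "(\<lambda>j. (2 ^ \<beta> * tail \<omega> \<rho> * (1 - \<rho>) powr (- \<gamma>)) * q ^ j) sums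
          ((2 ^ \<beta> * tail \<omega> \<rho> * (1 - \<rho>) powr (- \<gamma>)) * (1 / (1 - q)))"
        using q by (intro sums_mult geometric_sums) auto
      moreover have "(2 ^ \<beta> * tail \<omega> \<rho> * (1 - \<rho>) powr (- \<gamma>)) * (1 / (1 - q)) = C * (tail \<omega> \<rho> * (1 - \<rho>) powr (- \<gamma>))"
        by (simp add: C_def)
      ultimately show ?thesis by (simp only:)
    qed
    show "0 \<le> ?d j" for j using tail_pos[OF \<rho>(2)] by simp
  qed auto
  show ?thesis using that C main by blast
qed

text \<open>\<open>tail_iterate\<close> at the dyadic level of the ratio of the distances. The
  summand 1 covers level zero, where only one doubling is spent.\<close>

lemma tail_le_poly:
  assumes "0 \<le> r" "r < 1" "0 \<le> \<rho>" "\<rho> < 1"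
  shows "tail \<omega> r \<le> 2 ^ \<beta> * (1 + ((1 - r) / (1 - \<rho>)) ^ \<beta>) * tail \<omega> \<rho>"
proof -
  let ?x = "(1 - r) / (1 - \<rho>)"
  have x0: "0 < ?x" using assms by simp
  obtain j :: nat where j: "1 - r \<le> 2 ^ Suc j * (1 - \<rho>)" "j = 0 \<or> 2 ^ j * (1 - \<rho>) < 1 - r"
    using dyadic_level[of "1 - \<rho>" "1 - r"] assms by auto
  have jx: "(2 ^ j) ^ \<beta> \<le> 1 + ?x ^ \<beta>"
  proof (cases "j = 0")
    case False
    then have "2 ^ j \<le> ?x" using j(2) assms by (simp add: field_simps)
    then have "(2 ^ j) ^ \<beta> \<le> ?x ^ \<beta>" by (intro power_mono) auto
    then show ?thesis by simp
  qed (use x0 in simp)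
  have "tail \<omega> r \<le> 2 ^ (\<beta> * Suc j) * tail \<omega> \<rho>" by (intro tail_iterate assms j)
  also have "(2::real) ^ (\<beta> * Suc j) = 2 ^ \<beta> * (2 ^ j) ^ \<beta>"
    by (simp add: power_add power_mult[symmetric] mult.commute)
  also have "2 ^ \<beta> * (2 ^ j) ^ \<beta> * tail \<omega> \<rho> \<le> 2 ^ \<beta> * (1 + ?x ^ \<beta>) * tail \<omega> \<rho>"
    using jx tail_pos[OF assms(4)] by (intro mult_right_mono mult_left_mono) auto
  finally show ?thesis .
qed

text \<open>Moves the reciprocal tail from the radius belonging to the index m to a fixed radius
  \<rho>, at the cost of a power of (m + 2) (1 - \<rho>) that will disappear on summation against
  \<rho>^m.\<close>

lemma inverse_tail_le:
  assumes "0 \<le> \<rho>" "\<rho> < 1"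
  shows "1 / tail \<omega> (inner_radius m) \<le> 2 ^ \<beta> * (1 + (real (m + 2) * (1 - \<rho>)) ^ \<beta>) / tail \<omega> \<rho>"
proof -
  have "(1 - \<rho>) / (1 - inner_radius m) = real (m + 2) * (1 - \<rho>)" by (simp add: inner_radius_def)
  then have "tail \<omega> \<rho> \<le> 2 ^ \<beta> * (1 + (real (m + 2) * (1 - \<rho>)) ^ \<beta>) * tail \<omega> (inner_radius m)"
    using tail_le_poly[OF assms, of "inner_radius m"] inner_radius_bounds[of m] by simp
  then show ?thesis
    using tail_pos[OF assms(2)] tail_pos[of "inner_radius m"] inner_radius_bounds[of m] by (simp add: field_simps)
qed

lemma tail_inner_radius_Suc: "tail \<omega> (inner_radius m) \<le> 2 ^ \<beta> * tail \<omega> (inner_radius (Suc m))"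
  using tail_iterate[of "inner_radius m" "inner_radius (Suc m)" 1] inner_radius_bounds[of m] inner_radius_bounds[of "Suc m"]
  by (simp add: inner_radius_def field_simps)

text \<open>With \<rho> = \<open>inner_radius m\<close> the power r^(m + 1) is at most a constant
  times ((1 - \<rho>) / (1 - \<rho> r))^g, and \<open>layer_integral\<close> applies because g =
  \<beta> + 1 exceeds \<beta>. The order is m + 1, not 2 m + 1, since
  \<open>moment_difference\<close> spends m of the factors r.\<close>

lemma moment_le:
  obtains C where "0 < C" "\<And>m. moment (m + 1) \<le> C * tail \<omega> (inner_radius m)"
proof -
  define g where "g = Suc \<beta>"
  obtain C where C: "0 < C" "\<And>\<rho>. 0 \<le> \<rho> \<Longrightarrow> \<rho> < 1 \<Longrightarrow>
    (\<integral>\<^sup>+r. ennreal ((1 - \<rho> * r) powr (- real g)) \<partial>radial_measure \<omega>) \<le> ennreal (C * (tail \<omega> \<rho> * (1 - \<rho>) powr (- real g)))"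
    using layer_integral[of "real g"] by (auto simp: g_def)
  define K where "K = fact g * exp (1::real)"
  have K: "0 < K" by (simp add: K_def)
  have "moment (m + 1) \<le> (K * C) * tail \<omega> (inner_radius m)" for m
  proof -
    define \<rho> where "\<rho> = inner_radius m"
    have \<rho>: "0 \<le> \<rho>" "\<rho> < 1" using inner_radius_bounds[of m] by (auto simp: \<rho>_def)
    have pw: "r ^ (m + 1) \<le> (K * (1 - \<rho>) ^ g) * (1 - \<rho> * r) powr (- real g)" if r: "0 \<le> r" "r < 1" for r
    proof -
      \<comment> \<open>In this variable (1 - \<rho> r) / (1 - \<rho>) = 1 + y, while r^(m + 1)
        \<le> exp(-y), and the exponential beats (1 + y)^g with constant g! e.\<close>
      define y where "y = real (m + 1) * (1 - r)"
      have y: "0 \<le> y" using r by (simp add: y_def)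
      have "\<rho> * r < 1" using \<rho> r by (meson le_less_trans mult_left_le less_imp_le)
      have e: "(1 - \<rho> * r) = (1 - \<rho>) * (1 + y)"
        by (simp add: \<rho>_def inner_radius_def y_def field_simps)
      have "r \<le> exp (- (1 - r))" using exp_ge_add_one_self[of "- (1 - r)"] by simp
      then have "r ^ (m + 1) \<le> exp (- (1 - r)) ^ (m + 1)" using r by (intro power_mono)
      also have "\<dots> = exp (- y)" by (simp add: y_def exp_of_nat_mult[symmetric] algebra_simps del: power_Suc)
      finally have "r ^ (m + 1) * (1 + y) ^ g \<le> exp (- y) * (fact g * exp (1 + y))"
        using y exp_fact_bound[of "1 + y" g] r by (intro mult_mono) auto
      also have "\<dots> = K" by (simp add: K_def exp_add exp_minus field_simps)
      finally have "r ^ (m + 1) \<le> K / (1 + y) ^ g" using y by (simp add: field_simps add_pos_nonneg)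
      also have "\<dots> = (K * (1 - \<rho>) ^ g) / (1 - \<rho> * r) ^ g"
        using \<rho> y by (simp add: e power_mult_distrib)
      also have "\<dots> = (K * (1 - \<rho>) ^ g) * (1 - \<rho> * r) powr (- real g)"
        using \<open>\<rho> * r < 1\<close> by (simp add: powr_minus powr_realpow divide_inverse)
      finally show ?thesis .
    qed
    have "ennreal (moment (m + 1)) = (\<integral>\<^sup>+r. ennreal (r ^ (m + 1)) \<partial>radial_measure \<omega>)"
      unfolding moment_def
    proof (rule nn_integral_eq_integral[symmetric, OF integrable_power])
      show "AE r in radial_measure \<omega>. 0 \<le> r ^ (m + 1)" using AE_radial by eventually_elim simp
    qed
    also have "\<dots> \<le> (\<integral>\<^sup>+r. ennreal (K * (1 - \<rho>) ^ g) * ennreal ((1 - \<rho> * r) powr (- real g)) \<partial>radial_measure \<omega>)"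
    proof (rule nn_integral_mono_AE)
      show "AE r in radial_measure \<omega>. ennreal (r ^ (m + 1)) \<le> ennreal (K * (1 - \<rho>) ^ g) * ennreal ((1 - \<rho> * r) powr (- real g))"
        using AE_radial by eventually_elim (use pw K \<rho> in \<open>auto simp: ennreal_mult[symmetric] intro!: ennreal_leI\<close>)
    qed
    also have "\<dots> = ennreal (K * (1 - \<rho>) ^ g) * (\<integral>\<^sup>+r. ennreal ((1 - \<rho> * r) powr (- real g)) \<partial>radial_measure \<omega>)"
      by (rule nn_integral_cmult) measurable
    also have "\<dots> \<le> ennreal (K * (1 - \<rho>) ^ g) * ennreal (C * (tail \<omega> \<rho> * (1 - \<rho>) powr (- real g)))"
      by (intro mult_left_mono C \<rho>) auto
    also have "\<dots> = ennreal ((K * (1 - \<rho>) ^ g) * (C * (tail \<omega> \<rho> * (1 - \<rho>) powr (- real g))))"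
      using K C \<rho> tail_pos[OF \<rho>(2)] by (intro ennreal_mult[symmetric]) auto
    also have "(K * (1 - \<rho>) ^ g) * (C * (tail \<omega> \<rho> * (1 - \<rho>) powr (- real g))) = K * C * tail \<omega> \<rho>"
      using \<rho> by (simp add: powr_minus powr_realpow field_simps)
    finally show ?thesis
      using K C tail_pos[OF \<rho>(2)] by (simp add: \<rho>_def)
  qed
  then show ?thesis using that[of "K * C"] K C by simp
qed

text \<open>The difference of the powers is r^(m + 1) times r^m (1 - r) times 1 + r, whose middle
  factor is at most 1 / (m + 1). What remains is the moment of order m + 1, which is compared with
  that of order 2 m + 3 through the tails at neighbouring inner radii.\<close>

lemma moment_difference:
  obtains C where "0 < C" "\<And>m. moment (2 * m + 1) - moment (2 * Suc m + 1) \<le> C / real (m + 1) * moment (2 * Suc m + 1)"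
proof -
  obtain C where C: "0 < C" "\<And>m. moment (m + 1) \<le> C * tail \<omega> (inner_radius m)"
    using moment_le by blast
  have "moment (2 * m + 1) - moment (2 * Suc m + 1) \<le> (2 * C * 2 ^ \<beta> * 9) / real (m + 1) * moment (2 * Suc m + 1)" for m
  proof -
    have "moment (2 * m + 1) - moment (2 * Suc m + 1) = (\<integral>r. r ^ (2 * m + 1) - r ^ (2 * Suc m + 1) \<partial>radial_measure \<omega>)"
      unfolding moment_def by (rule Bochner_Integration.integral_diff[symmetric]) (rule integrable_power)+
    also have "\<dots> \<le> (\<integral>r. 2 / real (m + 1) * r ^ (m + 1) \<partial>radial_measure \<omega>)"
    proof (rule integral_mono_AE)
      show "AE r in radial_measure \<omega>. r ^ (2 * m + 1) - r ^ (2 * Suc m + 1) \<le> 2 / real (m + 1) * r ^ (m + 1)"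
        using AE_radial
      proof eventually_elim
        case (elim r)
        have "r ^ (2 * m + 1) - r ^ (2 * Suc m + 1) = r ^ (m + 1) * (r ^ m * (1 - r)) * (1 + r)"
        proof -
          have "r ^ (2 * Suc m + 1) = r ^ (2 * m + 1) * (r * r)" by simp
          moreover have "r ^ (2 * m + 1) = r ^ (m + 1) * r ^ m" by (simp add: mult_2 power_add)
          moreover have "x * y - x * y * (r * r) = x * (y * (1 - r)) * (1 + r)" for x y :: real
            by algebra
          ultimately show ?thesis by (simp only:)
        qed
        also have "\<dots> \<le> r ^ (m + 1) * (1 / real (m + 1)) * 2"
          using elim power_times_one_minus_le[of r m] by (intro mult_mono mult_nonneg_nonneg) auto
        finally show ?case by (simp add: mult_ac)
      qed
    qed (intro Bochner_Integration.integrable_diff integrable_power integrable_mult_right)+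
    also have "\<dots> = 2 / real (m + 1) * moment (m + 1)" by (simp add: moment_def)
    also have "\<dots> \<le> 2 / real (m + 1) * (C * (2 ^ \<beta> * (9 * moment (2 * Suc m + 1))))"
    proof (intro mult_left_mono)
      have "moment (m + 1) \<le> C * tail \<omega> (inner_radius m)" by (rule C)
      also have "\<dots> \<le> C * (2 ^ \<beta> * tail \<omega> (inner_radius (Suc m)))"
        using C by (intro mult_left_mono tail_inner_radius_Suc) auto
      also have "\<dots> \<le> C * (2 ^ \<beta> * (9 * moment (2 * Suc m + 1)))"
        using C moment_ge[of "Suc m"] by (intro mult_left_mono) auto
      finally show "moment (m + 1) \<le> C * (2 ^ \<beta> * (9 * moment (2 * Suc m + 1)))" .
    qed auto
    finally show ?thesis by (simp add: mult_ac)
  qed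
  then show ?thesis using that[of "2 * C * 2 ^ \<beta> * 9"] C by simp
qed

end

section \<open>Integral means of the kernel\<close>

text \<open>Induction on q: the Cauchy product with the geometric series sums the binomial
  coefficients by the hockey-stick identity.\<close>

lemma negative_binomial_sums:
  fixes w :: complex
  assumes "norm w < 1"
  shows "(\<lambda>m. of_nat ((q + m) choose m) * w ^ m) sums (1 / (1 - w) ^ Suc q)"
  using assms
proof (induction q arbitrary: w)
  case 0
  then show ?case using geometric_sums[of w] by simp
next
  case (Suc q)
  have dc: "disc_coeffs (\<lambda>m. of_nat ((q + m) choose m))"
    by (rule disc_coeffsI) (use Suc.IH in \<open>auto simp: sums_iff\<close>)
  let ?a = "\<lambda>m. of_nat ((q + m) choose m) * w ^ m"
  have "(\<lambda>k. \<Sum>i\<le>k. ?a i * w ^ (k - i)) sums ((\<Sum>k. ?a k) * (\<Sum>k. w ^ k))"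
    by (rule Cauchy_product_sums)
       (use disc_coeffsD[OF dc Suc.prems] summable_geometric[of "norm w"] Suc.prems in \<open>auto simp: norm_power\<close>)
  moreover have "(\<Sum>k. ?a k) * (\<Sum>k. w ^ k) = 1 / (1 - w) ^ Suc (Suc q)"
    using Suc.IH[OF Suc.prems] geometric_sums[OF Suc.prems] by (simp add: sums_iff mult_ac)
  moreover have "(\<Sum>i\<le>k. ?a i * w ^ (k - i)) = of_nat ((Suc q + k) choose k) * w ^ k" for k
  proof -
    have "(\<Sum>i\<le>k. ?a i * w ^ (k - i)) = (\<Sum>i\<le>k. of_nat ((q + i) choose i) * w ^ k)"
      by (intro sum.cong) (auto simp: mult.assoc power_add[symmetric])
    also have "\<dots> = of_nat (\<Sum>i\<le>k. (q + i) choose i) * w ^ k" by (simp add: sum_distrib_right)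
    finally show ?thesis by (simp only: sum_choose_lower add_Suc)
  qed
  ultimately show ?case by simp
qed

lemma disc_coeffs_binomial: "disc_coeffs (\<lambda>m. of_nat ((q + m) choose m))"
  by (rule disc_coeffsI) (use negative_binomial_sums in \<open>auto simp: sums_iff\<close>)

text \<open>The right side is the product (m + 1) (m + 2) ... (m + q).\<close>

lemma power_le_binomial: "real (m + 1) ^ q \<le> fact q * real ((q + m) choose m)"
proof (induction q)
  case (Suc q)
  have "Suc q * ((Suc q + m) choose m) = (Suc q + m) * ((q + m) choose m)"
    using binomial_absorb_comp[of "Suc q + m" m] by simp
  then have eq: "real (Suc q) * real ((Suc q + m) choose m) = real (Suc q + m) * real ((q + m) choose m)"
    by (simp only: of_nat_mult[symmetric])
  have "real (m + 1) ^ Suc q \<le> real (Suc q + m) * (fact q * real ((q + m) choose m))"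
    unfolding power_Suc by (intro mult_mono Suc.IH) auto
  also have "\<dots> = fact q * (real (Suc q + m) * real ((q + m) choose m))" by simp
  also have "\<dots> = fact (Suc q) * real ((Suc q + m) choose m)"
    unfolding eq[symmetric] by simp
  finally show ?case .
qed simp

text \<open>Termwise comparison with the negative binomial series, using m + 2 \<le> 2 (m +
  1).\<close>

lemma power_series_bound:
  assumes "0 \<le> r" "r < 1"
  shows "summable (\<lambda>m. real (m + 2) ^ q * r ^ m)"
    "(\<Sum>m. real (m + 2) ^ q * r ^ m) \<le> 2 ^ q * fact q / (1 - r) ^ Suc q"
proof -
  have "(\<lambda>m. complex_of_real (real ((q + m) choose m) * r ^ m)) sums complex_of_real (1 / (1 - r) ^ Suc q)"
    using negative_binomial_sums[of "complex_of_real r" q] assms by simp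
  then have s: "(\<lambda>m. real ((q + m) choose m) * r ^ m) sums (1 / (1 - r) ^ Suc q)"
    by (simp only: sums_of_real_iff)
  have s2: "(\<lambda>m. 2 ^ q * fact q * (real ((q + m) choose m) * r ^ m)) sums (2 ^ q * fact q * (1 / (1 - r) ^ Suc q))"
    by (rule sums_mult[OF s])
  have le: "real (m + 2) ^ q * r ^ m \<le> 2 ^ q * fact q * (real ((q + m) choose m) * r ^ m)" for m
  proof -
    have "real (m + 2) ^ q \<le> (2 * real (m + 1)) ^ q" by (intro power_mono) auto
    also have "\<dots> \<le> 2 ^ q * (fact q * real ((q + m) choose m))"
      unfolding power_mult_distrib by (intro mult_left_mono power_le_binomial) auto
    finally show ?thesis using assms by (simp add: mult.assoc[symmetric] mult_right_mono)
  qed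
  show sm: "summable (\<lambda>m. real (m + 2) ^ q * r ^ m)"
    by (rule summable_comparison_test'[OF sums_summable[OF s2], of 0]) (use le assms in auto)
  show "(\<Sum>m. real (m + 2) ^ q * r ^ m) \<le> 2 ^ q * fact q / (1 - r) ^ Suc q"
    using suminf_le[OF le sm sums_summable[OF s2]] s2 by (simp add: sums_iff)
qed

lemma ennreal_power2_le_imp_le:
  assumes "a\<^sup>2 \<le> (ennreal X)\<^sup>2" "0 \<le> X" shows "a \<le> ennreal X"
proof (cases a)
  case (real b)
  then show ?thesis using assms
    by (auto simp: ennreal_power intro!: ennreal_leI power2_le_imp_le)
next
  case top
  then show ?thesis using assms by (simp add: ennreal_power top_unique)
qed

context upper_doubling_weight
begin

text \<open>In \<open>circle_mean_square_le\<close> the reciprocal tails are moved to the radius of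
  w by \<open>inverse_tail_le\<close>. The extra powers ((m + 2) (1 - \<rho>))^\<beta> are harmless:
  summed against \<rho>^m, a power of m + 2 produces the same power of 1 / (1 - \<rho>), which the
  factor 1 - \<rho> cancels.\<close>

lemma circle_mean_bound:
  obtains C where "0 < C"
    "\<And>x A w. disc_coeffs x \<Longrightarrow> 0 \<le> A \<Longrightarrow>
       (\<And>m. norm (coeff_diff x m) \<le> A * real (m + 2) ^ s / tail \<omega> (inner_radius m)) \<Longrightarrow> norm w < 1 \<Longrightarrow>
       circle_mean (psum x) w \<le> ennreal (C * A / ((1 - norm w) ^ Suc s * tail \<omega> (norm w)))"
proof -
  define B :: "nat \<Rightarrow> real" where "B q = 2 ^ q * fact q" for q
  define C0 where "C0 = 2 * (2 ^ \<beta>)\<^sup>2 * (B (2 * s) + B (2 * s + 2 * \<beta>))"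
  have B: "0 < B q" for q by (simp add: B_def)
  then have C0: "0 < C0" unfolding C0_def by (intro mult_pos_pos add_pos_pos) auto
  have main: "circle_mean (psum x) w \<le> ennreal (sqrt C0 * A / ((1 - norm w) ^ Suc s * tail \<omega> (norm w)))"
    if x: "disc_coeffs x" and A: "0 \<le> A"
    and d: "\<And>m. norm (coeff_diff x m) \<le> A * real (m + 2) ^ s / tail \<omega> (inner_radius m)" and w: "norm w < 1" for x A w
  proof -
    define \<rho> where "\<rho> = norm w"
    have \<rho>: "0 \<le> \<rho>" "\<rho> < 1" using w by (auto simp: \<rho>_def)
    define T where "T = tail \<omega> \<rho>"
    have T: "0 < T" unfolding T_def by (rule tail_pos) fact
    let ?u = "\<lambda>m. real (m + 2)"
    define D where "D = 2 * (2 ^ \<beta>)\<^sup>2 * A\<^sup>2 / T\<^sup>2"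
    have D: "0 \<le> D" by (simp add: D_def)
    \<comment> \<open>The two summands come from the 1 and from the \<beta>-th power in
      \<open>inverse_tail_le\<close>.\<close>
    let ?b = "\<lambda>m. D * (?u m ^ (2 * s) * \<rho> ^ m + (1 - \<rho>) ^ (2 * \<beta>) * (?u m ^ (2 * s + 2 * \<beta>) * \<rho> ^ m))"
    have le: "(norm (coeff_diff x m) * \<rho> ^ m)\<^sup>2 \<le> ?b m" for m
    proof -
      let ?v = "(?u m * (1 - \<rho>)) ^ \<beta>"
      have "norm (coeff_diff x m) \<le> A * ?u m ^ s * (1 / tail \<omega> (inner_radius m))"
        using d[of m] by simp
      also have "\<dots> \<le> A * ?u m ^ s * (2 ^ \<beta> * (1 + ?v) / T)"
        unfolding T_def using A by (intro mult_left_mono inverse_tail_le \<rho>) auto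
      finally have "(norm (coeff_diff x m))\<^sup>2 \<le> (A * ?u m ^ s * (2 ^ \<beta> * (1 + ?v) / T))\<^sup>2"
        by (intro power_mono) auto
      also have "\<dots> = (A\<^sup>2 * (2 ^ \<beta>)\<^sup>2 / T\<^sup>2) * ?u m ^ (2 * s) * (1 + ?v)\<^sup>2"
        by (simp add: power_mult_distrib power_divide power_mult[symmetric] mult.commute)
      also have "\<dots> \<le> (A\<^sup>2 * (2 ^ \<beta>)\<^sup>2 / T\<^sup>2) * ?u m ^ (2 * s) * (2 * (1 + ?v\<^sup>2))"
      proof -
        have "0 \<le> (1 - ?v)\<^sup>2" by simp
        then have "(1 + ?v)\<^sup>2 \<le> 2 * (1 + ?v\<^sup>2)" by (simp add: power2_eq_square algebra_simps)
        then show ?thesis by (intro mult_left_mono) auto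
      qed
      also have "\<dots> = D * (?u m ^ (2 * s) + (1 - \<rho>) ^ (2 * \<beta>) * ?u m ^ (2 * s + 2 * \<beta>))"
      proof -
        have v2: "?v\<^sup>2 = (1 - \<rho>) ^ (2 * \<beta>) * ?u m ^ (2 * \<beta>)"
          by (simp only: power_mult[symmetric] power_mult_distrib mult.commute[of \<beta> 2]) (rule mult.commute)
        have "(a * e / t) * U * (2 * (1 + P * V)) = (2 * e * a / t) * (U + P * (U * V))" for a e t U P V :: real
          by (simp add: algebra_simps add_divide_distrib)
        then show ?thesis unfolding v2 power_add D_def .
      qed
      finally have 1: "(norm (coeff_diff x m))\<^sup>2 \<le> D * (?u m ^ (2 * s) + (1 - \<rho>) ^ (2 * \<beta>) * ?u m ^ (2 * s + 2 * \<beta>))" .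
      \<comment> \<open>The square of \<rho>^m is weakened to \<rho>^m, so that
        \<open>power_series_bound\<close> applies at \<rho> itself.\<close>
      have 2: "(\<rho> ^ m)\<^sup>2 \<le> \<rho> ^ m" using \<rho> by (simp add: power2_eq_square mult_left_le power_le_one)
      have "(norm (coeff_diff x m) * \<rho> ^ m)\<^sup>2 = (norm (coeff_diff x m))\<^sup>2 * (\<rho> ^ m)\<^sup>2"
        by (rule power_mult_distrib)
      also have "\<dots> \<le> D * (?u m ^ (2 * s) + (1 - \<rho>) ^ (2 * \<beta>) * ?u m ^ (2 * s + 2 * \<beta>)) * \<rho> ^ m"
        by (intro mult_mono 1 2 mult_nonneg_nonneg D add_nonneg_nonneg) (use \<rho> in auto)
      finally show ?thesis by (simp add: algebra_simps)
    qed
    have sb: "summable ?b"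
      by (intro summable_mult summable_add power_series_bound \<rho>)
    have sl: "summable (\<lambda>m. (norm (coeff_diff x m) * \<rho> ^ m)\<^sup>2)"
      by (rule summable_comparison_test'[OF sb, of 0]) (use le in auto)
    have "(\<Sum>m. (norm (coeff_diff x m) * \<rho> ^ m)\<^sup>2) \<le> (\<Sum>m. ?b m)"
      by (intro suminf_le le sl sb)
    also have "\<dots> = D * ((\<Sum>m. ?u m ^ (2 * s) * \<rho> ^ m) + (1 - \<rho>) ^ (2 * \<beta>) * (\<Sum>m. ?u m ^ (2 * s + 2 * \<beta>) * \<rho> ^ m))"
      using power_series_bound(1)[OF \<rho>, of "2 * s"] power_series_bound(1)[OF \<rho>, of "2 * s + 2 * \<beta>"]
      by (simp add: suminf_mult suminf_add[symmetric] summable_mult summable_add)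
    also have "\<dots> \<le> D * (B (2 * s) / (1 - \<rho>) ^ Suc (2 * s) + (1 - \<rho>) ^ (2 * \<beta>) * (B (2 * s + 2 * \<beta>) / (1 - \<rho>) ^ Suc (2 * s + 2 * \<beta>)))"
      unfolding B_def using \<rho> by (intro mult_left_mono add_mono power_series_bound D) auto
    also have "(1 - \<rho>) ^ (2 * \<beta>) * (B (2 * s + 2 * \<beta>) / (1 - \<rho>) ^ Suc (2 * s + 2 * \<beta>)) = B (2 * s + 2 * \<beta>) / (1 - \<rho>) ^ Suc (2 * s)"
      using \<rho> by (simp add: power_add)
    also have "D * (B (2 * s) / (1 - \<rho>) ^ Suc (2 * s) + B (2 * s + 2 * \<beta>) / (1 - \<rho>) ^ Suc (2 * s)) = C0 * A\<^sup>2 / (T\<^sup>2 * (1 - \<rho>) ^ Suc (2 * s))"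
    proof -
      have "(2 * e * a / t) * (x / p + y / p) = (2 * e * (x + y)) * a / (t * p)" for a e t x y p :: real
        by (simp add: add_divide_distrib algebra_simps)
      then show ?thesis unfolding D_def C0_def .
    qed
    finally have S: "(\<Sum>m. (norm (coeff_diff x m) * \<rho> ^ m)\<^sup>2) \<le> C0 * A\<^sup>2 / (T\<^sup>2 * (1 - \<rho>) ^ Suc (2 * s))" .
    have r1: "1 / (1 - \<rho>\<^sup>2) \<le> 1 / (1 - \<rho>)"
    proof -
      have "\<rho>\<^sup>2 \<le> \<rho>" using \<rho> by (simp add: power2_eq_square mult_left_le)
      then show ?thesis using \<rho> by (intro divide_left_mono) auto
    qed
    define X where "X = sqrt C0 * A / ((1 - \<rho>) ^ Suc s * T)"
    have X: "0 \<le> X" using A T \<rho> C0 by (simp add: X_def)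
    have "(circle_mean (psum x) w)\<^sup>2 \<le> ennreal (1 / (1 - \<rho>\<^sup>2)) * ennreal (\<Sum>m. (norm (coeff_diff x m) * \<rho> ^ m)\<^sup>2)"
      unfolding \<rho>_def by (rule circle_mean_square_le[OF x w])
    also have "\<dots> \<le> ennreal (1 / (1 - \<rho>)) * ennreal (C0 * A\<^sup>2 / (T\<^sup>2 * (1 - \<rho>) ^ Suc (2 * s)))"
      by (intro mult_mono ennreal_leI r1 S) auto
    also have "\<dots> = ennreal (1 / (1 - \<rho>) * (C0 * A\<^sup>2 / (T\<^sup>2 * (1 - \<rho>) ^ Suc (2 * s))))"
      using \<rho> C0 T by (intro ennreal_mult[symmetric]) auto
    \<comment> \<open>One power of 1 / (1 - \<rho>) comes from the mean square of 1 / (1 - w) and 2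
      s + 1 come from the coefficients; the square root leaves s + 1.\<close>
    also have "1 / (1 - \<rho>) * (C0 * A\<^sup>2 / (T\<^sup>2 * (1 - \<rho>) ^ Suc (2 * s))) = X\<^sup>2"
    proof -
      have "((1 - \<rho>) ^ Suc s)\<^sup>2 = (1 - \<rho>) ^ Suc (2 * s) * (1 - \<rho>)"
        by (simp add: power_mult[symmetric] power2_eq_square power_add[symmetric] mult_2)
      then show ?thesis unfolding X_def power_divide power_mult_distrib using C0 by simp
    qed
    also have "ennreal (X\<^sup>2) = (ennreal X)\<^sup>2" using X by (simp add: ennreal_power)
    finally have "circle_mean (psum x) w \<le> ennreal X" by (rule ennreal_power2_le_imp_le) fact
    then show ?thesis by (simp add: X_def \<rho>_def T_def)
  qed
  show ?thesis using that[of "sqrt C0"] C0 main by simp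
qed

definition kernel_coeff :: "nat \<Rightarrow> real" where "kernel_coeff m = 1 / (2 * moment (2 * m + 1))"

lemma kernel_coeff_pos: "0 < kernel_coeff m"
  unfolding kernel_coeff_def using moment_pos[of m] by simp

lemma kernel_coeff_mono: "kernel_coeff m \<le> kernel_coeff (Suc m)"
  unfolding kernel_coeff_def using moment_pos[of m] moment_pos[of "Suc m"] moment_mono[of "2 * m + 1" "2 * Suc m + 1"]
  by (intro divide_left_mono) auto

lemma kernel_coeff_le: "kernel_coeff m \<le> 9 / tail \<omega> (inner_radius m)"
proof -
  have t: "0 < tail \<omega> (inner_radius m)" by (rule tail_pos) (rule inner_radius_bounds)
  have "kernel_coeff m \<le> 1 / (tail \<omega> (inner_radius m) / 9)"
    unfolding kernel_coeff_def using moment_ge[of m] t moment_pos[of m] by (intro divide_left_mono) auto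
  then show ?thesis by simp
qed

lemma kernel_coeff_Suc_le: "kernel_coeff (Suc m) \<le> 9 * 2 ^ \<beta> / tail \<omega> (inner_radius m)"
proof -
  have t: "0 < tail \<omega> (inner_radius m)" "0 < tail \<omega> (inner_radius (Suc m))"
    by (auto intro: tail_pos inner_radius_bounds)
  have "9 / tail \<omega> (inner_radius (Suc m)) \<le> 9 / (tail \<omega> (inner_radius m) / 2 ^ \<beta>)"
    using tail_inner_radius_Suc[of m] t by (intro divide_left_mono) (auto simp: field_simps)
  then show ?thesis using kernel_coeff_le[of "Suc m"] by simp
qed

text \<open>Passing to reciprocals turns the relative decrease of the moments into a relative
  increase of the coefficients.\<close>

lemma kernel_coeff_difference:
  obtains C where "0 < C" "\<And>m. kernel_coeff (Suc m) - kernel_coeff m \<le> C / real (m + 1) * kernel_coeff m"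
proof -
  obtain C where C: "0 < C" "\<And>m. moment (2 * m + 1) - moment (2 * Suc m + 1) \<le> C / real (m + 1) * moment (2 * Suc m + 1)"
    using moment_difference by blast
  have "kernel_coeff (Suc m) - kernel_coeff m \<le> C / real (m + 1) * kernel_coeff m" for m
  proof -
    let ?a = "moment (2 * m + 1)" and ?b = "moment (2 * Suc m + 1)"
    have pos: "0 < ?a" "0 < ?b" by (rule moment_pos)+
    have "kernel_coeff (Suc m) - kernel_coeff m = (?a - ?b) / (2 * ?a * ?b)"
      unfolding kernel_coeff_def using pos by (simp add: field_simps)
    also have "\<dots> \<le> (C / real (m + 1) * ?b) / (2 * ?a * ?b)"
      using C(2)[of m] pos by (intro divide_right_mono) auto
    also have "\<dots> = C / real (m + 1) * kernel_coeff m"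
    proof -
      have "x * b / (2 * a * b) = x * (1 / (2 * a))" if "b \<noteq> 0" for x a b :: real using that by simp
      then show ?thesis unfolding kernel_coeff_def using pos by simp
    qed
    finally show ?thesis .
  qed
  then show ?thesis using that[of C] C by blast
qed

text \<open>\<open>inverse_tail_le\<close> at \<rho> = 0 shows that the coefficients grow at most
  like the \<beta>-th power of the index.\<close>

lemma disc_coeffs_kernel: "disc_coeffs (\<lambda>m. of_real (kernel_coeff m))"
proof (rule disc_coeffs_poly_bound)
  fix m
  have "kernel_coeff m \<le> 9 * (1 / tail \<omega> (inner_radius m))" using kernel_coeff_le[of m] by simp
  also have "\<dots> \<le> 9 * (2 ^ \<beta> * (1 + (real (m + 2) * (1 - 0)) ^ \<beta>) / tail \<omega> 0)"
    by (intro mult_left_mono inverse_tail_le) auto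
  also have "\<dots> \<le> 9 * (2 ^ \<beta> * (2 * (2 * real (Suc m)) ^ \<beta>) / tail \<omega> 0)"
  proof (intro mult_left_mono divide_right_mono)
    have "(real (m + 2) * (1 - 0)) ^ \<beta> \<le> (2 * real (Suc m)) ^ \<beta>" by (intro power_mono) auto
    moreover have "1 \<le> (2 * real (Suc m)) ^ \<beta>" by (intro one_le_power) auto
    ultimately show "1 + (real (m + 2) * (1 - 0)) ^ \<beta> \<le> 2 * (2 * real (Suc m)) ^ \<beta>" by linarith
  qed (use tail_pos[of 0] in auto)
  finally show "norm (complex_of_real (kernel_coeff m)) \<le> (18 * 2 ^ \<beta> * 2 ^ \<beta> / tail \<omega> 0) * real (Suc m) ^ \<beta>"
    using kernel_coeff_pos[of m] by (simp add: power_mult_distrib mult_ac del: of_nat_Suc)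
qed

text \<open>The bound \<open>circle_mean_bound\<close> loses too much for slowly growing coefficients, so it is applied
  to the derivative of the kernel, which is then integrated along the radius.\<close>

lemma circle_mean_diffs_kernel:
  obtains C where "0 < C" "\<And>w. norm w < 1 \<Longrightarrow>
    circle_mean (psum (diffs (\<lambda>m. of_real (kernel_coeff m)))) w \<le> ennreal (C / ((1 - norm w) * tail \<omega> (norm w)))"
proof -
  let ?k = "\<lambda>m. complex_of_real (kernel_coeff m)"
  obtain C where C: "0 < C"
    "\<And>x A w. disc_coeffs x \<Longrightarrow> 0 \<le> A \<Longrightarrow>
       (\<And>m. norm (coeff_diff x m) \<le> A * real (m + 2) ^ 0 / tail \<omega> (inner_radius m)) \<Longrightarrow> norm w < 1 \<Longrightarrow>
       circle_mean (psum x) w \<le> ennreal (C * A / ((1 - norm w) ^ Suc 0 * tail \<omega> (norm w)))"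
    using circle_mean_bound by blast
  obtain E where E: "0 < E" "\<And>m. kernel_coeff (Suc m) - kernel_coeff m \<le> E / real (m + 1) * kernel_coeff m"
    using kernel_coeff_difference by blast
  define A where "A = (1 + E) * (9 * 2 ^ \<beta>)"
  have A: "0 < A" using E by (simp add: A_def)
  \<comment> \<open>The difference (m + 1) k(m+1) - m k(m) equals k(m+1) + m (k(m+1) - k(m)), and
    the relative increment E / (m + 1) absorbs the factor m. The differences are thus no larger than
    kernel coefficients, which is the case s = 0 of \<open>circle_mean_bound\<close>.\<close>
  have d: "norm (coeff_diff (diffs ?k) m) \<le> (1 + E) * kernel_coeff (Suc m)" for m
  proof (cases m)
    case 0
    have "1 * kernel_coeff (Suc 0) \<le> (1 + E) * kernel_coeff (Suc 0)"
      using E kernel_coeff_pos[of "Suc 0"] by (intro mult_right_mono) auto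
    then show ?thesis using 0 kernel_coeff_pos[of "Suc 0"] by (simp add: coeff_diff_def diffs_def)
  next
    case (Suc i)
    have "coeff_diff (diffs ?k) m = of_real (real (Suc m) * kernel_coeff (Suc m) - real m * kernel_coeff m)"
      using Suc by (simp add: coeff_diff_def diffs_def)
    also have "real (Suc m) * kernel_coeff (Suc m) - real m * kernel_coeff m
      = kernel_coeff (Suc m) + real m * (kernel_coeff (Suc m) - kernel_coeff m)" by (simp add: algebra_simps)
    finally have eq: "norm (coeff_diff (diffs ?k) m) = kernel_coeff (Suc m) + real m * (kernel_coeff (Suc m) - kernel_coeff m)"
      using kernel_coeff_pos[of "Suc m"] kernel_coeff_mono[of m] by (simp only: norm_of_real) (simp add: add_nonneg_nonneg)
    have "real m * (kernel_coeff (Suc m) - kernel_coeff m) \<le> real m * (E / real (m + 1) * kernel_coeff m)"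
      by (intro mult_left_mono E) auto
    also have "\<dots> = (real m / real (m + 1)) * (E * kernel_coeff m)" by simp
    also have "\<dots> \<le> 1 * (E * kernel_coeff (Suc m))"
      using E kernel_coeff_pos[of m] kernel_coeff_mono[of m] by (intro mult_mono) auto
    finally show ?thesis unfolding eq by (simp add: algebra_simps)
  qed
  have "norm (coeff_diff (diffs ?k) m) \<le> A * real (m + 2) ^ 0 / tail \<omega> (inner_radius m)" for m
  proof -
    have "(1 + E) * kernel_coeff (Suc m) \<le> (1 + E) * (9 * 2 ^ \<beta> / tail \<omega> (inner_radius m))"
      using E by (intro mult_left_mono kernel_coeff_Suc_le) auto
    then show ?thesis using d[of m] by (simp add: A_def)
  qed
  then have "circle_mean (psum (diffs ?k)) w \<le> ennreal (C * A / ((1 - norm w) ^ Suc 0 * tail \<omega> (norm w)))"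
    if "norm w < 1" for w using that A by (intro C disc_coeffs_diffs disc_coeffs_kernel) auto
  then show ?thesis using that[of "C * A"] C A by simp
qed

end

section \<open>Consequences of lower doubling\<close>

locale doubling_weight = upper_doubling_weight +
  fixes K c :: real
  assumes K: "1 < K" and c: "1 < c"
    and reverse_doubling: "0 \<le> r \<Longrightarrow> r < 1 \<Longrightarrow> c * tail \<omega> (1 - (1 - r) / K) \<le> tail \<omega> r"
begin

lemma tail_reverse_iterate:
  assumes "0 \<le> t" "t < 1" "r < 1" "(1 - r) * K ^ j \<le> 1 - t"
  shows "c ^ j * tail \<omega> r \<le> tail \<omega> t"
  using assms
proof (induction j arbitrary: t)
  case 0 then show ?case by (auto intro: tail_antimono)
next
  case (Suc j)
  let ?t = "1 - (1 - t) / K"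
  have "(1 - t) / K \<le> (1 - t) / 1" using Suc.prems K by (intro divide_left_mono) auto
  then have t: "t \<le> ?t" "?t < 1" using Suc.prems K by auto
  have "(1 - r) * K ^ j \<le> 1 - ?t" using Suc.prems K by (simp add: field_simps)
  then have "c ^ j * tail \<omega> r \<le> tail \<omega> ?t" using Suc.IH[of ?t] Suc.prems t by simp
  then have "c * (c ^ j * tail \<omega> r) \<le> c * tail \<omega> ?t" using c by (intro mult_left_mono) auto
  also have "\<dots> \<le> tail \<omega> t" using reverse_doubling Suc.prems by simp
  finally show ?case by (simp add: mult_ac)
qed

text \<open>Iterated lower doubling in continuous form: \<alpha> = ln c / ln K satisfies K^\<alpha>
  = c, and the additional factor c pays for rounding to a whole number of steps.\<close>

lemma tail_reverse:
  obtains \<alpha> where "0 < \<alpha>" "\<And>t r. 0 \<le> t \<Longrightarrow> t \<le> r \<Longrightarrow> r < 1 \<Longrightarrow>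
    tail \<omega> r \<le> c * ((1 - r) / (1 - t)) powr \<alpha> * tail \<omega> t"
proof -
  define \<alpha> where "\<alpha> = ln c / ln K"
  have \<alpha>: "0 < \<alpha>" using K c by (simp add: \<alpha>_def)
  have Ka: "K powr \<alpha> = c" using K c by (simp add: \<alpha>_def powr_def)
  have "tail \<omega> r \<le> c * ((1 - r) / (1 - t)) powr \<alpha> * tail \<omega> t" if tr: "0 \<le> t" "t \<le> r" "r < 1" for t r
  proof -
    let ?x = "(1 - t) / (1 - r)"
    have x1: "1 \<le> ?x" using tr by simp
    obtain n where n: "?x < K ^ n" using real_arch_pow[OF K] by blast
    define j where "j = (LEAST j. ?x < K ^ Suc j)"
    have ex: "\<exists>j. ?x < K ^ Suc j"
    proof
      have "K ^ n \<le> K ^ Suc n" using K by (intro power_increasing) auto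
      then show "?x < K ^ Suc n" using n by linarith
    qed
    have j1: "?x < K ^ Suc j" unfolding j_def by (rule LeastI_ex[OF ex])
    have j2: "K ^ j \<le> ?x"
    proof (cases j)
      case (Suc i)
      then have "\<not> ?x < K ^ Suc i" using not_less_Least[of i "\<lambda>j. ?x < K ^ Suc j"] unfolding j_def by simp
      then show ?thesis using Suc by simp
    qed (use x1 in simp)
    have "c ^ j * tail \<omega> r \<le> tail \<omega> t"
      using j2 tr by (intro tail_reverse_iterate) (auto simp: field_simps)
    moreover have "?x powr \<alpha> \<le> c * c ^ j"
    proof -
      have "?x powr \<alpha> \<le> (K ^ Suc j) powr \<alpha>" using j1 x1 \<alpha> by (intro powr_mono2) auto
      also have "\<dots> = (K powr \<alpha>) ^ Suc j"
        using K by (simp only: powr_realpow[symmetric] powr_gt_zero powr_powr) (simp add: powr_powr powr_realpow[symmetric] mult.commute)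
      finally show ?thesis by (simp add: Ka)
    qed
    ultimately have "?x powr \<alpha> * tail \<omega> r \<le> c * tail \<omega> t"
      using mult_right_mono[of "?x powr \<alpha>" "c * c ^ j" "tail \<omega> r"] tail_pos[OF tr(3)] c
      by (smt (verit, best) mult.assoc mult_left_mono)
    then have "((1 - r) / (1 - t)) powr \<alpha> * (?x powr \<alpha> * tail \<omega> r) \<le> ((1 - r) / (1 - t)) powr \<alpha> * (c * tail \<omega> t)"
      by (intro mult_left_mono) auto
    moreover have "((1 - r) / (1 - t)) powr \<alpha> * ?x powr \<alpha> = 1"
      using tr by (simp add: powr_mult[symmetric])
    ultimately show ?thesis by (simp only: mult.assoc[symmetric]) (simp add: mult_ac)
  qed
  then show ?thesis using that[of \<alpha>] \<alpha> by blast
qed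

text \<open>The mean of the derivative is integrated along the radius. By
  \<open>tail_reverse\<close> the reciprocal tail grows at least like a positive power of the
  reciprocal distance, so the integral is dominated by its upper end and no logarithm
  appears.\<close>

lemma circle_mean_kernel:
  obtains C where "0 < C" "\<And>w. norm w < 1 \<Longrightarrow>
    circle_mean (psum (\<lambda>m. of_real (kernel_coeff m))) w \<le> ennreal (C / tail \<omega> (norm w))"
proof -
  let ?k = "\<lambda>m. complex_of_real (kernel_coeff m)"
  obtain C where C: "0 < C" "\<And>w. norm w < 1 \<Longrightarrow>
    circle_mean (psum (diffs ?k)) w \<le> ennreal (C / ((1 - norm w) * tail \<omega> (norm w)))"
    using circle_mean_diffs_kernel by blast
  obtain \<alpha> where \<alpha>: "0 < \<alpha>" "\<And>t r. 0 \<le> t \<Longrightarrow> t \<le> r \<Longrightarrow> r < 1 \<Longrightarrow>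
    tail \<omega> r \<le> c * ((1 - r) / (1 - t)) powr \<alpha> * tail \<omega> t"
    using tail_reverse by blast
  have main: "circle_mean (psum ?k) w \<le> ennreal ((kernel_coeff 0 * tail \<omega> 0 + C * c / \<alpha>) / tail \<omega> (norm w))" if w: "norm w < 1" for w
  proof -
    define \<rho> where "\<rho> = norm w"
    have \<rho>: "0 \<le> \<rho>" "\<rho> < 1" using w by (auto simp: \<rho>_def)
    have T: "0 < tail \<omega> \<rho>" by (rule tail_pos) fact
    \<comment> \<open>Collects what does not depend on s after lower doubling between s \<rho> and
      \<rho> has replaced the reciprocal tail at s \<rho> by a power of 1 - s \<rho>.\<close>
    define D where "D = C * c * (1 - \<rho>) powr \<alpha> / tail \<omega> \<rho>"
    have D: "0 \<le> D" using C c T by (simp add: D_def)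
    have b: "circle_mean (psum (diffs ?k)) (of_real s * w) \<le> ennreal (D * (1 - s * \<rho>) powr (- \<alpha> - 1))" if s: "0 \<le> s" "s \<le> 1" for s
    proof -
      have sr: "s * \<rho> \<le> \<rho>" "0 \<le> s * \<rho>" using s \<rho> by (auto simp: mult_left_le_one_le)
      have n: "norm (of_real s * w) = s * \<rho>" using s by (simp add: norm_mult \<rho>_def)
      have Ts: "0 < tail \<omega> (s * \<rho>)" using sr \<rho> by (intro tail_pos) auto
      have p1: "0 < 1 - s * \<rho>" using sr \<rho> by simp
      have "1 / tail \<omega> (s * \<rho>) \<le> c * ((1 - \<rho>) / (1 - s * \<rho>)) powr \<alpha> / tail \<omega> \<rho>"
        using \<alpha>(2)[OF sr(2,1) \<rho>(2)] Ts T by (simp add: field_simps)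
      also have "\<dots> = c * (1 - \<rho>) powr \<alpha> * (1 - s * \<rho>) powr (- \<alpha>) / tail \<omega> \<rho>"
      proof -
        have "((1 - \<rho>) / (1 - s * \<rho>)) powr \<alpha> = (1 - \<rho>) powr \<alpha> / (1 - s * \<rho>) powr \<alpha>"
          by (rule powr_divide)
        then show ?thesis by (simp add: powr_minus divide_inverse)
      qed
      finally have "C / (1 - s * \<rho>) * (1 / tail \<omega> (s * \<rho>)) \<le> C / (1 - s * \<rho>) * (c * (1 - \<rho>) powr \<alpha> * (1 - s * \<rho>) powr (- \<alpha>) / tail \<omega> \<rho>)"
        using C p1 by (intro mult_left_mono) auto
      also have "\<dots> = D * (1 - s * \<rho>) powr (- \<alpha> - 1)"
        using p1 by (simp add: D_def powr_diff powr_minus divide_inverse)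
      finally have "C / ((1 - s * \<rho>) * tail \<omega> (s * \<rho>)) \<le> D * (1 - s * \<rho>) powr (- \<alpha> - 1)" by simp
      moreover have "circle_mean (psum (diffs ?k)) (of_real s * w) \<le> ennreal (C / ((1 - s * \<rho>) * tail \<omega> (s * \<rho>)))"
        using C(2)[of "of_real s * w"] sr \<rho> unfolding n by simp
      ultimately show ?thesis by (meson ennreal_leI order_trans)
    qed
    have int: "ennreal \<rho> * (\<integral>\<^sup>+s. ennreal (D * (1 - s * \<rho>) powr (- \<alpha> - 1)) \<partial>unit_interval) \<le> ennreal (C * c / \<alpha> / tail \<omega> \<rho>)"
    proof -
      have "ennreal \<rho> * (\<integral>\<^sup>+s. ennreal (D * (1 - s * \<rho>) powr (- \<alpha> - 1)) \<partial>unit_interval)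
        = (\<integral>\<^sup>+s. ennreal \<rho> * ennreal (D * (1 - s * \<rho>) powr (- \<alpha> - 1)) \<partial>unit_interval)"
        by (rule nn_integral_cmult[symmetric]) measurable
      also have "\<dots> = (\<integral>\<^sup>+s. ennreal (D * (\<rho> * (1 - s * \<rho>) powr (- \<alpha> - 1))) \<partial>unit_interval)"
        using \<rho> D by (simp add: ennreal_mult[symmetric] mult_ac)
      also have "\<dots> = (\<integral>\<^sup>+s. ennreal (D * (\<rho> * (1 - s * \<rho>) powr (- \<alpha> - 1))) * indicator {0..1} s \<partial>lborel)"
        unfolding unit_interval_def by (rule nn_integral_restrict_space) simp
      also have "\<dots> = ennreal (D * ((1 - 1 * \<rho>) powr (- \<alpha>) / \<alpha>) - D * ((1 - 0 * \<rho>) powr (- \<alpha>) / \<alpha>))"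
      proof (rule nn_integral_FTC_Icc[where F = "\<lambda>s. D * ((1 - s * \<rho>) powr (- \<alpha>) / \<alpha>)"])
        fix s :: real assume s01: "s \<in> {0..1}"
        then have s: "0 \<le> s" "s \<le> 1" by auto
        have p1: "0 < 1 - s * \<rho>" using s \<rho> by (smt (verit) mult_left_le_one_le)
        have "((\<lambda>s. (1 - s * \<rho>) powr (- \<alpha>)) has_real_derivative ((- \<alpha>) * (1 - s * \<rho>) powr (- \<alpha> - 1) * (- \<rho>))) (at s)"
          by (rule DERIV_fun_powr[of "\<lambda>s. 1 - s * \<rho>", unfolded of_nat_1]) (use p1 in \<open>auto intro!: derivative_eq_intros\<close>)
        then have "((\<lambda>s. D * ((1 - s * \<rho>) powr (- \<alpha>) / \<alpha>)) has_real_derivative D * (((- \<alpha>) * (1 - s * \<rho>) powr (- \<alpha> - 1) * (- \<rho>)) / \<alpha>)) (at s)"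
          by (intro DERIV_cmult DERIV_cdivide)
        then show "((\<lambda>s. D * ((1 - s * \<rho>) powr (- \<alpha>) / \<alpha>)) has_real_derivative D * (\<rho> * (1 - s * \<rho>) powr (- \<alpha> - 1))) (at s)"
          using \<alpha> by (simp add: field_simps)
        show "0 \<le> D * (\<rho> * (1 - s * \<rho>) powr (- \<alpha> - 1))" using D \<rho> by simp
      qed auto
      also have "\<dots> \<le> ennreal (D * ((1 - \<rho>) powr (- \<alpha>) / \<alpha>))"
        using D \<alpha> by (intro ennreal_leI) simp
      also have "D * ((1 - \<rho>) powr (- \<alpha>) / \<alpha>) = C * c / \<alpha> / tail \<omega> \<rho>"
        using \<rho> by (simp add: D_def powr_minus field_simps)
      finally show ?thesis .
    qed
    have "circle_mean (psum ?k) w \<le> ennreal (norm (?k 0)) + ennreal \<rho> * (\<integral>\<^sup>+s. circle_mean (psum (diffs ?k)) (of_real s * w) \<partial>unit_interval)"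
      unfolding \<rho>_def by (rule circle_mean_le_diffs[OF disc_coeffs_kernel w])
    also have "\<dots> \<le> ennreal (kernel_coeff 0) + ennreal \<rho> * (\<integral>\<^sup>+s. ennreal (D * (1 - s * \<rho>) powr (- \<alpha> - 1)) \<partial>unit_interval)"
      using kernel_coeff_pos[of 0] by (intro add_mono mult_left_mono nn_integral_mono b) auto
    \<comment> \<open>The constant term is absorbed because the tail at \<rho> is at most the tail
      at 0.\<close>
    also have "\<dots> \<le> ennreal (kernel_coeff 0 * tail \<omega> 0 / tail \<omega> \<rho>) + ennreal (C * c / \<alpha> / tail \<omega> \<rho>)"
    proof (intro add_mono int ennreal_leI)
      have "kernel_coeff 0 * tail \<omega> \<rho> \<le> kernel_coeff 0 * tail \<omega> 0"
        using kernel_coeff_pos[of 0] \<rho> by (intro mult_left_mono tail_antimono) auto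
      then show "kernel_coeff 0 \<le> kernel_coeff 0 * tail \<omega> 0 / tail \<omega> \<rho>" using T by (simp add: field_simps)
    qed
    also have "\<dots> = ennreal (kernel_coeff 0 * tail \<omega> 0 / tail \<omega> \<rho> + C * c / \<alpha> / tail \<omega> \<rho>)"
      using kernel_coeff_pos[of 0] tail_pos[of 0] T C c \<alpha> by (intro ennreal_plus[symmetric]) auto
    also have "kernel_coeff 0 * tail \<omega> 0 / tail \<omega> \<rho> + C * c / \<alpha> / tail \<omega> \<rho> = (kernel_coeff 0 * tail \<omega> 0 + C * c / \<alpha>) / tail \<omega> \<rho>"
      by (simp add: add_divide_distrib)
    finally show ?thesis by (simp add: \<rho>_def)
  qed
  have "0 < kernel_coeff 0 * tail \<omega> 0 + C * c / \<alpha>"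
    using kernel_coeff_pos[of 0] tail_pos[of 0] C c \<alpha> by (intro add_pos_pos) auto
  then show ?thesis using that main by blast
qed

end

section \<open>The Schur test and the maximal Bergman projection\<close>

text \<open>The density \<kappa> is kept as a factor because two kinds are needed: the weight alone
  for pairings, and kernel times weight for the Schur test. After normalising both factors the
  inequality is Young's; if one of them has norm zero, the product vanishes almost
  everywhere.\<close>

lemma Holder_weighted:
  fixes a b \<kappa> :: "'a \<Rightarrow> real"
  assumes pq: "1 < p" "1 < q" "1 / p + 1 / q = 1"
    and [measurable]: "a \<in> borel_measurable M" "b \<in> borel_measurable M" "\<kappa> \<in> borel_measurable M"
    and nn: "\<And>x. x \<in> space M \<Longrightarrow> 0 \<le> a x" "\<And>x. x \<in> space M \<Longrightarrow> 0 \<le> b x" "\<And>x. x \<in> space M \<Longrightarrow> 0 \<le> \<kappa> x"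
    and ia: "integrable M (\<lambda>x. a x powr p * \<kappa> x)" and ib: "integrable M (\<lambda>x. b x powr q * \<kappa> x)"
  shows "integrable M (\<lambda>x. a x * b x * \<kappa> x)"
    "(\<integral>x. a x * b x * \<kappa> x \<partial>M) \<le> (\<integral>x. a x powr p * \<kappa> x \<partial>M) powr (1 / p) * (\<integral>x. b x powr q * \<kappa> x \<partial>M) powr (1 / q)"
proof -
  define A where "A = (\<integral>x. a x powr p * \<kappa> x \<partial>M)"
  define B where "B = (\<integral>x. b x powr q * \<kappa> x \<partial>M)"
  have A0: "0 \<le> A" unfolding A_def using nn by (intro integral_nonneg_AE AE_I2) auto
  have B0: "0 \<le> B" unfolding B_def using nn by (intro integral_nonneg_AE AE_I2) auto
  show int: "integrable M (\<lambda>x. a x * b x * \<kappa> x)"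
  proof (rule Bochner_Integration.integrable_bound)
    show "integrable M (\<lambda>x. a x powr p * \<kappa> x / p + b x powr q * \<kappa> x / q)" using ia ib by auto
    show "AE x in M. norm (a x * b x * \<kappa> x) \<le> norm (a x powr p * \<kappa> x / p + b x powr q * \<kappa> x / q)"
    proof (rule AE_I2)
      fix x assume x: "x \<in> space M"
      have "a x * b x * \<kappa> x \<le> (a x powr p / p + b x powr q / q) * \<kappa> x"
        using nn[OF x] by (intro mult_right_mono Youngs_inequality pq) auto
      then have "\<bar>a x * b x * \<kappa> x\<bar> \<le> a x powr p * \<kappa> x / p + b x powr q * \<kappa> x / q"
        using nn[OF x] by (simp add: algebra_simps add_divide_distrib)
      then show "norm (a x * b x * \<kappa> x) \<le> norm (a x powr p * \<kappa> x / p + b x powr q * \<kappa> x / q)"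
        by simp
    qed
  qed measurable
  have zero: "(\<integral>x. a x * b x * \<kappa> x \<partial>M) = 0" if "A = 0 \<or> B = 0"
  proof -
    have "AE x in M. a x * b x * \<kappa> x = 0"
      using that
    proof
      assume "A = 0"
      then have "AE x in M. a x powr p * \<kappa> x = 0"
        unfolding A_def using nn by (subst (asm) integral_nonneg_eq_0_iff_AE[OF ia]) (auto intro!: AE_I2)
      then show ?thesis by eventually_elim auto
    next
      assume "B = 0"
      then have "AE x in M. b x powr q * \<kappa> x = 0"
        unfolding B_def using nn by (subst (asm) integral_nonneg_eq_0_iff_AE[OF ib]) (auto intro!: AE_I2)
      then show ?thesis by eventually_elim auto
    qed
    then show ?thesis by (rule integral_eq_zero_AE)
  qed
  show "(\<integral>x. a x * b x * \<kappa> x \<partial>M) \<le> A powr (1 / p) * B powr (1 / q)"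
  proof (cases "A = 0 \<or> B = 0")
    case False
    then have AB: "0 < A" "0 < B" using A0 B0 by auto
    have Ap: "(A powr (1 / p)) powr p = A" "(B powr (1 / q)) powr q = B" using AB pq by (auto simp: powr_powr)
    let ?N = "A powr (1 / p) * B powr (1 / q)"
    have N: "0 < ?N" using AB by simp
    have "(\<integral>x. a x * b x * \<kappa> x / ?N \<partial>M) \<le> (\<integral>x. (a x powr p * \<kappa> x) / (p * A) + (b x powr q * \<kappa> x) / (q * B) \<partial>M)"
    proof (rule integral_mono)
      show "integrable M (\<lambda>x. a x * b x * \<kappa> x / ?N)" using int by simp
      show "integrable M (\<lambda>x. (a x powr p * \<kappa> x) / (p * A) + (b x powr q * \<kappa> x) / (q * B))" using ia ib by auto
      fix x assume x: "x \<in> space M"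
      have "(a x / A powr (1 / p)) * (b x / B powr (1 / q)) \<le> (a x / A powr (1 / p)) powr p / p + (b x / B powr (1 / q)) powr q / q"
        using nn[OF x] by (intro Youngs_inequality pq) auto
      also have "\<dots> = a x powr p / (p * A) + b x powr q / (q * B)"
        using nn[OF x] AB Ap by (simp add: powr_divide mult.commute)
      finally have "(a x / A powr (1 / p)) * (b x / B powr (1 / q)) * \<kappa> x \<le> (a x powr p / (p * A) + b x powr q / (q * B)) * \<kappa> x"
        using nn[OF x] by (intro mult_right_mono) auto
      then show "a x * b x * \<kappa> x / ?N \<le> (a x powr p * \<kappa> x) / (p * A) + (b x powr q * \<kappa> x) / (q * B)"
        by (simp add: algebra_simps)
    qed
    also have "\<dots> = A / (p * A) + B / (q * B)" using ia ib by (simp add: A_def B_def)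
    also have "\<dots> = 1" using AB pq by simp
    finally have "(\<integral>x. a x * b x * \<kappa> x \<partial>M) / ?N \<le> 1" by simp
    then show ?thesis using N by (simp add: field_simps)
  qed (use zero in simp)
qed

context weight
begin

lemma measurable_disc_profile [measurable]: "(\<lambda>z. \<omega> (norm z)) \<in> borel_measurable disc_area"
proof -
  have "(\<lambda>z. indicator {0..<1} (norm z) * \<omega> (norm z)) \<in> borel_measurable disc_area"
    using measurable_compose[OF measurable_cmod_disc measurable_profile] .
  then show ?thesis by (rule measurable_cong[THEN iffD1, rotated]) (auto simp: indicator_def)
qed

lemma disc_profile_nonneg: "norm z < 1 \<Longrightarrow> 0 \<le> \<omega> (norm z)"
  by (rule nonneg) auto

lemma nn_integral_disc_weight:
  assumes f[measurable]: "f \<in> borel_measurable borel"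
  shows "(\<integral>\<^sup>+z. f (norm z) * ennreal (\<omega> (norm z)) \<partial>disc_area) = (\<integral>\<^sup>+r. f r * ennreal (2 * r) \<partial>radial_measure \<omega>)"
proof -
  have fm: "f \<in> borel_measurable lebesgue" by (rule measurable_lebesgue_borel) fact
  have eq: "(\<lambda>r. f r * ennreal (\<omega> r) * indicator {0..<1} r) = (\<lambda>r. f r * ennreal (indicator {0..<1} r * \<omega> r))"
    by (auto simp: indicator_def)
  have "(\<lambda>r. f r * ennreal (\<omega> r) * indicator {0..<1} r) \<in> borel_measurable lebesgue"
    unfolding eq by (rule borel_measurable_times_ennreal[OF fm measurable_profile_ennreal])
  then have "(\<integral>\<^sup>+z. f (norm z) * ennreal (\<omega> (norm z)) \<partial>disc_area) = (\<integral>\<^sup>+r\<in>{0..<1}. f r * ennreal (\<omega> r) * ennreal (2 * r) \<partial>lebesgue)"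
    using nn_integral_disc_radial[of "\<lambda>r. f r * ennreal (\<omega> r)"] by simp
  also have "\<dots> = (\<integral>\<^sup>+r. ennreal (indicator {0..<1} r * \<omega> r) * (f r * ennreal (2 * r)) \<partial>lebesgue)"
    by (intro nn_integral_cong) (auto simp: indicator_def mult_ac)
  also have "\<dots> = (\<integral>\<^sup>+r. f r * ennreal (2 * r) \<partial>radial_measure \<omega>)"
    by (rule nn_integral_radial[symmetric]) measurable
  finally show ?thesis .
qed

lemma nn_integral_disc_weight_le:
  assumes f[measurable]: "f \<in> borel_measurable borel"
  shows "(\<integral>\<^sup>+z. f (norm z) * ennreal (\<omega> (norm z)) \<partial>disc_area) \<le> 2 * (\<integral>\<^sup>+r. f r \<partial>radial_measure \<omega>)"
proof -
  have "(\<integral>\<^sup>+z. f (norm z) * ennreal (\<omega> (norm z)) \<partial>disc_area) \<le> (\<integral>\<^sup>+r. 2 * f r \<partial>radial_measure \<omega>)"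
    unfolding nn_integral_disc_weight[OF f]
  proof (rule nn_integral_mono_AE)
    show "AE r in radial_measure \<omega>. f r * ennreal (2 * r) \<le> 2 * f r"
      using AE_radial
    proof eventually_elim
      case (elim r)
      have "ennreal (2 * r) \<le> ennreal 2" using elim by (intro ennreal_leI) simp
      then show ?case using mult_left_mono[of "ennreal (2 * r)" 2 "f r"] by (simp add: mult.commute)
    qed
  qed
  also have "\<dots> = 2 * (\<integral>\<^sup>+r. f r \<partial>radial_measure \<omega>)" by (rule nn_integral_cmult) measurable
  finally show ?thesis .
qed

text \<open>The factor 2 r of the area element raises the order 2 k to the odd order 2 k +
  1.\<close>

lemma disc_moment:
  "integrable disc_area (\<lambda>z. norm z ^ (2 * k) * \<omega> (norm z))"
  "(\<integral>z. norm z ^ (2 * k) * \<omega> (norm z) \<partial>disc_area) = 2 * moment (2 * k + 1)"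
proof -
  have "(\<integral>\<^sup>+z. ennreal (norm z ^ (2 * k) * \<omega> (norm z)) \<partial>disc_area) = (\<integral>\<^sup>+z. ennreal (norm z ^ (2 * k)) * ennreal (\<omega> (norm z)) \<partial>disc_area)"
    by (intro nn_integral_cong ennreal_mult) (auto simp: disc_profile_nonneg)
  also have "\<dots> = (\<integral>\<^sup>+r. ennreal (r ^ (2 * k)) * ennreal (2 * r) \<partial>radial_measure \<omega>)"
    by (rule nn_integral_disc_weight) measurable
  also have "\<dots> = (\<integral>\<^sup>+r. ennreal (2 * r ^ (2 * k + 1)) \<partial>radial_measure \<omega>)"
  proof (rule nn_integral_cong_AE)
    show "AE r in radial_measure \<omega>. ennreal (r ^ (2 * k)) * ennreal (2 * r) = ennreal (2 * r ^ (2 * k + 1))"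
      using AE_radial by eventually_elim (simp add: ennreal_mult[symmetric] mult_ac)
  qed
  also have "\<dots> = ennreal (\<integral>r. 2 * r ^ (2 * k + 1) \<partial>radial_measure \<omega>)"
  proof (rule nn_integral_eq_integral)
    show "integrable (radial_measure \<omega>) (\<lambda>r. 2 * r ^ (2 * k + 1))" by (intro integrable_mult_right integrable_power)
    show "AE r in radial_measure \<omega>. 0 \<le> 2 * r ^ (2 * k + 1)" using AE_radial by eventually_elim simp
  qed
  also have "(\<integral>r. 2 * r ^ (2 * k + 1) \<partial>radial_measure \<omega>) = 2 * moment (2 * k + 1)" by (simp add: moment_def)
  finally have *: "(\<integral>\<^sup>+z. ennreal (norm z ^ (2 * k) * \<omega> (norm z)) \<partial>disc_area) = ennreal (2 * moment (2 * k + 1))" .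
  have "(\<integral>\<^sup>+z. ennreal (norm z ^ (2 * k) * \<omega> (norm z)) \<partial>disc_area) = ennreal (2 * moment (2 * k + 1)) \<longleftrightarrow>
      integrable disc_area (\<lambda>z. norm z ^ (2 * k) * \<omega> (norm z)) \<and> (\<integral>z. norm z ^ (2 * k) * \<omega> (norm z) \<partial>disc_area) = 2 * moment (2 * k + 1)"
    using moment_pos[of k] by (intro nn_integral_eq_integrable) (auto simp: disc_profile_nonneg)
  then show "integrable disc_area (\<lambda>z. norm z ^ (2 * k) * \<omega> (norm z))"
     "(\<integral>z. norm z ^ (2 * k) * \<omega> (norm z) \<partial>disc_area) = 2 * moment (2 * k + 1)" using * by auto
qed

lemma integrable_disc_profile: "integrable disc_area (\<lambda>z. \<omega> (norm z))"
  using disc_moment(1)[of 0] by simp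

text \<open>By \<open>emeasure_tail_le\<close> the tail u is distributed at most like a uniform
  variable, so the model is the integral of min(1/u, 1/t) u^(-s) over u > 0. It converges at 0
  because s < 1 and at infinity because s > 0.\<close>

lemma schur_radial:
  assumes s: "0 < s" "s < 1"
  obtains C where "0 < C" "\<And>\<rho>. \<rho> < 1 \<Longrightarrow>
    (\<integral>\<^sup>+r. ennreal (min (1 / tail \<omega> r) (1 / tail \<omega> \<rho>) * tail \<omega> r powr (- s)) \<partial>radial_measure \<omega>)
      \<le> ennreal (C * tail \<omega> \<rho> powr (- s))"
proof -
  define C1 where "C1 = 2 powr s * (1 / (1 - 2 powr (s - 1)))"
  define C2 where "C2 = 2 * (1 / (1 - 2 powr (- s)))"
  have q: "2 powr (s - 1) < 1" "2 powr (- s) < 1" using s by (auto simp: powr_less_one)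
  have C: "0 < C1" "0 < C2" using q by (auto simp: C1_def C2_def)
  have main: "(\<integral>\<^sup>+r. ennreal (min (1 / tail \<omega> r) (1 / tail \<omega> \<rho>) * tail \<omega> r powr (- s)) \<partial>radial_measure \<omega>)
      \<le> ennreal ((C1 + C2) * tail \<omega> \<rho> powr (- s))" if \<rho>: "\<rho> < 1" for \<rho>
  proof -
    define t where "t = tail \<omega> \<rho>"
    have t: "0 < t" unfolding t_def by (rule tail_pos) fact
    let ?T = "tail \<omega>"
    \<comment> \<open>The minimum is split at tail = t; \<open>?f1\<close> is summed over dyadic
      layers downwards from t and \<open>?f2\<close> upwards.\<close>
    let ?f1 = "\<lambda>r. if ?T r \<le> t then ennreal (?T r powr (- s) / t) else 0"
    let ?f2 = "\<lambda>r. if t < ?T r then ennreal (?T r powr (- 1 - s)) else 0"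
    have "(\<integral>\<^sup>+r. ennreal (min (1 / ?T r) (1 / t) * ?T r powr (- s)) \<partial>radial_measure \<omega>) \<le> (\<integral>\<^sup>+r. ?f1 r + ?f2 r \<partial>radial_measure \<omega>)"
    proof (rule nn_integral_mono_AE)
      show "AE r in radial_measure \<omega>. ennreal (min (1 / ?T r) (1 / t) * ?T r powr (- s)) \<le> ?f1 r + ?f2 r"
        using AE_radial
      proof eventually_elim
        case (elim r)
        have T: "0 < ?T r" using elim by (intro tail_pos) auto
        show ?case
        proof (cases "?T r \<le> t")
          case True
          have "min (1 / ?T r) (1 / t) * ?T r powr (- s) \<le> (1 / t) * ?T r powr (- s)" by (intro mult_right_mono) auto
          then show ?thesis using True by (simp add: ennreal_leI)
        next
          case False
          have "min (1 / ?T r) (1 / t) * ?T r powr (- s) \<le> (1 / ?T r) * ?T r powr (- s)" by (intro mult_right_mono) auto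
          also have "\<dots> = ?T r powr (- 1 - s)" using T by (simp add: powr_diff powr_minus divide_inverse)
          finally show ?thesis using False by (simp add: ennreal_leI)
        qed
      qed
    qed
    also have "\<dots> = (\<integral>\<^sup>+r. ?f1 r \<partial>radial_measure \<omega>) + (\<integral>\<^sup>+r. ?f2 r \<partial>radial_measure \<omega>)"
      by (rule nn_integral_add) measurable
    also have "(\<integral>\<^sup>+r. ?f1 r \<partial>radial_measure \<omega>) \<le> ennreal (C1 * t powr (- s))"
    proof (rule nn_integral_le_layers)
      let ?A = "\<lambda>j::nat. {r. 0 \<le> r \<and> r < 1 \<and> ?T r \<le> t / 2 ^ j}"
      let ?c = "\<lambda>j::nat. (t / 2 ^ Suc j) powr (- s) / t"
      show "\<exists>j. r \<in> ?A j \<and> ?f1 r \<le> ennreal (?c j)" if r: "0 \<le> r" "r < 1" "?f1 r \<noteq> 0" for r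
      proof -
        have T: "0 < ?T r" "?T r \<le> t" using r by (auto intro: tail_pos split: if_splits)
        obtain j :: nat where j: "t \<le> 2 ^ Suc j * ?T r" "j = 0 \<or> 2 ^ j * ?T r < t"
          using dyadic_level[OF T(1), of t] by blast
        have "?T r powr (- s) \<le> (t / 2 ^ Suc j) powr (- s)"
          using j t s by (intro powr_mono2') (auto simp: field_simps)
        then have "?f1 r \<le> ennreal (?c j)" using T t by (auto intro!: ennreal_leI divide_right_mono)
        moreover have "?T r \<le> t / 2 ^ j" using j T by (auto simp: field_simps)
        ultimately show ?thesis using r by auto
      qed
      show "emeasure (radial_measure \<omega>) (?A j) \<le> ennreal (t / 2 ^ j)" for j
        using t by (intro emeasure_tail_le) auto
      show "(\<lambda>j. ?c j * (t / 2 ^ j)) sums (C1 * t powr (- s))"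
      proof -
        have "?c j * (t / 2 ^ j) = (2 powr s * t powr (- s)) * (2 powr (s - 1)) ^ j" for j
        proof -
          have e1: "?c j * (t / 2 ^ j) = (t / 2 ^ Suc j) powr (- s) / 2 ^ j" using t by simp
          have e2: "(t / 2 ^ Suc j) powr (- s) = t powr (- s) * (2 powr s * 2 powr (real j * s))"
            using t by (simp add: powr_divide powr_mult powr_minus field_simps powr_realpow[symmetric] powr_powr powr_add[symmetric])
          have e3: "t powr (- s) * (2 powr s * 2 powr (real j * s)) / 2 ^ j = (2 powr s * t powr (- s)) * (2 powr (real j * s) / 2 powr real j)"
            by (simp add: powr_realpow)
          have e4: "2 powr (real j * s) / 2 powr real j = (2 powr (s - 1)) ^ j"
            by (simp add: powr_realpow[symmetric] powr_powr powr_diff[symmetric] algebra_simps)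
          show ?thesis by (rule trans[OF e1]) (simp only: e2 e3 e4)
        qed
        then have "(\<lambda>j. ?c j * (t / 2 ^ j)) = (\<lambda>j. (2 powr s * t powr (- s)) * (2 powr (s - 1)) ^ j)" by (rule ext)
        moreover have "(\<lambda>j. (2 powr s * t powr (- s)) * (2 powr (s - 1)) ^ j) sums ((2 powr s * t powr (- s)) * (1 / (1 - 2 powr (s - 1))))"
          using q by (intro sums_mult geometric_sums) auto
        moreover have "(2 powr s * t powr (- s)) * (1 / (1 - 2 powr (s - 1))) = C1 * t powr (- s)" by (simp add: C1_def)
        ultimately show ?thesis by (simp only:)
      qed
    qed (use t in auto)
    also have "(\<integral>\<^sup>+r. ?f2 r \<partial>radial_measure \<omega>) \<le> ennreal (C2 * t powr (- s))"
    proof (rule nn_integral_le_layers)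
      let ?A = "\<lambda>j::nat. {r. 0 \<le> r \<and> r < 1 \<and> ?T r \<le> 2 ^ Suc j * t}"
      let ?c = "\<lambda>j::nat. (2 ^ j * t) powr (- 1 - s)"
      show "\<exists>j. r \<in> ?A j \<and> ?f2 r \<le> ennreal (?c j)" if r: "0 \<le> r" "r < 1" "?f2 r \<noteq> 0" for r
      proof -
        have T: "0 < ?T r" "t < ?T r" using r by (auto intro: tail_pos split: if_splits)
        obtain j :: nat where j: "?T r \<le> 2 ^ Suc j * t" "j = 0 \<or> 2 ^ j * t < ?T r"
          using dyadic_level[OF t, of "?T r"] by blast
        have "?T r powr (- 1 - s) \<le> ?c j"
          using j t s T by (intro powr_mono2') auto
        then have "?f2 r \<le> ennreal (?c j)" using T t by (auto intro!: ennreal_leI)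
        then show ?thesis using r j by auto
      qed
      show "emeasure (radial_measure \<omega>) (?A j) \<le> ennreal (2 ^ Suc j * t)" for j
        using t by (intro emeasure_tail_le) auto
      show "(\<lambda>j. ?c j * (2 ^ Suc j * t)) sums (C2 * t powr (- s))"
      proof -
        have "?c j * (2 ^ Suc j * t) = (2 * t powr (- s)) * (2 powr (- s)) ^ j" for j
        proof -
          have "(2 ^ j * t) powr (- 1 - s) = (2 ^ j * t) powr (- s) / (2 ^ j * t)"
            using t by (simp add: powr_diff powr_minus divide_inverse)
          then have "?c j * (2 ^ Suc j * t) = 2 * (2 ^ j * t) powr (- s)" using t by simp
          also have "(2 ^ j * t) powr (- s) = (2 ^ j) powr (- s) * t powr (- s)" using t by (simp add: powr_mult)
          also have "(2 ^ j) powr (- s) = (2 powr (- s)) ^ j"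
            by (simp add: powr_realpow[symmetric] powr_powr mult.commute)
          finally show ?thesis by simp
        qed
        then have "(\<lambda>j. ?c j * (2 ^ Suc j * t)) = (\<lambda>j. (2 * t powr (- s)) * (2 powr (- s)) ^ j)" by (rule ext)
        moreover have "(\<lambda>j. (2 * t powr (- s)) * (2 powr (- s)) ^ j) sums ((2 * t powr (- s)) * (1 / (1 - 2 powr (- s))))"
          using q by (intro sums_mult geometric_sums) auto
        moreover have "(2 * t powr (- s)) * (1 / (1 - 2 powr (- s))) = C2 * t powr (- s)" by (simp add: C2_def)
        ultimately show ?thesis by (simp only:)
      qed
    qed (use t in auto)
    finally show ?thesis using C by (simp add: t_def algebra_simps flip: ennreal_plus)
  qed
  show ?thesis using that[of "C1 + C2"] C main by simp
qed

end

context upper_doubling_weight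
begin

text \<open>Two of the \<gamma> powers are integrated over circles exactly, by Parseval for 1 / (1 -
  w); the remaining \<gamma> - 2 \<ge> 0 are replaced by their maximum on the circle. This leaves
  the radial exponent \<gamma> - 1 > \<beta> for \<open>layer_integral\<close>.\<close>

lemma test_function_bound:
  assumes \<gamma>: "real \<beta> + 1 < \<gamma>" "2 \<le> \<gamma>"
  obtains C where "0 < C" "\<And>b. norm b < 1 \<Longrightarrow>
    (\<integral>\<^sup>+z. ennreal (norm (1 - b * z) powr (- \<gamma>)) * ennreal (\<omega> (norm z)) \<partial>disc_area)
      \<le> ennreal (C * (tail \<omega> (norm b) * (1 - norm b) powr (1 - \<gamma>)))"
proof -
  obtain C where C: "0 < C" "\<And>\<rho>. 0 \<le> \<rho> \<Longrightarrow> \<rho> < 1 \<Longrightarrow>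
    (\<integral>\<^sup>+r. ennreal ((1 - \<rho> * r) powr (- (\<gamma> - 1))) \<partial>radial_measure \<omega>) \<le> ennreal (C * (tail \<omega> \<rho> * (1 - \<rho>) powr (- (\<gamma> - 1))))"
    using layer_integral[of "\<gamma> - 1"] \<gamma> by auto
  have "(\<integral>\<^sup>+z. ennreal (norm (1 - b * z) powr (- \<gamma>)) * ennreal (\<omega> (norm z)) \<partial>disc_area)
      \<le> ennreal (2 * C * (tail \<omega> (norm b) * (1 - norm b) powr (1 - \<gamma>)))" if b: "norm b < 1" for b
  proof -
    define \<rho> where "\<rho> = norm b"
    have \<rho>: "0 \<le> \<rho>" "\<rho> < 1" using b by (auto simp: \<rho>_def)
    let ?F = "\<lambda>w. (psum (\<lambda>_. 1) w)\<^sup>2"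
    have one: "disc_coeffs (\<lambda>_. 1)" using disc_coeffs_power[of 0] by simp
    have F: "psum (\<lambda>_. 1) u = 1 / (1 - u)" if "norm u < 1" for u
      using suminf_geometric[OF that] by (simp add: psum_def)
    have lt: "\<rho> * norm z < 1" if "norm z < 1" for z :: complex
      using \<rho> that by (smt (verit, best) mult_left_le norm_ge_zero)
    let ?\<phi> = "\<lambda>r. ennreal ((1 - \<rho> * r) powr (- (\<gamma> - 2)))"
    have mphi: "(\<lambda>z. ?\<phi> (norm z) * ennreal (\<omega> (norm z))) \<in> borel_measurable disc_area" by measurable
    have "(\<integral>\<^sup>+z. ennreal (norm (1 - b * z) powr (- \<gamma>)) * ennreal (\<omega> (norm z)) \<partial>disc_area)
      \<le> (\<integral>\<^sup>+z. ennreal (norm (?F (b * z))) * (?\<phi> (norm z) * ennreal (\<omega> (norm z))) \<partial>disc_area)"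
    proof (rule nn_integral_mono)
      fix z assume "z \<in> space disc_area"
      then have z: "norm z < 1" by simp
      have bz: "norm (b * z) = \<rho> * norm z" by (simp add: norm_mult \<rho>_def)
      have n1: "1 - \<rho> * norm z \<le> norm (1 - b * z)"
        using norm_triangle_ineq2[of 1 "b * z"] by (simp add: bz)
      have pos: "0 < norm (1 - b * z)" using n1 lt[OF z] by linarith
      have "norm (1 - b * z) powr (- \<gamma>) = norm (1 - b * z) powr (- 2) * norm (1 - b * z) powr (- (\<gamma> - 2))"
        by (simp add: powr_add[symmetric])
      also have "norm (1 - b * z) powr (- 2) = norm (?F (b * z))"
        using pos lt[OF z] by (simp add: F bz norm_power norm_divide powr_minus powr_numeral power_one_over inverse_eq_divide)
      also have "norm (?F (b * z)) * norm (1 - b * z) powr (- (\<gamma> - 2)) \<le> norm (?F (b * z)) * (1 - \<rho> * norm z) powr (- (\<gamma> - 2))"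
        using n1 lt[OF z] \<gamma> by (intro mult_left_mono powr_mono2') auto
      finally have "ennreal (norm (1 - b * z) powr (- \<gamma>)) \<le> ennreal (norm (?F (b * z))) * ?\<phi> (norm z)"
        by (simp add: ennreal_mult[symmetric] ennreal_leI)
      then have "ennreal (norm (1 - b * z) powr (- \<gamma>)) * ennreal (\<omega> (norm z)) \<le> ennreal (norm (?F (b * z))) * ?\<phi> (norm z) * ennreal (\<omega> (norm z))"
        by (rule mult_right_mono) simp
      then show "ennreal (norm (1 - b * z) powr (- \<gamma>)) * ennreal (\<omega> (norm z)) \<le> ennreal (norm (?F (b * z))) * (?\<phi> (norm z) * ennreal (\<omega> (norm z)))"
        by (simp add: mult.assoc)
    qed
    also have "\<dots> = (\<integral>\<^sup>+z. circle_mean ?F (b * z) * (?\<phi> (norm z) * ennreal (\<omega> (norm z))) \<partial>disc_area)"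
      by (rule nn_integral_disc_circle_mean[OF _ mphi]) measurable
    also have "\<dots> \<le> (\<integral>\<^sup>+z. ennreal ((1 - \<rho> * norm z) powr (- (\<gamma> - 1))) * ennreal (\<omega> (norm z)) \<partial>disc_area)"
    proof (rule nn_integral_mono)
      fix z assume "z \<in> space disc_area"
      then have z: "norm z < 1" by simp
      have bz: "norm (b * z) = \<rho> * norm z" by (simp add: norm_mult \<rho>_def)
      have l: "\<rho> * norm z < 1" "0 \<le> \<rho> * norm z" using lt[OF z] \<rho> by auto
      have "circle_mean ?F (b * z) = ennreal (\<Sum>n. (norm (1::complex) * norm (b * z) ^ n)\<^sup>2)"
        unfolding circle_mean_def norm_power
        by (rule nn_integral_psum_square[OF one]) (use l bz in simp)
      also have "(\<Sum>n. (norm (1::complex) * norm (b * z) ^ n)\<^sup>2) = (\<Sum>n. ((\<rho> * norm z)\<^sup>2) ^ n)"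
        unfolding bz by (simp add: power_mult[symmetric] mult.commute)
      also have "\<dots> = 1 / (1 - (\<rho> * norm z)\<^sup>2)"
      proof (rule suminf_geometric)
        have "(\<rho> * norm z) ^ 2 < 1" using l power_less_one_iff[of "\<rho> * norm z" 2] by simp
        then show "norm ((\<rho> * norm z)\<^sup>2) < 1" by simp
      qed
      also have "ennreal (1 / (1 - (\<rho> * norm z)\<^sup>2)) \<le> ennreal (1 / (1 - \<rho> * norm z))"
      proof (intro ennreal_leI divide_left_mono)
        have "(\<rho> * norm z)\<^sup>2 \<le> \<rho> * norm z" using l by (simp add: power2_eq_square mult_left_le del: mult_le_cancel_left1)
        then show "1 - \<rho> * norm z \<le> 1 - (\<rho> * norm z)\<^sup>2" by simp
        with l show "0 < (1 - (\<rho> * norm z)\<^sup>2) * (1 - \<rho> * norm z)" by (intro mult_pos_pos) linarith+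
      qed simp
      finally have "circle_mean ?F (b * z) * ?\<phi> (norm z) \<le> ennreal (1 / (1 - \<rho> * norm z)) * ?\<phi> (norm z)"
        by (rule mult_right_mono) simp
      also have "\<dots> = ennreal ((1 - \<rho> * norm z) powr (- (\<gamma> - 1)))"
      proof -
        have "1 / u * u powr (- (\<gamma> - 2)) = u powr (- (\<gamma> - 1))" if "0 < u" for u :: real
          using powr_diff[of u "2 - \<gamma>" 1] that by simp
        then have "1 / (1 - \<rho> * norm z) * (1 - \<rho> * norm z) powr (- (\<gamma> - 2)) = (1 - \<rho> * norm z) powr (- (\<gamma> - 1))"
          using l by simp
        then show ?thesis using l by (simp add: ennreal_mult[symmetric])
      qed
      finally have "circle_mean ?F (b * z) * ?\<phi> (norm z) * ennreal (\<omega> (norm z)) \<le> ennreal ((1 - \<rho> * norm z) powr (- (\<gamma> - 1))) * ennreal (\<omega> (norm z))"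
        by (rule mult_right_mono) simp
      then show "circle_mean ?F (b * z) * (?\<phi> (norm z) * ennreal (\<omega> (norm z))) \<le> ennreal ((1 - \<rho> * norm z) powr (- (\<gamma> - 1))) * ennreal (\<omega> (norm z))"
        by (simp add: mult.assoc)
    qed
    also have "\<dots> \<le> 2 * (\<integral>\<^sup>+r. ennreal ((1 - \<rho> * r) powr (- (\<gamma> - 1))) \<partial>radial_measure \<omega>)"
      by (rule nn_integral_disc_weight_le) measurable
    also have "\<dots> \<le> ennreal 2 * ennreal (C * (tail \<omega> \<rho> * (1 - \<rho>) powr (- (\<gamma> - 1))))"
      using C(2)[OF \<rho>] by (simp add: mult_left_mono)
    also have "\<dots> = ennreal (2 * (C * (tail \<omega> \<rho> * (1 - \<rho>) powr (- (\<gamma> - 1)))))"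
      using C tail_pos[OF \<rho>(2)] by (intro ennreal_mult[symmetric]) auto
    finally show ?thesis by (simp add: \<rho>_def mult.assoc)
  qed
  then show ?thesis using that[of "2 * C"] C by simp
qed

end

context weight
begin

abbreviation lp_integral :: "real \<Rightarrow> (complex \<Rightarrow> complex) \<Rightarrow> ennreal" where
  "lp_integral p f \<equiv> (\<integral>\<^sup>+z. ennreal (norm (f z) powr p * \<omega> (norm z)) \<partial>disc_area)"

lemma integrable_disc_weight_bounded:
  fixes h :: "complex \<Rightarrow> real"
  assumes [measurable]: "h \<in> borel_measurable disc_area" and b: "\<And>z. norm z < 1 \<Longrightarrow> \<bar>h z\<bar> \<le> B"
  shows "integrable disc_area (\<lambda>z. h z * \<omega> (norm z))"
proof (rule Bochner_Integration.integrable_bound)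
  show "integrable disc_area (\<lambda>z. B * \<omega> (norm z))" using integrable_disc_profile by simp
  show "AE z in disc_area. norm (h z * \<omega> (norm z)) \<le> norm (B * \<omega> (norm z))"
  proof (rule AE_I2)
    fix z assume "z \<in> space disc_area"
    then have z: "norm z < 1" by simp
    have "\<bar>h z\<bar> * \<bar>\<omega> (norm z)\<bar> \<le> \<bar>B\<bar> * \<bar>\<omega> (norm z)\<bar>" using b[OF z] by (intro mult_right_mono) auto
    then show "norm (h z * \<omega> (norm z)) \<le> norm (B * \<omega> (norm z))" by (simp add: abs_mult)
  qed
qed measurable

end

context upper_doubling_weight
begin

abbreviation kernel_series :: "complex \<Rightarrow> complex" where
  "kernel_series \<equiv> psum (\<lambda>m. of_real (kernel_coeff m))"

end

context doubling_weight
begin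

text \<open>The circle mean is taken at radius |a z|, which exceeds neither |z| nor |a|;
  monotonicity of the tail yields the minimum of \<open>schur_radial\<close>.\<close>

lemma schur_kernel_disc:
  assumes s: "0 < s" "s < 1"
  obtains C where "0 < C" "\<And>a. norm a < 1 \<Longrightarrow>
    (\<integral>\<^sup>+z. ennreal (norm (kernel_series (a * z)) * tail \<omega> (norm z) powr (- s) * \<omega> (norm z)) \<partial>disc_area)
      \<le> ennreal (C * tail \<omega> (norm a) powr (- s))"
proof -
  obtain C1 where C1: "0 < C1" "\<And>w. norm w < 1 \<Longrightarrow> circle_mean kernel_series w \<le> ennreal (C1 / tail \<omega> (norm w))"
    using circle_mean_kernel by blast
  obtain C2 where C2: "0 < C2" "\<And>\<rho>. \<rho> < 1 \<Longrightarrow>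
    (\<integral>\<^sup>+r. ennreal (min (1 / tail \<omega> r) (1 / tail \<omega> \<rho>) * tail \<omega> r powr (- s)) \<partial>radial_measure \<omega>)
      \<le> ennreal (C2 * tail \<omega> \<rho> powr (- s))"
    using schur_radial[OF s] by blast
  have "(\<integral>\<^sup>+z. ennreal (norm (kernel_series (a * z)) * tail \<omega> (norm z) powr (- s) * \<omega> (norm z)) \<partial>disc_area)
      \<le> ennreal (2 * C1 * C2 * tail \<omega> (norm a) powr (- s))" if a: "norm a < 1" for a
  proof -
    let ?\<phi> = "\<lambda>r. ennreal (tail \<omega> r powr (- s)) * ennreal (\<omega> r)"
    let ?\<psi> = "\<lambda>r. ennreal (C1 * (min (1 / tail \<omega> r) (1 / tail \<omega> (norm a)) * tail \<omega> r powr (- s)))"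
    have m: "(\<lambda>z. ?\<phi> (norm z)) \<in> borel_measurable disc_area" by measurable
    have "(\<integral>\<^sup>+z. ennreal (norm (kernel_series (a * z)) * tail \<omega> (norm z) powr (- s) * \<omega> (norm z)) \<partial>disc_area)
      = (\<integral>\<^sup>+z. ennreal (norm (kernel_series (a * z))) * ?\<phi> (norm z) \<partial>disc_area)"
      by (intro nn_integral_cong) (auto simp: ennreal_mult disc_profile_nonneg mult.assoc)
    also have "\<dots> = (\<integral>\<^sup>+z. circle_mean kernel_series (a * z) * ?\<phi> (norm z) \<partial>disc_area)"
      by (rule nn_integral_disc_circle_mean[OF _ m]) measurable
    also have "\<dots> \<le> (\<integral>\<^sup>+z. ?\<psi> (norm z) * ennreal (\<omega> (norm z)) \<partial>disc_area)"
    proof (rule nn_integral_mono)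
      fix z assume "z \<in> space disc_area"
      then have z: "norm z < 1" by simp
      have az: "norm (a * z) \<le> norm a" "norm (a * z) \<le> norm z"
        using a z by (auto simp: norm_mult mult_left_le mult_left_le_one_le)
      have T: "0 < tail \<omega> (norm z)" "0 < tail \<omega> (norm a)" using a z by (auto intro: tail_pos)
      have T': "tail \<omega> (norm z) \<le> tail \<omega> (norm (a * z))" "tail \<omega> (norm a) \<le> tail \<omega> (norm (a * z))"
        using az by (auto intro: tail_antimono)
      have "C1 / tail \<omega> (norm (a * z)) = C1 * (1 / tail \<omega> (norm (a * z)))" by simp
      also have "\<dots> \<le> C1 * min (1 / tail \<omega> (norm z)) (1 / tail \<omega> (norm a))"
        using T T' C1 by (intro mult_left_mono min.boundedI divide_left_mono mult_pos_pos) auto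
      finally have "circle_mean kernel_series (a * z) \<le> ennreal (C1 * min (1 / tail \<omega> (norm z)) (1 / tail \<omega> (norm a)))"
        using C1(2)[of "a * z"] az a by (meson ennreal_leI le_less_trans order_trans)
      then have "circle_mean kernel_series (a * z) * ?\<phi> (norm z) \<le> ennreal (C1 * min (1 / tail \<omega> (norm z)) (1 / tail \<omega> (norm a))) * ?\<phi> (norm z)"
        by (rule mult_right_mono) simp
      also have "\<dots> = ?\<psi> (norm z) * ennreal (\<omega> (norm z))"
        using C1 T by (simp add: ennreal_mult[symmetric] mult.assoc[symmetric])
      finally show "circle_mean kernel_series (a * z) * ?\<phi> (norm z) \<le> ?\<psi> (norm z) * ennreal (\<omega> (norm z))" .
    qed
    also have "\<dots> \<le> 2 * (\<integral>\<^sup>+r. ?\<psi> r \<partial>radial_measure \<omega>)"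
      by (rule nn_integral_disc_weight_le) measurable
    also have "(\<integral>\<^sup>+r. ?\<psi> r \<partial>radial_measure \<omega>) = ennreal C1 * (\<integral>\<^sup>+r. ennreal (min (1 / tail \<omega> r) (1 / tail \<omega> (norm a)) * tail \<omega> r powr (- s)) \<partial>radial_measure \<omega>)"
      using C1 by (subst nn_integral_cmult[symmetric]) (auto simp: ennreal_mult')
    also have "\<dots> \<le> ennreal C1 * ennreal (C2 * tail \<omega> (norm a) powr (- s))"
      by (intro mult_left_mono C2 a) simp
    also have "2 * \<dots> = ennreal (2 * (C1 * (C2 * tail \<omega> (norm a) powr (- s))))"
      using C1 C2 by (simp add: ennreal_mult)
    finally show ?thesis by (simp add: mult.assoc mult_left_mono)
  qed
  then show ?thesis using that[of "2 * C1 * C2"] C1 C2 by simp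
qed

text \<open>For fixed z this bound is uniform in \<zeta>, which makes pairings with the kernel
  integrable.\<close>

lemma norm_kernel_series_le:
  assumes "norm z < 1" "norm \<zeta> \<le> 1"
  shows "norm (kernel_series (z * \<zeta>)) \<le> (\<Sum>m. kernel_coeff m * norm z ^ m)"
proof -
  have s: "summable (\<lambda>m. norm (of_real (kernel_coeff m) * z ^ m :: complex))"
    using disc_coeffsD[OF disc_coeffs_kernel assms(1)] .
  have le: "norm (of_real (kernel_coeff m) * (z * \<zeta>) ^ m :: complex) \<le> norm (of_real (kernel_coeff m) * z ^ m :: complex)" for m
    using assms(2) by (simp add: norm_mult norm_power power_mult_distrib mult_left_le power_le_one mult_left_mono)
  have s': "summable (\<lambda>m. norm (of_real (kernel_coeff m) * (z * \<zeta>) ^ m :: complex))"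
    by (rule summable_comparison_test'[OF s, of 0]) (use le in auto)
  have "norm (kernel_series (z * \<zeta>)) \<le> (\<Sum>m. norm (of_real (kernel_coeff m) * (z * \<zeta>) ^ m :: complex))"
    unfolding psum_def by (rule summable_norm[OF s'])
  also have "\<dots> \<le> (\<Sum>m. norm (of_real (kernel_coeff m) * z ^ m :: complex))"
    by (rule suminf_le[OF le s' s])
  also have "\<dots> = (\<Sum>m. kernel_coeff m * norm z ^ m)"
    using kernel_coeff_pos by (simp add: norm_mult norm_power less_imp_le)
  finally show ?thesis .
qed

text \<open>The coefficients are real, so exchanging the variables conjugates the kernel. This lets
  \<open>schur_kernel_disc\<close> serve for either variable.\<close>

lemma norm_kernel_series_cnj: "norm z < 1 \<Longrightarrow> norm \<zeta> < 1 \<Longrightarrow> norm (kernel_series (cnj z * \<zeta>)) = norm (kernel_series (cnj \<zeta> * z))"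
proof -
  assume "norm z < 1" "norm \<zeta> < 1"
  then have n: "norm (cnj z * \<zeta>) < 1"
    using mult_strict_mono'[of "norm z" 1 "norm \<zeta>" 1] by (simp add: norm_mult)
  have "(\<lambda>m. cnj (of_real (kernel_coeff m) * (cnj z * \<zeta>) ^ m)) sums cnj (kernel_series (cnj z * \<zeta>))"
    unfolding sums_cnj by (rule disc_coeffs_sums[OF disc_coeffs_kernel n])
  then have "kernel_series (cnj \<zeta> * z) = cnj (kernel_series (cnj z * \<zeta>))"
    by (simp add: psum_def sums_iff mult.commute)
  then show ?thesis by simp
qed

text \<open>Schur test: |g| is split as |g| tail^(1/(p q)) times tail^(-1/(p q)) and Hoelder is
  applied against kernel times weight. The second factor leads to the Schur integral with exponent
  1/p, the first one, after Tonelli, to that with exponent 1/q. The bound on g makes the integrals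
  at each z finite and does not enter the constant.\<close>

lemma positive_projection_bound:
  assumes p: "1 < p"
  obtains C where "0 < C" "\<And>g B. g \<in> borel_measurable disc_area \<Longrightarrow> (\<And>z. norm z < 1 \<Longrightarrow> norm (g z) \<le> B) \<Longrightarrow>
    (\<integral>\<^sup>+z. ennreal ((\<integral>\<zeta>. norm (kernel_series (cnj z * \<zeta>)) * norm (g \<zeta>) * \<omega> (norm \<zeta>) \<partial>disc_area) powr p * \<omega> (norm z)) \<partial>disc_area)
      \<le> ennreal C * lp_integral p g"
proof -
  define q where "q = p / (p - 1)"
  have q: "1 < q" "1 / p + 1 / q = 1" using p by (auto simp: q_def field_simps)
  have pq: "p / q = p - 1" using p by (simp add: q_def)
  have sp: "0 < 1 / p" "1 / p < 1" and sq: "0 < 1 / q" "1 / q < 1" using p q(1) by auto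
  obtain C1 where C1: "0 < C1" "\<And>a. norm a < 1 \<Longrightarrow>
    (\<integral>\<^sup>+z. ennreal (norm (kernel_series (a * z)) * tail \<omega> (norm z) powr (- (1 / p)) * \<omega> (norm z)) \<partial>disc_area)
      \<le> ennreal (C1 * tail \<omega> (norm a) powr (- (1 / p)))"
    using schur_kernel_disc[OF sp] by blast
  obtain C2 where C2: "0 < C2" "\<And>a. norm a < 1 \<Longrightarrow>
    (\<integral>\<^sup>+z. ennreal (norm (kernel_series (a * z)) * tail \<omega> (norm z) powr (- (1 / q)) * \<omega> (norm z)) \<partial>disc_area)
      \<le> ennreal (C2 * tail \<omega> (norm a) powr (- (1 / q)))"
    using schur_kernel_disc[OF sq] by blast
  interpret D: sigma_finite_measure disc_area by (rule sigma_finite_disc_area)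
  interpret DD: pair_sigma_finite disc_area disc_area ..
  have "(\<integral>\<^sup>+z. ennreal ((\<integral>\<zeta>. norm (kernel_series (cnj z * \<zeta>)) * norm (g \<zeta>) * \<omega> (norm \<zeta>) \<partial>disc_area) powr p * \<omega> (norm z)) \<partial>disc_area)
      \<le> ennreal (C1 powr (p - 1) * C2) * lp_integral p g"
    if g[measurable]: "g \<in> borel_measurable disc_area" and B: "\<And>z. norm z < 1 \<Longrightarrow> norm (g z) \<le> B" for g B
  proof -
    let ?k = "\<lambda>z \<zeta>. norm (kernel_series (cnj z * \<zeta>))"
    let ?T = "\<lambda>z. tail \<omega> (norm z)"
    let ?J = "\<lambda>z. \<integral>\<^sup>+\<zeta>. ennreal (norm (g \<zeta>) powr p * ?T \<zeta> powr (1 / q) * ?k z \<zeta> * \<omega> (norm \<zeta>)) \<partial>disc_area"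
    have B0: "0 \<le> B" using B[of 0] order_trans[OF norm_ge_zero[of "g 0"]] by simp
    have pt: "ennreal ((\<integral>\<zeta>. ?k z \<zeta> * norm (g \<zeta>) * \<omega> (norm \<zeta>) \<partial>disc_area) powr p * \<omega> (norm z))
      \<le> ennreal (C1 powr (p - 1)) * (ennreal (?T z powr (- (1 / q)) * \<omega> (norm z)) * ?J z)" if z: "norm z < 1" for z
    proof -
      define S where "S = (\<Sum>m. kernel_coeff m * norm z ^ m)"
      have kS: "?k z \<zeta> \<le> S" if "norm \<zeta> < 1" for \<zeta>
        unfolding S_def using norm_kernel_series_le[of "cnj z" \<zeta>] z that by simp
      have Tz: "0 < ?T z" by (rule tail_pos) fact
      have TT: "0 < ?T \<zeta>" "?T \<zeta> \<le> tail \<omega> 0" if "norm \<zeta> < 1" for \<zeta> :: complex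
        using that by (auto intro: tail_pos tail_antimono)
      have ia: "integrable disc_area (\<lambda>\<zeta>. (norm (g \<zeta>) * ?T \<zeta> powr (1 / (p * q))) powr p * (?k z \<zeta> * \<omega> (norm \<zeta>)))"
      proof -
        have "integrable disc_area (\<lambda>\<zeta>. ((norm (g \<zeta>) * ?T \<zeta> powr (1 / (p * q))) powr p * ?k z \<zeta>) * \<omega> (norm \<zeta>))"
        proof (rule integrable_disc_weight_bounded[where B="(B * tail \<omega> 0 powr (1 / (p * q))) powr p * S"])
          fix \<zeta> :: complex assume \<zeta>: "norm \<zeta> < 1"
          have "norm (g \<zeta>) * ?T \<zeta> powr (1 / (p * q)) \<le> B * tail \<omega> 0 powr (1 / (p * q))"
            using B[OF \<zeta>] TT[OF \<zeta>] p q B0 by (intro mult_mono powr_mono2) auto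
          then have "(norm (g \<zeta>) * ?T \<zeta> powr (1 / (p * q))) powr p \<le> (B * tail \<omega> 0 powr (1 / (p * q))) powr p"
            using p by (intro powr_mono2) auto
          then show "\<bar>(norm (g \<zeta>) * ?T \<zeta> powr (1 / (p * q))) powr p * ?k z \<zeta>\<bar> \<le> (B * tail \<omega> 0 powr (1 / (p * q))) powr p * S"
            using kS[OF \<zeta>] by (auto simp: abs_mult intro!: mult_mono)
        qed measurable
        then show ?thesis by (simp add: mult.assoc)
      qed
      have nb: "(\<integral>\<^sup>+\<zeta>. ennreal ((?T \<zeta> powr (- (1 / (p * q)))) powr q * (?k z \<zeta> * \<omega> (norm \<zeta>))) \<partial>disc_area) \<le> ennreal (C1 * ?T z powr (- (1 / p)))"
      proof -
        have eq: "(?T \<zeta> powr (- (1 / (p * q)))) powr q * (?k z \<zeta> * \<omega> (norm \<zeta>)) = ?k z \<zeta> * ?T \<zeta> powr (- (1 / p)) * \<omega> (norm \<zeta>)" for \<zeta>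
          using p q by (simp add: powr_powr)
        show ?thesis unfolding eq using C1(2)[of "cnj z"] z by (simp only: complex_mod_cnj)
      qed
      have ib: "integrable disc_area (\<lambda>\<zeta>. (?T \<zeta> powr (- (1 / (p * q)))) powr q * (?k z \<zeta> * \<omega> (norm \<zeta>)))"
      proof (rule integrableI_nonneg)
        show "(\<integral>\<^sup>+\<zeta>. ennreal ((?T \<zeta> powr (- (1 / (p * q)))) powr q * (?k z \<zeta> * \<omega> (norm \<zeta>))) \<partial>disc_area) < \<infinity>"
          using nb by (rule order.strict_trans1) simp
      qed (auto simp: disc_profile_nonneg)
      define X where "X = (\<integral>\<zeta>. (norm (g \<zeta>) * ?T \<zeta> powr (1 / (p * q))) powr p * (?k z \<zeta> * \<omega> (norm \<zeta>)) \<partial>disc_area)"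
      define Y where "Y = (\<integral>\<zeta>. (?T \<zeta> powr (- (1 / (p * q)))) powr q * (?k z \<zeta> * \<omega> (norm \<zeta>)) \<partial>disc_area)"
      have X0: "0 \<le> X" unfolding X_def by (intro integral_nonneg_AE AE_I2) (auto simp: disc_profile_nonneg)
      have Y0: "0 \<le> Y" unfolding Y_def by (intro integral_nonneg_AE AE_I2) (auto simp: disc_profile_nonneg)
      have Yle: "Y \<le> C1 * ?T z powr (- (1 / p))"
      proof -
        have "ennreal Y = (\<integral>\<^sup>+\<zeta>. ennreal ((?T \<zeta> powr (- (1 / (p * q)))) powr q * (?k z \<zeta> * \<omega> (norm \<zeta>))) \<partial>disc_area)"
          unfolding Y_def by (rule nn_integral_eq_integral[symmetric, OF ib]) (auto simp: disc_profile_nonneg)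
        then have "ennreal Y \<le> ennreal (C1 * ?T z powr (- (1 / p)))" using nb by (simp only:)
        then show ?thesis using C1(1) by (simp add: ennreal_le_iff)
      qed
      have "(\<integral>\<zeta>. ?k z \<zeta> * norm (g \<zeta>) * \<omega> (norm \<zeta>) \<partial>disc_area)
        = (\<integral>\<zeta>. (norm (g \<zeta>) * ?T \<zeta> powr (1 / (p * q))) * ?T \<zeta> powr (- (1 / (p * q))) * (?k z \<zeta> * \<omega> (norm \<zeta>)) \<partial>disc_area)"
      proof (rule Bochner_Integration.integral_cong)
        fix \<zeta> assume "\<zeta> \<in> space disc_area"
        then have "0 < ?T \<zeta>" using TT by simp
        then have "?T \<zeta> powr (1 / (p * q)) * ?T \<zeta> powr (- (1 / (p * q))) = 1" by (simp add: powr_add[symmetric])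
        then show "?k z \<zeta> * norm (g \<zeta>) * \<omega> (norm \<zeta>) = (norm (g \<zeta>) * ?T \<zeta> powr (1 / (p * q))) * ?T \<zeta> powr (- (1 / (p * q))) * (?k z \<zeta> * \<omega> (norm \<zeta>))"
          by (simp add: mult.assoc mult.commute)
      qed simp
      also have "\<dots> \<le> X powr (1 / p) * Y powr (1 / q)"
        unfolding X_def Y_def
        by (rule Holder_weighted(2)[OF p q]) (use ia ib in \<open>auto simp: disc_profile_nonneg\<close>)
      finally have Q: "(\<integral>\<zeta>. ?k z \<zeta> * norm (g \<zeta>) * \<omega> (norm \<zeta>) \<partial>disc_area) \<le> X powr (1 / p) * Y powr (1 / q)" .
      have "(\<integral>\<zeta>. ?k z \<zeta> * norm (g \<zeta>) * \<omega> (norm \<zeta>) \<partial>disc_area) powr p \<le> (X powr (1 / p) * Y powr (1 / q)) powr p"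
        using Q p by (intro powr_mono2 integral_nonneg_AE AE_I2) (auto simp: disc_profile_nonneg)
      also have "\<dots> = X * Y powr (p - 1)"
        using p q X0 pq by (simp add: powr_mult powr_powr)
      also have "\<dots> \<le> X * (C1 * ?T z powr (- (1 / p))) powr (p - 1)"
        using Yle Y0 X0 p by (intro mult_left_mono powr_mono2) auto
      \<comment> \<open>The exponent (p - 1)/p is 1/q, so the weight left over in z is the one
        needed for the second Schur integral.\<close>
      also have "(C1 * ?T z powr (- (1 / p))) powr (p - 1) = C1 powr (p - 1) * ?T z powr (- (1 / q))"
      proof -
        have "- (1 / p) * (p - 1) = - (1 / q)" using p by (simp add: q_def field_simps)
        then show ?thesis using C1 by (simp add: powr_mult powr_powr)
      qed
      finally have 1: "(\<integral>\<zeta>. ?k z \<zeta> * norm (g \<zeta>) * \<omega> (norm \<zeta>) \<partial>disc_area) powr p * \<omega> (norm z)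
         \<le> (X * (C1 powr (p - 1) * ?T z powr (- (1 / q)))) * \<omega> (norm z)"
        using disc_profile_nonneg[OF z] by (intro mult_right_mono)
      have "ennreal X = (\<integral>\<^sup>+\<zeta>. ennreal ((norm (g \<zeta>) * ?T \<zeta> powr (1 / (p * q))) powr p * (?k z \<zeta> * \<omega> (norm \<zeta>))) \<partial>disc_area)"
        unfolding X_def by (rule nn_integral_eq_integral[symmetric, OF ia]) (auto simp: disc_profile_nonneg)
      also have "\<dots> = ?J z"
        using p q by (intro nn_integral_cong) (simp add: powr_mult powr_powr mult.assoc)
      finally have XJ: "ennreal X = ?J z" .
      have eqX: "ennreal ((X * (C1 powr (p - 1) * ?T z powr (- (1 / q)))) * \<omega> (norm z)) =
        ennreal (C1 powr (p - 1)) * (ennreal (?T z powr (- (1 / q)) * \<omega> (norm z)) * ennreal X)"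
        using X0 disc_profile_nonneg[OF z] by (simp add: ennreal_mult[symmetric] mult_ac)
      show ?thesis using ennreal_leI[OF 1] unfolding eqX XJ .
    qed
    have [measurable]: "(\<lambda>x. fst x) \<in> borel_measurable (disc_area \<Otimes>\<^sub>M disc_area)"
        "(\<lambda>x. snd x) \<in> borel_measurable (disc_area \<Otimes>\<^sub>M disc_area)"
        "(\<lambda>x. g (snd x)) \<in> borel_measurable (disc_area \<Otimes>\<^sub>M disc_area)"
        "(\<lambda>x. \<omega> (norm (snd x))) \<in> borel_measurable (disc_area \<Otimes>\<^sub>M disc_area)"
        "(\<lambda>x. \<omega> (norm (fst x))) \<in> borel_measurable (disc_area \<Otimes>\<^sub>M disc_area)"
      by (rule measurable_compose[OF measurable_fst measurable_disc_area_ident]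
          measurable_compose[OF measurable_snd measurable_disc_area_ident]
          measurable_compose[OF measurable_snd g]
          measurable_compose[OF measurable_snd measurable_disc_profile]
          measurable_compose[OF measurable_fst measurable_disc_profile])+
    let ?H = "\<lambda>x. ennreal (norm (g (snd x)) powr p * ?T (snd x) powr (1 / q) * ?k (fst x) (snd x) * \<omega> (norm (snd x)))"
    have H[measurable]: "?H \<in> borel_measurable (disc_area \<Otimes>\<^sub>M disc_area)" by measurable
    have J[measurable]: "?J \<in> borel_measurable disc_area"
      by (rule D.borel_measurable_nn_integral) (use H in \<open>simp add: case_prod_unfold\<close>)
    let ?W = "\<lambda>x. ennreal (?T (fst x) powr (- (1 / q)) * \<omega> (norm (fst x))) * ?H x"
    have W[measurable]: "?W \<in> borel_measurable (disc_area \<Otimes>\<^sub>M disc_area)" by measurable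
    have "(\<integral>\<^sup>+z. ennreal ((\<integral>\<zeta>. ?k z \<zeta> * norm (g \<zeta>) * \<omega> (norm \<zeta>) \<partial>disc_area) powr p * \<omega> (norm z)) \<partial>disc_area)
       \<le> (\<integral>\<^sup>+z. ennreal (C1 powr (p - 1)) * (ennreal (?T z powr (- (1 / q)) * \<omega> (norm z)) * ?J z) \<partial>disc_area)"
      by (intro nn_integral_mono pt) auto
    also have "\<dots> = ennreal (C1 powr (p - 1)) * (\<integral>\<^sup>+z. ennreal (?T z powr (- (1 / q)) * \<omega> (norm z)) * ?J z \<partial>disc_area)"
      by (rule nn_integral_cmult) measurable
    also have "(\<integral>\<^sup>+z. ennreal (?T z powr (- (1 / q)) * \<omega> (norm z)) * ?J z \<partial>disc_area)
       = (\<integral>\<^sup>+z. (\<integral>\<^sup>+\<zeta>. ?W (z, \<zeta>) \<partial>disc_area) \<partial>disc_area)"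
      unfolding fst_conv snd_conv by (intro nn_integral_cong nn_integral_cmult[symmetric]) measurable
    \<comment> \<open>After Tonelli the inner integral runs over z. It contributes the tail at
      \<zeta> to the power -1/q, which cancels the factor carried by g.\<close>
    also have "\<dots> = (\<integral>\<^sup>+\<zeta>. (\<integral>\<^sup>+z. ?W (z, \<zeta>) \<partial>disc_area) \<partial>disc_area)"
      by (rule DD.Fubini'[symmetric]) (use W in \<open>simp add: case_prod_unfold\<close>)
    also have "\<dots> \<le> (\<integral>\<^sup>+\<zeta>. ennreal C2 * ennreal (norm (g \<zeta>) powr p * \<omega> (norm \<zeta>)) \<partial>disc_area)"
    proof (rule nn_integral_mono)
      fix \<zeta> assume "\<zeta> \<in> space disc_area"
      then have \<zeta>: "norm \<zeta> < 1" by simp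
      have T: "0 < ?T \<zeta>" by (rule tail_pos) fact
      let ?c = "norm (g \<zeta>) powr p * ?T \<zeta> powr (1 / q) * \<omega> (norm \<zeta>)"
      have c0: "0 \<le> ?c" using disc_profile_nonneg[OF \<zeta>] by simp
      have "(\<integral>\<^sup>+z. ?W (z, \<zeta>) \<partial>disc_area)
        = (\<integral>\<^sup>+z. ennreal ?c * ennreal (norm (kernel_series (cnj \<zeta> * z)) * ?T z powr (- (1 / q)) * \<omega> (norm z)) \<partial>disc_area)"
      proof (rule nn_integral_cong)
        fix z assume "z \<in> space disc_area"
        then have z: "norm z < 1" by simp
        show "?W (z, \<zeta>) = ennreal ?c * ennreal (norm (kernel_series (cnj \<zeta> * z)) * ?T z powr (- (1 / q)) * \<omega> (norm z))"
          using disc_profile_nonneg[OF z] disc_profile_nonneg[OF \<zeta>] norm_kernel_series_cnj[OF z \<zeta>]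
          by (simp add: ennreal_mult[symmetric] mult_ac)
      qed
      also have "\<dots> = ennreal ?c * (\<integral>\<^sup>+z. ennreal (norm (kernel_series (cnj \<zeta> * z)) * ?T z powr (- (1 / q)) * \<omega> (norm z)) \<partial>disc_area)"
        by (rule nn_integral_cmult) measurable
      also have "\<dots> \<le> ennreal ?c * ennreal (C2 * ?T \<zeta> powr (- (1 / q)))"
        using C2(2)[of "cnj \<zeta>"] \<zeta> by (intro mult_left_mono) auto
      also have "\<dots> = ennreal (?c * (C2 * ?T \<zeta> powr (- (1 / q))))"
        using C2 c0 by (intro ennreal_mult[symmetric]) auto
      also have "?c * (C2 * ?T \<zeta> powr (- (1 / q))) = C2 * (norm (g \<zeta>) powr p * \<omega> (norm \<zeta>))"
      proof -
        have "?T \<zeta> powr (1 / q) * ?T \<zeta> powr (- (1 / q)) = 1" using T by (simp add: powr_add[symmetric])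
        then show ?thesis by (simp add: algebra_simps)
      qed
      finally show "(\<integral>\<^sup>+z. ?W (z, \<zeta>) \<partial>disc_area) \<le> ennreal C2 * ennreal (norm (g \<zeta>) powr p * \<omega> (norm \<zeta>))"
        using C2 disc_profile_nonneg[OF \<zeta>] by (simp add: ennreal_mult)
    qed
    also have "\<dots> = ennreal C2 * lp_integral p g"
      by (rule nn_integral_cmult) measurable
    finally show ?thesis
      using C2 by (simp add: ennreal_mult mult.assoc mult_left_mono)
  qed
  moreover have "0 < C1 powr (p - 1) * C2" using C1(1) C2(1) by simp
  ultimately show ?thesis using that by blast
qed

end

section \<open>From the transform to the Hankel operator\<close>

lemma disc_coeffs_times_bounded:
  assumes x: "disc_coeffs x" and b: "\<And>m. norm (a m) \<le> E"
  shows "disc_coeffs (\<lambda>m. x m * a m)"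
proof (rule disc_coeffs_le)
  show "disc_coeffs (\<lambda>m. of_real E * x m)"
    unfolding disc_coeffs_def
    using disc_coeffsD[OF x, THEN summable_mult, of _ "norm E"] by (simp add: norm_mult mult_ac)
  show "norm (x m * a m) \<le> norm (of_real E * x m)" for m
  proof -
    have "norm (a m) \<le> \<bar>E\<bar>" using b[of m] by linarith
    then show ?thesis by (simp add: norm_mult mult.commute mult_right_mono)
  qed
qed

lemma cnj_psum_of_real:
  assumes c: "disc_coeffs (\<lambda>m. of_real (c m))" and w: "norm w < 1"
  shows "cnj (psum (\<lambda>m. of_real (c m)) w) = psum (\<lambda>m. of_real (c m)) (cnj w)"
proof -
  have "(\<lambda>m. cnj (of_real (c m) * w ^ m)) sums cnj (psum (\<lambda>m. of_real (c m)) w)"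
    unfolding sums_cnj by (rule disc_coeffs_sums[OF c w])
  then show ?thesis by (simp add: psum_def sums_iff)
qed

lemma norm_disc_mult_less: "norm a < 1 \<Longrightarrow> norm b < 1 \<Longrightarrow> norm (a * b :: complex) < 1"
  using mult_strict_mono'[of "norm a" 1 "norm b" 1] by (simp add: norm_mult)

lemma norm_antimoment_le:
  fixes D :: "complex \<Rightarrow> complex"
  assumes "integrable disc_area D"
  shows "norm (\<integral>z. D z * cnj z ^ m \<partial>disc_area) \<le> (\<integral>z. norm (D z) \<partial>disc_area)"
proof (rule order_trans[OF integral_norm_bound])
  have i: "integrable disc_area (\<lambda>z. D z * cnj z ^ m)"
    by (rule integrable_disc_times_bounded[OF assms, where B=1]) (auto simp: norm_power power_le_one)
  show "(\<integral>z. norm (D z * cnj z ^ m) \<partial>disc_area) \<le> (\<integral>z. norm (D z) \<partial>disc_area)"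
    by (intro integral_mono integrable_norm i assms) (auto simp: norm_mult norm_power mult_left_le power_le_one)
qed

text \<open>Turns a pairing with a kernel into a power series in z whose coefficients are kernel
  coefficients times antianalytic moments. It serves the transform, the conjugated Hankel operator
  and the squared test functions.\<close>

lemma integral_cnj_psum:
  fixes D :: "complex \<Rightarrow> complex"
  assumes D: "integrable disc_area D" and c: "disc_coeffs (\<lambda>m. of_real (c m))" and z: "norm z < 1"
  shows "(\<integral>\<zeta>. D \<zeta> * cnj (psum (\<lambda>m. of_real (c m)) (cnj z * \<zeta>)) \<partial>disc_area) =
     psum (\<lambda>m. of_real (c m) * (\<integral>\<zeta>. D \<zeta> * cnj \<zeta> ^ m \<partial>disc_area)) z"
proof -
  have s: "summable (\<lambda>m. norm (of_real (c m) * z ^ m :: complex))" using disc_coeffsD[OF c z] .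
  have "(\<lambda>m. (of_real (c m) * z ^ m) * (\<integral>\<zeta>. D \<zeta> * cnj \<zeta> ^ m \<partial>disc_area)) sums
     (\<integral>\<zeta>. D \<zeta> * (\<Sum>m. (of_real (c m) * z ^ m) * cnj \<zeta> ^ m) \<partial>disc_area)"
    by (rule sums_integral_mult_suminf[OF s D]) (auto simp: norm_power power_le_one)
  moreover have "(\<integral>\<zeta>. D \<zeta> * (\<Sum>m. (of_real (c m) * z ^ m) * cnj \<zeta> ^ m) \<partial>disc_area)
     = (\<integral>\<zeta>. D \<zeta> * cnj (psum (\<lambda>m. of_real (c m)) (cnj z * \<zeta>)) \<partial>disc_area)"
  proof (rule Bochner_Integration.integral_cong)
    fix \<zeta> assume "\<zeta> \<in> space disc_area"
    then have "norm (cnj z * \<zeta>) < 1" using z by (intro norm_disc_mult_less) auto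
    then have "cnj (psum (\<lambda>m. of_real (c m)) (cnj z * \<zeta>)) = (\<Sum>m. (of_real (c m) * z ^ m) * cnj \<zeta> ^ m)"
      by (simp add: cnj_psum_of_real[OF c]) (simp add: psum_def power_mult_distrib mult_ac)
    then show "D \<zeta> * (\<Sum>m. (of_real (c m) * z ^ m) * cnj \<zeta> ^ m) = D \<zeta> * cnj (psum (\<lambda>m. of_real (c m)) (cnj z * \<zeta>))"
      by simp
  qed simp
  ultimately show ?thesis by (simp add: psum_def sums_iff mult_ac)
qed

context weight
begin

text \<open>The logarithmic factor is at least ln e = 1.\<close>

lemma L1_log_integrable:
  assumes "f \<in> L1_log_space \<omega>"
  shows "integrable disc_area (\<lambda>z. f z * of_real (\<omega> (norm z)))"
proof (rule Bochner_Integration.integrable_bound)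
  have [measurable]: "f \<in> borel_measurable disc_area" using assms by (simp add: L1_log_space_def)
  show "integrable disc_area (\<lambda>z. norm (f z) * ln (exp 1 / (1 - norm z)) * \<omega> (norm z))"
    using assms by (simp add: L1_log_space_def)
  show "AE z in disc_area. norm (f z * of_real (\<omega> (norm z))) \<le> norm (norm (f z) * ln (exp 1 / (1 - norm z)) * \<omega> (norm z))"
  proof (rule AE_I2)
    fix z assume "z \<in> space disc_area"
    then have z: "norm z < 1" by simp
    have "ln (exp 1) \<le> ln (exp 1 / (1 - norm z))" using z by (subst ln_le_cancel_iff) (auto simp: field_simps)
    then have "1 \<le> ln (exp 1 / (1 - norm z))" by simp
    then have "norm (f z) * 1 * \<bar>\<omega> (norm z)\<bar> \<le> norm (f z) * \<bar>ln (exp 1 / (1 - norm z))\<bar> * \<bar>\<omega> (norm z)\<bar>"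
      by (intro mult_right_mono mult_left_mono) auto
    then show "norm (f z * of_real (\<omega> (norm z))) \<le> norm (norm (f z) * ln (exp 1 / (1 - norm z)) * \<omega> (norm z))"
      by (simp add: norm_mult abs_mult)
  qed
  show "(\<lambda>z. f z * of_real (\<omega> (norm z))) \<in> borel_measurable disc_area" by measurable
qed

lemma lp_integral_eq:
  assumes "integrable disc_area (\<lambda>z. norm (f z) powr p * \<omega> (norm z))"
  shows "lp_integral p f = ennreal (\<integral>z. norm (f z) powr p * \<omega> (norm z) \<partial>disc_area)"
  using assms by (intro nn_integral_eq_integral AE_I2) (auto simp: disc_profile_nonneg)

lemma Hinf_Lp:
  assumes g: "g \<in> Hinf_space" and p: "0 < p"
  shows "integrable disc_area (\<lambda>z. norm (g z) powr p * \<omega> (norm z))"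
proof -
  note [measurable] = Hinf_measurable[OF g]
  obtain B where B: "0 \<le> B" "\<And>z. norm z < 1 \<Longrightarrow> norm (g z) \<le> B" using Hinf_bounded[OF g] by blast
  show ?thesis
    by (rule integrable_disc_weight_bounded[where B="B powr p"]) (use B p in \<open>auto intro: powr_mono2\<close>)
qed

end

context upper_doubling_weight
begin

lemma bergman_kernel_eq: "bergman_kernel \<omega> z \<zeta> = kernel_series (cnj z * \<zeta>)"
  unfolding bergman_kernel_def psum_def weight_moment_eq
  by (intro suminf_cong) (simp add: kernel_coeff_def)

lemma kernel_reproduces_moment: "kernel_coeff k * (2 * moment (2 * k + 1)) = 1"
  unfolding kernel_coeff_def using moment_pos[of k] by simp

end

context doubling_weight
begin

text \<open>For fixed z the kernel is bounded and analytic in \<zeta>, so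
  \<open>integral_cnj_Hinf_eq_0\<close> can be applied to the integrand of the Hankel
  operator.\<close>

lemma Hinf_times_kernel:
  assumes g: "g \<in> Hinf_space" and z: "norm z < 1"
  shows "(\<lambda>\<zeta>. g \<zeta> * bergman_kernel \<omega> z \<zeta>) \<in> Hinf_space"
proof -
  obtain B where B: "0 \<le> B" "\<And>z. norm z < 1 \<Longrightarrow> norm (g z) \<le> B" using Hinf_bounded[OF g] by blast
  have "kernel_series \<circ> (\<lambda>\<zeta>. cnj z * \<zeta>) holomorphic_on ball 0 1"
  proof (rule holomorphic_on_compose_gen)
    show "kernel_series holomorphic_on ball 0 1" by (rule holomorphic_psum[OF disc_coeffs_kernel])
    show "(\<lambda>\<zeta>. cnj z * \<zeta>) ` ball 0 1 \<subseteq> ball 0 1" using z norm_disc_mult_less[of "cnj z"] by auto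
  qed (auto intro!: holomorphic_intros)
  then have hol: "(\<lambda>\<zeta>. g \<zeta> * bergman_kernel \<omega> z \<zeta>) holomorphic_on ball 0 1"
    unfolding bergman_kernel_eq using g by (auto simp: o_def Hinf_space_def intro!: holomorphic_on_mult)
  have "norm (g \<zeta> * bergman_kernel \<omega> z \<zeta>) \<le> B * (\<Sum>m. kernel_coeff m * norm (cnj z) ^ m)" if "\<zeta> \<in> ball 0 1" for \<zeta>
    unfolding bergman_kernel_eq norm_mult
    using B that z norm_kernel_series_le[of "cnj z" \<zeta>] by (intro mult_mono) auto
  then have "bounded ((\<lambda>\<zeta>. g \<zeta> * bergman_kernel \<omega> z \<zeta>) ` ball 0 1)"
    unfolding bounded_iff by blast
  then show ?thesis using hol by (simp add: Hinf_space_def)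
qed

lemma cnj_little_hankel:
  "cnj (little_hankel \<omega> (\<lambda>z. cnj (f z)) g z) =
     (\<integral>\<zeta>. f \<zeta> * of_real (\<omega> (norm \<zeta>)) * cnj (g \<zeta> * bergman_kernel \<omega> z \<zeta>) \<partial>disc_area)"
proof -
  have "cnj (little_hankel \<omega> (\<lambda>z. cnj (f z)) g z) =
     (\<integral>\<zeta>. cnj (cnj (f \<zeta>) * g \<zeta> * bergman_kernel \<omega> z \<zeta> * of_real (\<omega> (norm \<zeta>))) \<partial>disc_area)"
    unfolding little_hankel_def by (rule Bochner_Integration.integral_cnj[symmetric])
  then show ?thesis by (simp add: mult_ac del: Bochner_Integration.integral_cnj)
qed

lemma cnj_little_hankel_series:
  assumes f: "integrable disc_area (\<lambda>z. f z * of_real (\<omega> (norm z)))" and g: "g \<in> Hinf_space"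
  defines "x \<equiv> \<lambda>m. of_real (kernel_coeff m) * (\<integral>\<zeta>. f \<zeta> * of_real (\<omega> (norm \<zeta>)) * cnj (g \<zeta>) * cnj \<zeta> ^ m \<partial>disc_area)"
  shows "disc_coeffs x"
    and "norm z < 1 \<Longrightarrow> cnj (little_hankel \<omega> (\<lambda>z. cnj (f z)) g z) = psum x z"
proof -
  obtain B where B: "0 \<le> B" "\<And>z. norm z < 1 \<Longrightarrow> norm (g z) \<le> B" using Hinf_bounded[OF g] by blast
  note [measurable] = Hinf_measurable[OF g]
  have D: "integrable disc_area (\<lambda>\<zeta>. f \<zeta> * of_real (\<omega> (norm \<zeta>)) * cnj (g \<zeta>))"
    by (rule integrable_disc_times_bounded[OF f, where B=B]) (use B in auto)
  show "disc_coeffs x" unfolding x_def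
    by (rule disc_coeffs_times_bounded[OF disc_coeffs_kernel norm_antimoment_le[OF D]])
  assume z: "norm z < 1"
  show "cnj (little_hankel \<omega> (\<lambda>z. cnj (f z)) g z) = psum x z"
    unfolding cnj_little_hankel x_def
    using integral_cnj_psum[OF D disc_coeffs_kernel z] by (simp add: bergman_kernel_eq mult.assoc)
qed

text \<open>The series combines kernel coefficients of \<omega> (1 - r)^n with moments of f taken
  against \<omega>. The outer factor (1 - |z|)^n compensates for this mismatch in
  \<open>V_op_antimoments\<close>.\<close>

lemma V_op_eq:
  assumes N: "upper_doubling_weight (\<lambda>r. \<omega> r * (1 - r) ^ n) b"
    and f: "integrable disc_area (\<lambda>z. f z * of_real (\<omega> (norm z)))"
  defines "y \<equiv> \<lambda>m. of_real (upper_doubling_weight.kernel_coeff (\<lambda>r. \<omega> r * (1 - r) ^ n) m) *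
      (\<integral>\<zeta>. f \<zeta> * of_real (\<omega> (norm \<zeta>)) * cnj \<zeta> ^ m \<partial>disc_area)"
  shows "disc_coeffs y"
    and "norm z < 1 \<Longrightarrow> V_op \<omega> (\<lambda>r. (1 - r) ^ n) f z = of_real ((1 - norm z) ^ n) * psum y z"
    and "V_op \<omega> (\<lambda>r. (1 - r) ^ n) f \<in> borel_measurable disc_area"
proof -
  interpret N: upper_doubling_weight "\<lambda>r. \<omega> r * (1 - r) ^ n" b by (rule N)
  show y: "disc_coeffs y" unfolding y_def
    by (rule disc_coeffs_times_bounded[OF N.disc_coeffs_kernel norm_antimoment_le[OF f]])
  show eq: "V_op \<omega> (\<lambda>r. (1 - r) ^ n) f z = of_real ((1 - norm z) ^ n) * psum y z" if z: "norm z < 1" for z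
  proof -
    have "(\<integral>\<zeta>. f \<zeta> * cnj (bergman_kernel (\<lambda>r. \<omega> r * (1 - r) ^ n) z \<zeta>) * of_real (\<omega> (norm \<zeta>)) \<partial>disc_area) = psum y z"
      unfolding y_def integral_cnj_psum[OF f N.disc_coeffs_kernel z, symmetric] N.bergman_kernel_eq
      by (simp add: mult_ac)
    then show ?thesis by (simp add: V_op_def)
  qed
  have "(\<lambda>z. of_real ((1 - norm z) ^ n) * psum y z) \<in> borel_measurable disc_area" by measurable
  then show "V_op \<omega> (\<lambda>r. (1 - r) ^ n) f \<in> borel_measurable disc_area"
    by (rule measurable_cong[THEN iffD1, rotated]) (simp add: eq)
qed

text \<open>Hence \<open>f\<close> and its transform induce the same little Hankel operator.\<close>

lemma V_op_antimoments:
  assumes N: "upper_doubling_weight (\<lambda>r. \<omega> r * (1 - r) ^ n) b"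
    and f: "integrable disc_area (\<lambda>z. f z * of_real (\<omega> (norm z)))"
    and V: "integrable disc_area (\<lambda>z. V_op \<omega> (\<lambda>r. (1 - r) ^ n) f z * of_real (\<omega> (norm z)))"
  shows "(\<integral>z. V_op \<omega> (\<lambda>r. (1 - r) ^ n) f z * of_real (\<omega> (norm z)) * cnj z ^ k \<partial>disc_area) =
    (\<integral>z. f z * of_real (\<omega> (norm z)) * cnj z ^ k \<partial>disc_area)"
proof -
  interpret N: upper_doubling_weight "\<lambda>r. \<omega> r * (1 - r) ^ n" b by (rule N)
  define a where "a m = (\<integral>\<zeta>. f \<zeta> * of_real (\<omega> (norm \<zeta>)) * cnj \<zeta> ^ m \<partial>disc_area)" for m
  define y where "y m = of_real (N.kernel_coeff m) * a m" for m
  have y: "disc_coeffs y" using V_op_eq(1)[OF N f] unfolding y_def[abs_def] a_def[abs_def] .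
  have eq: "V_op \<omega> (\<lambda>r. (1 - r) ^ n) f z = of_real ((1 - norm z) ^ n) * psum y z" if "norm z < 1" for z
    using V_op_eq(2)[OF N f that] unfolding y_def[abs_def] a_def[abs_def] .
  \<comment> \<open>The outer factor joins \<omega>, so the series is integrated against the very
    weight whose kernel coefficients it contains; these then cancel against the moments of that
    weight.\<close>
  have eq': "V_op \<omega> (\<lambda>r. (1 - r) ^ n) f z * of_real (\<omega> (norm z)) = psum y z * of_real (\<omega> (norm z) * (1 - norm z) ^ n)"
    if "norm z < 1" for z using eq[OF that] by simp
  have i1: "integrable disc_area (\<lambda>z. complex_of_real (\<omega> (norm z) * (1 - norm z) ^ n))"
    using N.integrable_disc_profile by (rule integrable_of_real)
  have i2: "integrable disc_area (\<lambda>z. psum y z * complex_of_real (\<omega> (norm z) * (1 - norm z) ^ n))"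
    using V by (rule Bochner_Integration.integrable_cong[THEN iffD1, rotated 2]) (auto simp: eq')
  have "(\<integral>z. V_op \<omega> (\<lambda>r. (1 - r) ^ n) f z * of_real (\<omega> (norm z)) * cnj z ^ k \<partial>disc_area)
    = (\<integral>z. psum y z * cnj z ^ k * of_real (\<omega> (norm z) * (1 - norm z) ^ n) \<partial>disc_area)"
  proof (rule Bochner_Integration.integral_cong)
    fix z assume "z \<in> space disc_area"
    then show "V_op \<omega> (\<lambda>r. (1 - r) ^ n) f z * of_real (\<omega> (norm z)) * cnj z ^ k
        = psum y z * cnj z ^ k * of_real (\<omega> (norm z) * (1 - norm z) ^ n)"
      by (subst eq') (auto simp: mult_ac)
  qed simp
  also have "\<dots> = y k * (\<integral>z. of_real (norm z ^ (2 * k) * (\<omega> (norm z) * (1 - norm z) ^ n)) \<partial>disc_area)"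
    by (rule integral_psum_monomial[OF y i1 i2])
  also have "\<dots> = y k * of_real (2 * N.moment (2 * k + 1))"
    using N.disc_moment(2)[of k] by (simp only: integral_complex_of_real)
  also have "\<dots> = of_real (N.kernel_coeff k * (2 * N.moment (2 * k + 1))) * a k"
    by (simp add: y_def)
  finally show ?thesis unfolding N.kernel_reproduces_moment by (simp add: a_def)
qed

lemma measurable_kernel_integral:
  assumes g: "g \<in> borel_measurable disc_area"
  shows "(\<lambda>z. \<integral>\<zeta>. norm (kernel_series (cnj z * \<zeta>)) * norm (g \<zeta> :: complex) * \<omega> (norm \<zeta>) \<partial>disc_area) \<in> borel_measurable disc_area"
proof -
  interpret D: sigma_finite_measure disc_area by (rule sigma_finite_disc_area)
  have [measurable]: "(\<lambda>x. fst x) \<in> borel_measurable (disc_area \<Otimes>\<^sub>M disc_area)"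
      "(\<lambda>x. snd x) \<in> borel_measurable (disc_area \<Otimes>\<^sub>M disc_area)"
      "(\<lambda>x. g (snd x)) \<in> borel_measurable (disc_area \<Otimes>\<^sub>M disc_area)"
      "(\<lambda>x. \<omega> (norm (snd x))) \<in> borel_measurable (disc_area \<Otimes>\<^sub>M disc_area)"
    by (rule measurable_compose[OF measurable_fst measurable_disc_area_ident]
        measurable_compose[OF measurable_snd measurable_disc_area_ident]
        measurable_compose[OF measurable_snd g]
        measurable_compose[OF measurable_snd measurable_disc_profile])+
  have "(\<lambda>x. norm (kernel_series (cnj (fst x) * snd x)) * norm (g (snd x)) * \<omega> (norm (snd x)))
      \<in> borel_measurable (disc_area \<Otimes>\<^sub>M disc_area)" by measurable
  then show ?thesis
    by (intro D.borel_measurable_lebesgue_integral) (simp add: case_prod_unfold)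
qed

lemma little_hankel_bound_of_V_op:
  assumes p: "1 < p" and N: "upper_doubling_weight (\<lambda>r. \<omega> r * (1 - r) ^ n) b"
  obtains C where "0 < C" "\<And>f M. integrable disc_area (\<lambda>z. f z * of_real (\<omega> (norm z))) \<Longrightarrow> 0 \<le> M \<Longrightarrow>
    (AE z in disc_area. norm (V_op \<omega> (\<lambda>r. (1 - r) ^ n) f z) \<le> M) \<Longrightarrow>
    little_hankel_bound p \<omega> (\<lambda>z. cnj (f z)) (C * M)"
proof -
  obtain C where C: "0 < C" "\<And>g B. g \<in> borel_measurable disc_area \<Longrightarrow> (\<And>z. norm z < 1 \<Longrightarrow> norm (g z) \<le> B) \<Longrightarrow>
    (\<integral>\<^sup>+z. ennreal ((\<integral>\<zeta>. norm (kernel_series (cnj z * \<zeta>)) * norm (g \<zeta>) * \<omega> (norm \<zeta>) \<partial>disc_area) powr p * \<omega> (norm z)) \<partial>disc_area)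
      \<le> ennreal C * lp_integral p g"
    using positive_projection_bound[OF p] by blast
  have "little_hankel_bound p \<omega> (\<lambda>z. cnj (f z)) (C powr (1 / p) * M)"
    if f: "integrable disc_area (\<lambda>z. f z * of_real (\<omega> (norm z)))" and M: "0 \<le> M"
    and ae: "AE z in disc_area. norm (V_op \<omega> (\<lambda>r. (1 - r) ^ n) f z) \<le> M" for f M
  proof -
    define V where "V = V_op \<omega> (\<lambda>r. (1 - r) ^ n) f"
    have Vm[measurable]: "V \<in> borel_measurable disc_area" unfolding V_def by (rule V_op_eq(3)[OF N f])
    have V: "integrable disc_area (\<lambda>z. V z * of_real (\<omega> (norm z)))"
    proof (rule Bochner_Integration.integrable_bound)
      show "integrable disc_area (\<lambda>z. M * \<omega> (norm z))" using integrable_disc_profile by simp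
      show "AE z in disc_area. norm (V z * of_real (\<omega> (norm z))) \<le> norm (M * \<omega> (norm z))"
        using ae unfolding V_def[symmetric]
        by eventually_elim (use M in \<open>auto simp: norm_mult abs_mult intro!: mult_right_mono\<close>)
    qed measurable
    \<comment> \<open>All antianalytic moments of this difference vanish, so f and its transform
      agree in every pairing with a conjugated bounded analytic function.\<close>
    define D where "D z = f z * of_real (\<omega> (norm z)) - V z * of_real (\<omega> (norm z))" for z
    have D: "integrable disc_area D" unfolding D_def[abs_def] using f V by simp
    have Dk: "(\<integral>z. D z * cnj z ^ k \<partial>disc_area) = 0" for k
    proof -
      have i: "integrable disc_area (\<lambda>z. h z * cnj z ^ k)" if "integrable disc_area h" for h :: "complex \<Rightarrow> complex"
        by (rule integrable_disc_times_bounded[OF that, where B=1]) (auto simp: norm_power power_le_one)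
      show ?thesis
        unfolding D_def left_diff_distrib
        using i[OF f] i[OF V] V_op_antimoments[OF N f V[unfolded V_def], of k] unfolding V_def[symmetric]
        by simp
    qed
    show ?thesis
      unfolding little_hankel_bound_def
    proof (intro conjI ballI)
      show "0 \<le> C powr (1 / p) * M" using M by simp
      fix g assume g: "g \<in> Hinf_space"
      note gm[measurable] = Hinf_measurable[OF g]
      obtain B where B: "0 \<le> B" "\<And>z. norm z < 1 \<Longrightarrow> norm (g z) \<le> B" using Hinf_bounded[OF g] by blast
      define h where "h = little_hankel \<omega> (\<lambda>z. cnj (f z)) g"
      define x where "x m = of_real (kernel_coeff m) * (\<integral>\<zeta>. f \<zeta> * of_real (\<omega> (norm \<zeta>)) * cnj (g \<zeta>) * cnj \<zeta> ^ m \<partial>disc_area)" for m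
      have x: "disc_coeffs x" using cnj_little_hankel_series(1)[OF f g] unfolding x_def[abs_def] .
      have hx: "cnj (h z) = psum x z" if "norm z < 1" for z
        using cnj_little_hankel_series(2)[OF f g that] unfolding x_def[abs_def] h_def .
      have cm: "(\<lambda>z. cnj (h z)) \<in> borel_measurable disc_area"
        by (rule measurable_cong[THEN iffD2, of _ _ "psum x"]) (auto simp: hx)
      define Q where "Q z = (\<integral>\<zeta>. norm (kernel_series (cnj z * \<zeta>)) * norm (g \<zeta>) * \<omega> (norm \<zeta>) \<partial>disc_area)" for z
      have hQ: "norm (h z) \<le> M * Q z" if z: "norm z < 1" for z
      proof -
        \<comment> \<open>Everything in the integrand of the operator except symbol and weight;
          pairing \<open>D\<close> with it replaces f by the bounded function V.\<close>
        define G where "G \<zeta> = g \<zeta> * bergman_kernel \<omega> z \<zeta>" for \<zeta>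
        have G: "G \<in> Hinf_space" unfolding G_def[abs_def] by (rule Hinf_times_kernel[OF g z])
        note [measurable] = Hinf_measurable[OF G]
        obtain B' where B': "0 \<le> B'" "\<And>z. norm z < 1 \<Longrightarrow> norm (G z) \<le> B'" using Hinf_bounded[OF G] by blast
        have iG: "integrable disc_area (\<lambda>z. u z * cnj (G z))" if "integrable disc_area u" for u :: "complex \<Rightarrow> complex"
          by (rule integrable_disc_times_bounded[OF that, where B=B']) (use B' in auto)
        have "(\<integral>\<zeta>. D \<zeta> * cnj (G \<zeta>) \<partial>disc_area) = 0" by (rule integral_cnj_Hinf_eq_0[OF D Dk G])
        then have "(\<integral>\<zeta>. f \<zeta> * of_real (\<omega> (norm \<zeta>)) * cnj (G \<zeta>) \<partial>disc_area) = (\<integral>\<zeta>. V \<zeta> * of_real (\<omega> (norm \<zeta>)) * cnj (G \<zeta>) \<partial>disc_area)"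
          unfolding D_def left_diff_distrib using iG[OF f] iG[OF V] by simp
        then have "cnj (h z) = (\<integral>\<zeta>. V \<zeta> * of_real (\<omega> (norm \<zeta>)) * cnj (G \<zeta>) \<partial>disc_area)"
          unfolding h_def cnj_little_hankel G_def by simp
        then have "norm (h z) = norm (\<integral>\<zeta>. V \<zeta> * of_real (\<omega> (norm \<zeta>)) * cnj (G \<zeta>) \<partial>disc_area)"
          by (metis complex_mod_cnj)
        also have "\<dots> \<le> (\<integral>\<zeta>. norm (V \<zeta> * of_real (\<omega> (norm \<zeta>)) * cnj (G \<zeta>)) \<partial>disc_area)"
          by (rule integral_norm_bound)
        also have "\<dots> \<le> (\<integral>\<zeta>. M * (norm (kernel_series (cnj z * \<zeta>)) * norm (g \<zeta>) * \<omega> (norm \<zeta>)) \<partial>disc_area)"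
        proof (rule integral_mono_AE)
          show "integrable disc_area (\<lambda>\<zeta>. norm (V \<zeta> * of_real (\<omega> (norm \<zeta>)) * cnj (G \<zeta>)))"
            by (intro integrable_norm iG V)
          have "integrable disc_area (\<lambda>\<zeta>. norm (G \<zeta>) * \<omega> (norm \<zeta>))"
            by (rule integrable_disc_weight_bounded[where B=B']) (use B' in auto)
          then show "integrable disc_area (\<lambda>\<zeta>. M * (norm (kernel_series (cnj z * \<zeta>)) * norm (g \<zeta>) * \<omega> (norm \<zeta>)))"
            unfolding G_def bergman_kernel_eq by (simp add: norm_mult mult_ac)
          show "AE \<zeta> in disc_area. norm (V \<zeta> * of_real (\<omega> (norm \<zeta>)) * cnj (G \<zeta>)) \<le> M * (norm (kernel_series (cnj z * \<zeta>)) * norm (g \<zeta>) * \<omega> (norm \<zeta>))"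
            using ae AE_space unfolding V_def[symmetric]
          proof eventually_elim
            case (elim \<zeta>)
            have "norm (V \<zeta>) * (norm (kernel_series (cnj z * \<zeta>)) * norm (g \<zeta>) * \<omega> (norm \<zeta>)) \<le> M * (norm (kernel_series (cnj z * \<zeta>)) * norm (g \<zeta>) * \<omega> (norm \<zeta>))"
              using elim disc_profile_nonneg[of \<zeta>] by (intro mult_right_mono mult_nonneg_nonneg) auto
            then show ?case unfolding G_def bergman_kernel_eq
              using elim disc_profile_nonneg[of \<zeta>] by (simp add: norm_mult mult_ac)
          qed
        qed
        also have "\<dots> = M * Q z" by (simp add: Q_def)
        finally show ?thesis .
      qed
      define I where "I = (\<integral>z. norm (g z) powr p * \<omega> (norm z) \<partial>disc_area)"
      have I0: "0 \<le> I" unfolding I_def by (intro integral_nonneg_AE AE_I2) (auto simp: disc_profile_nonneg)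
      have Q0: "0 \<le> Q z" for z unfolding Q_def by (intro integral_nonneg_AE AE_I2) (auto simp: disc_profile_nonneg)
      have lpg: "lp_integral p g = ennreal I" unfolding I_def by (rule lp_integral_eq[OF Hinf_Lp[OF g]]) (use p in simp)
      have "lp_integral p h \<le> (\<integral>\<^sup>+z. ennreal (M powr p) * ennreal (Q z powr p * \<omega> (norm z)) \<partial>disc_area)"
      proof (rule nn_integral_mono)
        fix z assume "z \<in> space disc_area"
        then have z: "norm z < 1" by simp
        have "norm (h z) powr p \<le> (M * Q z) powr p" using hQ[OF z] p by (intro powr_mono2) auto
        also have "\<dots> = M powr p * Q z powr p" using M Q0 by (simp add: powr_mult)
        finally have "norm (h z) powr p * \<omega> (norm z) \<le> M powr p * Q z powr p * \<omega> (norm z)"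
          using disc_profile_nonneg[OF z] by (rule mult_right_mono)
        then show "ennreal (norm (h z) powr p * \<omega> (norm z)) \<le> ennreal (M powr p) * ennreal (Q z powr p * \<omega> (norm z))"
          using disc_profile_nonneg[OF z] by (simp add: ennreal_mult[symmetric] ennreal_leI mult.assoc)
      qed
      also have "\<dots> = ennreal (M powr p) * (\<integral>\<^sup>+z. ennreal (Q z powr p * \<omega> (norm z)) \<partial>disc_area)"
      proof (rule nn_integral_cmult)
        have [measurable]: "Q \<in> borel_measurable disc_area"
          unfolding Q_def[abs_def] by (rule measurable_kernel_integral[OF gm])
        show "(\<lambda>z. ennreal (Q z powr p * \<omega> (norm z))) \<in> borel_measurable disc_area" by measurable
      qed
      also have "\<dots> \<le> ennreal (M powr p) * (ennreal C * lp_integral p g)"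
        unfolding Q_def by (intro mult_left_mono C(2)[where B=B] gm B) auto
      also have "\<dots> = ennreal (M powr p * (C * I))"
        unfolding lpg using C(1) I0 by (simp add: ennreal_mult[symmetric])
      finally have lph: "lp_integral p h \<le> ennreal (M powr p * (C * I))" .
      have hm: "(\<lambda>z. norm (h z) powr p * \<omega> (norm z)) \<in> borel_measurable disc_area"
      proof -
        have "(\<lambda>z. norm (cnj (h z)) powr p * \<omega> (norm z)) \<in> borel_measurable disc_area"
          using cm by measurable
        then show ?thesis by simp
      qed
      have ih: "integrable disc_area (\<lambda>z. norm (h z) powr p * \<omega> (norm z))"
        by (rule integrableI_nonneg[OF hm AE_I2]) (use lph in \<open>auto simp: disc_profile_nonneg order.strict_trans1\<close>)
      have "(\<lambda>z. cnj (h z)) \<in> bergman_space p \<omega>"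
      proof -
        have "psum x holomorphic_on ball 0 1" by (rule holomorphic_psum[OF x])
        then have "(\<lambda>z. cnj (h z)) holomorphic_on ball 0 1"
          by (rule holomorphic_transform) (simp add: hx)
        then show ?thesis using cm ih by (simp add: bergman_space_def Lp_space_def)
      qed
      then have "(\<lambda>z. cnj (cnj (h z))) \<in> conj_bergman_space p \<omega>"
        unfolding conj_bergman_space_def by (rule image_eqI[rotated]) simp
      then show "little_hankel \<omega> (\<lambda>z. cnj (f z)) g \<in> conj_bergman_space p \<omega>"
        by (simp add: h_def)
      have "(\<integral>z. norm (h z) powr p * \<omega> (norm z) \<partial>disc_area) \<le> M powr p * (C * I)"
        using lph lp_integral_eq[OF ih] C(1) I0 by (simp add: ennreal_le_iff)
      then have "Lp_norm p \<omega> h \<le> (M powr p * (C * I)) powr (1 / p)"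
        unfolding Lp_norm_def using p
        by (intro powr_mono2 integral_nonneg_AE AE_I2) (auto simp: disc_profile_nonneg)
      also have "\<dots> = C powr (1 / p) * M * Lp_norm p \<omega> g"
        unfolding Lp_norm_def I_def[symmetric] using p M C(1) I0 by (simp add: powr_mult powr_powr)
      finally show "Lp_norm p \<omega> (little_hankel \<omega> (\<lambda>z. cnj (f z)) g) \<le> C powr (1 / p) * M * Lp_norm p \<omega> g"
        by (simp add: h_def)
    qed
  qed
  moreover have "0 < C powr (1 / p)" using C(1) by simp
  ultimately show ?thesis using that by blast
qed

end

section \<open>From the Hankel operator to the transform\<close>

text \<open>The arguments run around the circle in opposite directions, so the mean of the product
  keeps the diagonal terms only, each with the factor y^m twice.\<close>

lemma psum_hadamard:
  assumes d: "disc_coeffs d" and e: "disc_coeffs e" and y: "norm y < 1"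
  shows "psum (\<lambda>m. d m * e m) (y * y) = (\<integral>t. psum d (y * unit_cis t) * psum e (y * cnj (unit_cis t)) \<partial>unit_interval)"
proof -
  have ds: "summable (\<lambda>m. norm (d m * y ^ m))" and es: "summable (\<lambda>m. norm (e m * y ^ m))"
    using disc_coeffsD[OF d y] disc_coeffsD[OF e y] .
  have pd: "psum d (y * unit_cis t) = (\<Sum>m. (d m * y ^ m) * unit_cis t ^ m)" for t
    by (simp add: psum_def power_mult_distrib mult_ac)
  have pe: "psum e (y * cnj (unit_cis t)) = (\<Sum>m. (e m * y ^ m) * cnj (unit_cis t ^ m))" for t
    by (simp add: psum_def power_mult_distrib mult_ac)
  note G = integrable_circle_series[OF ds, folded pd]
  note c = integral_circle_series[OF ds, folded pd]
  have "(\<lambda>m. (e m * y ^ m) * (\<integral>t. psum d (y * unit_cis t) * cnj (unit_cis t ^ m) \<partial>unit_interval))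
     sums (\<integral>t. psum d (y * unit_cis t) * psum e (y * cnj (unit_cis t)) \<partial>unit_interval)"
    unfolding pe by (rule sums_integral_mult_suminf[OF es G]) (auto simp: norm_power)
  then have "(\<lambda>m. (d m * e m) * (y * y) ^ m) sums (\<integral>t. psum d (y * unit_cis t) * psum e (y * cnj (unit_cis t)) \<partial>unit_interval)"
    unfolding c by (simp add: power_mult_distrib mult_ac)
  then show ?thesis by (simp add: psum_def sums_iff)
qed

context doubling_weight
begin

text \<open>For the lower bound only the radii from r to 1 - (1 - r)/K are kept: there 1 - s \<ge>
  (1 - r)/K, and by lower doubling they carry at least the proportion 1 - 1/c of the tail. Together
  with the obvious upper bound this transfers upper doubling to the new weight.\<close>

lemma power_weight:
  obtains b c\<^sub>0 where "0 < c\<^sub>0" "upper_doubling_weight (\<lambda>r. \<omega> r * (1 - r) ^ n) b"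
    "\<And>r. 0 \<le> r \<Longrightarrow> r < 1 \<Longrightarrow> c\<^sub>0 * (1 - r) ^ n * tail \<omega> r \<le> tail (\<lambda>r. \<omega> r * (1 - r) ^ n) r"
proof -
  define \<nu> where "\<nu> r = \<omega> r * (1 - r) ^ n" for r
  define c0 where "c0 = (1 / K) ^ n * (1 - 1 / c)"
  have c0: "0 < c0" using K c by (simp add: c0_def)
  have wt: "weight_tail \<nu> r = (\<integral>s. indicator {r..} s * (1 - s) ^ n \<partial>radial_measure \<omega>)" if "0 \<le> r" for r
  proof -
    have "(\<integral>s. indicator {r..} s * (1 - s) ^ n \<partial>radial_measure \<omega>) = set_lebesgue_integral lebesgue {0..<1} (\<lambda>s. indicator {r..} s * (1 - s) ^ n * \<omega> s)"
      by (rule integral_radial) measurable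
    also have "\<dots> = weight_tail \<nu> r"
      unfolding weight_tail_def set_lebesgue_integral_def \<nu>_def
      using that by (intro Bochner_Integration.integral_cong) (auto simp: indicator_def)
    finally show ?thesis by simp
  qed
  have ii: "integrable (radial_measure \<omega>) (\<lambda>s. indicator {r..} s * (1 - s) ^ n :: real)" for r
    by (rule integrable_radial_bounded[where B=1]) (auto simp: indicator_def power_le_one)
  have ij: "integrable (radial_measure \<omega>) (\<lambda>s. a * indicator {r..} s :: real)" for r a
    by (rule integrable_radial_bounded[where B="\<bar>a\<bar>"]) (auto simp: indicator_def)
  have up: "weight_tail \<nu> r \<le> (1 - r) ^ n * tail \<omega> r" if r: "0 \<le> r" for r
  proof -
    have "weight_tail \<nu> r \<le> (\<integral>s. (1 - r) ^ n * indicator {r..} s \<partial>radial_measure \<omega>)"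
      unfolding wt[OF r]
    proof (rule integral_mono_AE[OF ii ij])
      show "AE s in radial_measure \<omega>. indicator {r..} s * (1 - s) ^ n \<le> (1 - r) ^ n * indicator {r..} s"
        using AE_radial by eventually_elim (auto simp: indicator_def intro: power_mono)
    qed
    then show ?thesis by (simp add: tail_def)
  qed
  have lo: "c0 * (1 - r) ^ n * tail \<omega> r \<le> weight_tail \<nu> r" if r: "0 \<le> r" "r < 1" for r
  proof -
    define r' where "r' = 1 - (1 - r) / K"
    let ?a = "((1 - r) / K) ^ n"
    have "(\<integral>s. ?a * indicator {r..} s - ?a * indicator {r'..} s \<partial>radial_measure \<omega>) \<le> weight_tail \<nu> r"
      unfolding wt[OF r(1)]
    proof (rule integral_mono_AE[OF Bochner_Integration.integrable_diff[OF ij ij] ii])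
      show "AE s in radial_measure \<omega>. ?a * indicator {r..} s - ?a * indicator {r'..} s \<le> indicator {r..} s * (1 - s) ^ n"
        using AE_radial
      proof eventually_elim
        case (elim s)
        have "r \<le> r'"
        proof -
          have "(1 - r) / K \<le> (1 - r) / 1" using r K by (intro divide_left_mono) auto
          then show ?thesis by (simp add: r'_def)
        qed
        moreover have "?a \<le> (1 - s) ^ n" if "s < r'"
          using that r K by (intro power_mono) (auto simp: r'_def)
        ultimately show ?case using elim by (auto simp: indicator_def)
      qed
    qed
    moreover have "(\<integral>s. ?a * indicator {r..} s - ?a * indicator {r'..} s \<partial>radial_measure \<omega>) = ?a * tail \<omega> r - ?a * tail \<omega> r'"
      by (subst Bochner_Integration.integral_diff[OF ij ij]) (simp add: tail_def)
    moreover have "?a * tail \<omega> r' \<le> ?a * (tail \<omega> r / c)"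
    proof (rule mult_left_mono)
      show "tail \<omega> r' \<le> tail \<omega> r / c" using reverse_doubling[OF r] c by (simp add: r'_def field_simps)
    qed (use r K in simp)
    ultimately have "?a * tail \<omega> r - ?a * (tail \<omega> r / c) \<le> weight_tail \<nu> r" by linarith
    moreover have "c0 * (1 - r) ^ n * tail \<omega> r = ?a * tail \<omega> r - ?a * (tail \<omega> r / c)"
    proof -
      have a: "?a = (1 / K) ^ n * (1 - r) ^ n" by (simp add: power_divide)
      have "k * (1 - 1 / c) * x * t = (k * x) * t - (k * x) * (t / c)" for k x t :: real
        by (simp add: algebra_simps)
      then show ?thesis unfolding c0_def a .
    qed
    ultimately show ?thesis by linarith
  qed
  have rw: "radial_weight \<nu>"
    unfolding radial_weight_def
  proof (intro conjI ballI)
    show "0 \<le> \<nu> r" if "r \<in> {0..<1}" for r using that nonneg[of r] by (simp add: \<nu>_def)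
    show "0 < weight_tail \<nu> r" if "r \<in> {0..<1}" for r
    proof -
      have "0 < c0 * (1 - r) ^ n * tail \<omega> r" using that c0 tail_pos[of r] by simp
      then show ?thesis using lo[of r] that by simp
    qed
    show "set_integrable lebesgue {0..<1} \<nu>"
      unfolding set_integrable_def
    proof (rule Bochner_Integration.integrable_bound[OF integrable_profile])
      have "(\<lambda>r::real. (1 - r) ^ n) \<in> borel_measurable lebesgue" by (rule measurable_lebesgue_borel) measurable
      from borel_measurable_times[OF measurable_profile this, unfolded mult.assoc]
      show "(\<lambda>r. indicator {0..<1} r *\<^sub>R \<nu> r) \<in> borel_measurable lebesgue"
        unfolding \<nu>_def real_scaleR_def .
      show "AE r in lebesgue. norm (indicator {0..<1} r *\<^sub>R \<nu> r) \<le> norm (indicator {0..<1} r * \<omega> r)"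
        by (rule AE_I2) (auto simp: indicator_def \<nu>_def abs_mult power_le_one mult_left_le)
    qed
  qed
  interpret N: weight \<nu> by unfold_locales (rule rw)
  \<comment> \<open>The new doubling constant has to cover 2^\<beta> for the tail of \<omega>, 2^n
    for halving the distance, and the loss 1 / \<open>c0\<close> in the lower bound.\<close>
  obtain b where b: "2 ^ \<beta> * 2 ^ n / c0 < (2::real) ^ b" using real_arch_pow[of 2] by auto
  have up': "tail \<nu> r \<le> (1 - r) ^ n * tail \<omega> r" if "0 \<le> r" for r
    using up[OF that] N.weight_tail_eq[OF that] by simp
  have lo': "c0 * (1 - r) ^ n * tail \<omega> r \<le> tail \<nu> r" if "0 \<le> r" "r < 1" for r
    using lo[OF that] N.weight_tail_eq[OF that(1)] by simp
  have "upper_doubling_weight \<nu> b"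
  proof unfold_locales
    fix r :: real assume r: "0 \<le> r" "r < 1"
    let ?s = "(1 + r) / 2"
    have s: "0 \<le> ?s" "?s < 1" "1 - r = 2 * (1 - ?s)" using r by (auto simp: field_simps)
    have "tail \<nu> r \<le> (1 - r) ^ n * tail \<omega> r" by (rule up') fact
    also have "\<dots> \<le> (1 - r) ^ n * (2 ^ \<beta> * tail \<omega> ?s)" using r by (intro mult_left_mono doubling) auto
    also have "(1 - r) ^ n = 2 ^ n * (1 - ?s) ^ n" unfolding s(3) by (rule power_mult_distrib)
    also have "2 ^ n * (1 - ?s) ^ n * (2 ^ \<beta> * tail \<omega> ?s) = (2 ^ \<beta> * 2 ^ n / c0) * (c0 * (1 - ?s) ^ n * tail \<omega> ?s)"
      using c0 by simp
    also have "\<dots> \<le> 2 ^ b * tail \<nu> ?s"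
      using b lo'[OF s(1,2)] c0 s tail_pos[OF s(2)] by (intro mult_mono) auto
    finally show "tail \<nu> r \<le> 2 ^ b * tail \<nu> ?s" .
  qed
  then show ?thesis using that[of c0 b] c0 lo' unfolding \<nu>_def[abs_def] by blast
qed

text \<open>The conjugated image F of g has the same antianalytic moments against \<omega> as f
  cnj(g), so it can replace that product when paired with h. Hoelder and the operator bound then
  finish.\<close>

lemma pairing_bound:
  assumes p: "1 < p" "1 < q" "1 / p + 1 / q = 1"
    and f: "integrable disc_area (\<lambda>z. f z * of_real (\<omega> (norm z)))"
    and B: "little_hankel_bound p \<omega> (\<lambda>z. cnj (f z)) B"
    and g: "g \<in> Hinf_space" and h: "h \<in> Hinf_space"
  shows "norm (\<integral>z. f z * of_real (\<omega> (norm z)) * cnj (g z * h z) \<partial>disc_area) \<le> B * Lp_norm p \<omega> g * Lp_norm q \<omega> h"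
proof -
  note [measurable] = Hinf_measurable[OF g] Hinf_measurable[OF h]
  let ?H = "little_hankel \<omega> (\<lambda>z. cnj (f z)) g"
  define F where "F z = cnj (?H z)" for z
  have "?H \<in> conj_bergman_space p \<omega>" using B g by (simp add: little_hankel_bound_def)
  then obtain F' where F': "F' \<in> bergman_space p \<omega>" "?H = (\<lambda>z. cnj (F' z))"
    by (auto simp: conj_bergman_space_def)
  have "F = F'" by (rule ext) (simp add: F_def F'(2))
  then have Fb: "F \<in> bergman_space p \<omega>" using F' by simp
  have Fm[measurable]: "F \<in> borel_measurable disc_area" and Fi: "integrable disc_area (\<lambda>z. norm (F z) powr p * \<omega> (norm z))"
    using Fb by (auto simp: bergman_space_def Lp_space_def)
  define x where "x m = of_real (kernel_coeff m) * (\<integral>\<zeta>. f \<zeta> * of_real (\<omega> (norm \<zeta>)) * cnj (g \<zeta>) * cnj \<zeta> ^ m \<partial>disc_area)" for m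
  have x: "disc_coeffs x" using cnj_little_hankel_series(1)[OF f g] unfolding x_def[abs_def] .
  have Fx: "F z = psum x z" if "norm z < 1" for z
    using cnj_little_hankel_series(2)[OF f g that] unfolding x_def[abs_def] F_def .
  \<comment> \<open>Hoelder against the constant function 1, using that the weight has finite
    mass.\<close>
  have Fw: "integrable disc_area (\<lambda>z. F z * of_real (\<omega> (norm z)))"
  proof -
    have "integrable disc_area (\<lambda>z. norm (F z) * 1 * \<omega> (norm z))"
      by (rule Holder_weighted(1)[OF p]) (use Fi integrable_disc_profile in \<open>auto simp: disc_profile_nonneg\<close>)
    then show ?thesis
      by (rule Bochner_Integration.integrable_bound) (auto simp: norm_mult abs_mult)
  qed
  obtain Bg where Bg: "0 \<le> Bg" "\<And>z. norm z < 1 \<Longrightarrow> norm (g z) \<le> Bg" using Hinf_bounded[OF g] by blast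
  have fg: "integrable disc_area (\<lambda>z. f z * of_real (\<omega> (norm z)) * cnj (g z))"
    by (rule integrable_disc_times_bounded[OF f, where B=Bg]) (use Bg in auto)
  define D where "D z = F z * of_real (\<omega> (norm z)) - f z * of_real (\<omega> (norm z)) * cnj (g z)" for z
  have D: "integrable disc_area D" unfolding D_def[abs_def] using Fw fg by simp
  \<comment> \<open>The reproducing property tested on monomials: the k-th kernel coefficient
    cancels the corresponding moment of \<omega>.\<close>
  have Dk: "(\<integral>z. D z * cnj z ^ k \<partial>disc_area) = 0" for k
  proof -
    have i: "integrable disc_area (\<lambda>z. u z * cnj z ^ k)" if "integrable disc_area u" for u :: "complex \<Rightarrow> complex"
      by (rule integrable_disc_times_bounded[OF that, where B=1]) (auto simp: norm_power power_le_one)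
    have i1: "integrable disc_area (\<lambda>z. complex_of_real (\<omega> (norm z)))"
      using integrable_disc_profile by (rule integrable_of_real)
    have i2: "integrable disc_area (\<lambda>z. psum x z * complex_of_real (\<omega> (norm z)))"
      using Fw by (rule Bochner_Integration.integrable_cong[THEN iffD1, rotated 2]) (auto simp: Fx)
    have "(\<integral>z. F z * of_real (\<omega> (norm z)) * cnj z ^ k \<partial>disc_area) = (\<integral>z. psum x z * cnj z ^ k * of_real (\<omega> (norm z)) \<partial>disc_area)"
      by (intro Bochner_Integration.integral_cong) (auto simp: Fx mult_ac)
    also have "\<dots> = x k * (\<integral>z. of_real (norm z ^ (2 * k) * \<omega> (norm z)) \<partial>disc_area)"
      by (rule integral_psum_monomial[OF x i1 i2])
    also have "\<dots> = x k * of_real (2 * moment (2 * k + 1))"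
      using disc_moment(2)[of k] by (simp only: integral_complex_of_real)
    also have "\<dots> = of_real (kernel_coeff k * (2 * moment (2 * k + 1))) * (\<integral>z. f z * of_real (\<omega> (norm z)) * cnj (g z) * cnj z ^ k \<partial>disc_area)"
      by (simp add: x_def)
    finally have "(\<integral>z. F z * of_real (\<omega> (norm z)) * cnj z ^ k \<partial>disc_area) = (\<integral>z. f z * of_real (\<omega> (norm z)) * cnj (g z) * cnj z ^ k \<partial>disc_area)"
      unfolding kernel_reproduces_moment by simp
    then show ?thesis unfolding D_def left_diff_distrib using i[OF Fw] i[OF fg] by simp
  qed
  obtain Bh where Bh: "0 \<le> Bh" "\<And>z. norm z < 1 \<Longrightarrow> norm (h z) \<le> Bh" using Hinf_bounded[OF h] by blast
  have ih: "integrable disc_area (\<lambda>z. u z * cnj (h z))" if "integrable disc_area u" for u :: "complex \<Rightarrow> complex"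
    by (rule integrable_disc_times_bounded[OF that, where B=Bh]) (use Bh in auto)
  have "(\<integral>z. D z * cnj (h z) \<partial>disc_area) = 0" by (rule integral_cnj_Hinf_eq_0[OF D Dk h])
  then have "(\<integral>z. f z * of_real (\<omega> (norm z)) * cnj (g z * h z) \<partial>disc_area) = (\<integral>z. F z * of_real (\<omega> (norm z)) * cnj (h z) \<partial>disc_area)"
    unfolding D_def left_diff_distrib using ih[OF Fw] ih[OF fg] by (simp add: mult.assoc)
  then have "norm (\<integral>z. f z * of_real (\<omega> (norm z)) * cnj (g z * h z) \<partial>disc_area) \<le> (\<integral>z. norm (F z * of_real (\<omega> (norm z)) * cnj (h z)) \<partial>disc_area)"
    by (simp only: integral_norm_bound)
  also have "\<dots> = (\<integral>z. norm (F z) * norm (h z) * \<omega> (norm z) \<partial>disc_area)"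
    by (intro Bochner_Integration.integral_cong) (auto simp: norm_mult disc_profile_nonneg)
  also have "\<dots> \<le> Lp_norm p \<omega> F * Lp_norm q \<omega> h"
    unfolding Lp_norm_def
    by (rule Holder_weighted(2)[OF p]) (use Fi Hinf_Lp[OF h, of q] p in \<open>auto simp: disc_profile_nonneg\<close>)
  also have "Lp_norm p \<omega> F = Lp_norm p \<omega> ?H" by (simp add: Lp_norm_def F_def)
  also have "Lp_norm p \<omega> ?H * Lp_norm q \<omega> h \<le> (B * Lp_norm p \<omega> g) * Lp_norm q \<omega> h"
    using B g by (intro mult_right_mono) (auto simp: little_hankel_bound_def Lp_norm_def)
  finally show ?thesis .
qed

text \<open>One exponent serves p and its conjugate alike, because (\<beta> + 2) p exceeds both
  \<beta> + 1 and 2 for every p > 1.\<close>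

definition test_function :: "complex \<Rightarrow> complex \<Rightarrow> complex" where
  "test_function b z = 1 / (1 - b * z) ^ (\<beta> + 2)"

lemma test_function_Hinf:
  assumes b: "norm b < 1" shows "test_function b \<in> Hinf_space"
proof -
  have n: "1 - norm b \<le> norm (1 - b * z)" if "norm z < 1" for z
  proof -
    have "norm (b * z) \<le> norm b" using that by (simp add: norm_mult mult_left_le)
    then show ?thesis using norm_triangle_ineq2[of 1 "b * z"] by simp
  qed
  have nz: "1 - b * z \<noteq> 0" if "norm z < 1" for z using n[OF that] b by auto
  have "test_function b holomorphic_on ball 0 1"
    unfolding test_function_def[abs_def] using nz by (auto intro!: holomorphic_intros)
  moreover have "norm (test_function b z) \<le> 1 / (1 - norm b) ^ (\<beta> + 2)" if "z \<in> ball 0 1" for z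
  proof -
    have "0 < (1 - norm b) ^ (\<beta> + 2)" using b by (intro zero_less_power) simp
    moreover have "(1 - norm b) ^ (\<beta> + 2) \<le> norm (1 - b * z) ^ (\<beta> + 2)"
      using n[of z] b that by (intro power_mono) auto
    ultimately show ?thesis
      unfolding test_function_def norm_divide norm_power norm_one by (intro divide_left_mono mult_pos_pos) linarith+
  qed
  ultimately show ?thesis unfolding Hinf_space_def bounded_iff by blast
qed

text \<open>\<open>test_function_bound\<close> with \<gamma> = (\<beta> + 2) p, followed by a p-th
  root.\<close>

lemma test_function_norm:
  assumes p: "1 < p"
  obtains C where "0 < C" "\<And>b. norm b < 1 \<Longrightarrow>
    Lp_norm p \<omega> (test_function b) \<le> C * (tail \<omega> (norm b) powr (1 / p) * (1 - norm b) powr (1 / p - real (\<beta> + 2)))"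
proof -
  define \<gamma> where "\<gamma> = real (\<beta> + 2) * p"
  have "real (\<beta> + 2) * 1 < \<gamma>" unfolding \<gamma>_def using p by (intro mult_strict_left_mono) auto
  then have \<gamma>: "real \<beta> + 1 < \<gamma>" "2 \<le> \<gamma>" by auto
  obtain C where C: "0 < C" "\<And>b. norm b < 1 \<Longrightarrow>
    (\<integral>\<^sup>+z. ennreal (norm (1 - b * z) powr (- \<gamma>)) * ennreal (\<omega> (norm z)) \<partial>disc_area)
      \<le> ennreal (C * (tail \<omega> (norm b) * (1 - norm b) powr (1 - \<gamma>)))"
    using test_function_bound[OF \<gamma>] by blast
  have "Lp_norm p \<omega> (test_function b) \<le> C powr (1 / p) * (tail \<omega> (norm b) powr (1 / p) * (1 - norm b) powr (1 / p - real (\<beta> + 2)))"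
    if b: "norm b < 1" for b
  proof -
    have T: "0 < tail \<omega> (norm b)" by (rule tail_pos) fact
    have eq: "norm (test_function b z) powr p = norm (1 - b * z) powr (- \<gamma>)" if "norm z < 1" for z
    proof -
      have "norm (b * z) < 1" using b that by (rule norm_disc_mult_less)
      then have x: "0 < norm (1 - b * z)" by auto
      have "norm (test_function b z) = 1 / norm (1 - b * z) powr real (\<beta> + 2)"
        unfolding test_function_def norm_divide norm_power norm_one powr_realpow[OF x] ..
      also have "\<dots> = norm (1 - b * z) powr (- real (\<beta> + 2))" by (rule powr_minus_divide[symmetric])
      finally have "norm (test_function b z) powr p = norm (1 - b * z) powr (- real (\<beta> + 2) * p)"
        by (simp only: powr_powr)
      also have "- real (\<beta> + 2) * p = - \<gamma>" by (simp add: \<gamma>_def algebra_simps)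
      finally show ?thesis .
    qed
    have "ennreal (\<integral>z. norm (test_function b z) powr p * \<omega> (norm z) \<partial>disc_area) = lp_integral p (test_function b)"
      by (rule lp_integral_eq[OF Hinf_Lp[OF test_function_Hinf[OF b]], symmetric]) (use p in simp)
    also have "\<dots> = (\<integral>\<^sup>+z. ennreal (norm (1 - b * z) powr (- \<gamma>)) * ennreal (\<omega> (norm z)) \<partial>disc_area)"
      by (intro nn_integral_cong) (auto simp: eq ennreal_mult disc_profile_nonneg)
    also have "\<dots> \<le> ennreal (C * (tail \<omega> (norm b) * (1 - norm b) powr (1 - \<gamma>)))" by (rule C(2)[OF b])
    finally have "(\<integral>z. norm (test_function b z) powr p * \<omega> (norm z) \<partial>disc_area) \<le> C * (tail \<omega> (norm b) * (1 - norm b) powr (1 - \<gamma>))"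
      using C(1) T by (simp add: ennreal_le_iff)
    then have "Lp_norm p \<omega> (test_function b) \<le> (C * (tail \<omega> (norm b) * (1 - norm b) powr (1 - \<gamma>))) powr (1 / p)"
      unfolding Lp_norm_def using p by (intro powr_mono2 integral_nonneg_AE AE_I2) (auto simp: disc_profile_nonneg)
    also have "\<dots> = C powr (1 / p) * (tail \<omega> (norm b) powr (1 / p) * (1 - norm b) powr ((1 - \<gamma>) * (1 / p)))"
      using C(1) T by (simp add: powr_mult powr_powr)
    also have "(1 - \<gamma>) * (1 / p) = 1 / p - real (\<beta> + 2)" using p by (simp add: \<gamma>_def field_simps)
    finally show ?thesis .
  qed
  moreover have "0 < C powr (1 / p)" using C(1) by simp
  ultimately show ?thesis using that by blast
qed

text \<open>The binomial coefficients are those of the square of a test function; after the division the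
  coefficients still have to grow, which is where \<open>n \<ge> 2 (\<beta> + 2)\<close> enters.\<close>

lemma quotient_kernel_mean:
  assumes n: "2 * (\<beta> + 2) \<le> n"
    and N: "upper_doubling_weight (\<lambda>r. \<omega> r * (1 - r) ^ n) b"
    and c0: "0 < c\<^sub>0" "\<And>r. 0 \<le> r \<Longrightarrow> r < 1 \<Longrightarrow> c\<^sub>0 * (1 - r) ^ n * tail \<omega> r \<le> tail (\<lambda>r. \<omega> r * (1 - r) ^ n) r"
  defines "d \<equiv> \<lambda>m. upper_doubling_weight.kernel_coeff (\<lambda>r. \<omega> r * (1 - r) ^ n) m / real ((2 * \<beta> + 3 + m) choose m)"
  shows "disc_coeffs (\<lambda>m. of_real (d m))"
    and "\<exists>C>0. \<forall>w. norm w < 1 \<longrightarrow> circle_mean (psum (\<lambda>m. of_real (d m))) w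
           \<le> ennreal (C / ((1 - norm w) ^ Suc (n - 2 * (\<beta> + 2)) * tail \<omega> (norm w)))"
proof -
  interpret N: upper_doubling_weight "\<lambda>r. \<omega> r * (1 - r) ^ n" b by (rule N)
  define q where "q = 2 * \<beta> + 3"
  define s where "s = n - 2 * (\<beta> + 2)"
  define bn where "bn m = real ((q + m) choose m)" for m
  \<comment> \<open>Of the n powers of m in the kernel coefficients, q are lost to the binomial
    coefficient and one to differencing; the remaining s is the growth order passed to
    \<open>circle_mean_bound\<close>.\<close>
  have ns: "n = s + Suc q" using n by (simp add: s_def q_def)
  have d: "d m = N.kernel_coeff m / bn m" for m by (simp add: d_def bn_def q_def)
  have bn1: "1 \<le> bn m" for m
  proof -
    have "0 < (q + m) choose m" by simp
    then show ?thesis unfolding bn_def by linarith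
  qed
  have d0: "0 \<le> d m" for m unfolding d using N.kernel_coeff_pos[of m] bn1[of m] by simp
  show dc: "disc_coeffs (\<lambda>m. of_real (d m))"
  proof (rule disc_coeffs_le[OF N.disc_coeffs_kernel])
    have "d m \<le> N.kernel_coeff m" for m
      unfolding d using N.kernel_coeff_pos[of m] bn1[of m] by (simp add: divide_le_eq mult_le_cancel_left1)
    then show "norm (complex_of_real (d m)) \<le> norm (complex_of_real (N.kernel_coeff m))" for m
      using d0[of m] N.kernel_coeff_pos[of m] by simp
  qed
  obtain E where E: "0 < E" "\<And>m. N.kernel_coeff (Suc m) - N.kernel_coeff m \<le> E / real (m + 1) * N.kernel_coeff m"
    using N.kernel_coeff_difference by blast
  have bS: "bn (Suc m) = bn m * (real (m + 1 + q) / real (m + 1))" for m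
  proof -
    have "Suc m * ((q + Suc m) choose Suc m) = (q + Suc m) * ((q + m) choose m)"
      using Suc_times_binomial[of m "q + m"] by simp
    then have "real (Suc m) * real ((q + Suc m) choose Suc m) = real (q + Suc m) * real ((q + m) choose m)"
      by (simp only: of_nat_mult[symmetric])
    then show ?thesis by (simp add: bn_def field_simps)
  qed
  \<comment> \<open>The relative increment is at most E / (m + 1) for the kernel coefficients and
    exactly q / (m + 1) for the binomial ones; for the quotient the two add up at worst.\<close>
  have diff: "\<bar>d (Suc m) - d m\<bar> \<le> (E + real q) / real (m + 1) * d m" for m
  proof -
    let ?k = "N.kernel_coeff m" and ?k' = "N.kernel_coeff (Suc m)"
    let ?t = "real (m + 1) / real (m + 1 + q)"
    have k: "0 < ?k" "?k \<le> ?k'" using N.kernel_coeff_pos N.kernel_coeff_mono by auto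
    have t: "0 \<le> ?t" "?t \<le> 1" "1 - real q / real (m + 1) \<le> ?t"
    proof -
      have "1 - ?t = real q / real (m + 1 + q)" by (simp add: field_simps)
      also have "\<dots> \<le> real q / real (m + 1)" by (intro divide_left_mono) auto
      finally show "1 - real q / real (m + 1) \<le> ?t" by linarith
    qed auto
    have e: "d (Suc m) - d m = (?k' * ?t - ?k) / bn m"
    proof -
      have "x / (y * (u / v)) = x * (v / u) / y" for x y u v :: real by (simp add: mult_ac)
      then show ?thesis unfolding d bS by (simp only: diff_divide_distrib)
    qed
    have u: "?k' * ?t - ?k \<le> (E + real q) / real (m + 1) * ?k"
    proof -
      have "?k' * ?t \<le> ?k' * 1" using t k by (intro mult_left_mono) auto
      then have "?k' * ?t - ?k \<le> E / real (m + 1) * ?k" using E(2)[of m] by simp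
      also have "\<dots> \<le> (E + real q) / real (m + 1) * ?k" using k by (intro mult_right_mono divide_right_mono) auto
      finally show ?thesis .
    qed
    have l: "- ((E + real q) / real (m + 1) * ?k) \<le> ?k' * ?t - ?k"
    proof -
      have "?k * (1 - real q / real (m + 1)) \<le> ?k' * ?t"
        using t k order_trans[OF mult_left_mono[OF t(3), of ?k] mult_right_mono[OF k(2) t(1)]] by simp
      then have "- (real q / real (m + 1) * ?k) \<le> ?k' * ?t - ?k" by (simp add: algebra_simps)
      moreover have "real q / real (m + 1) * ?k \<le> (E + real q) / real (m + 1) * ?k"
        using k E by (intro mult_right_mono divide_right_mono) auto
      ultimately show ?thesis by linarith
    qed
    have "\<bar>d (Suc m) - d m\<bar> = \<bar>?k' * ?t - ?k\<bar> / bn m" unfolding e using bn1[of m] by (simp add: abs_divide)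
    also have "\<dots> \<le> ((E + real q) / real (m + 1) * ?k) / bn m"
      using u l bn1[of m] by (intro divide_right_mono) auto
    also have "\<dots> = (E + real q) / real (m + 1) * d m" by (simp add: d)
    finally show ?thesis .
  qed
  \<comment> \<open>The radius 1 - 1/(m + 2) turns the factor (1 - r)^n of the new tail into (m +
    2)^(-n).\<close>
  have dle: "d m \<le> (9 / c\<^sub>0 * fact q) * (real (m + 2) ^ n / real (m + 1) ^ q) / tail \<omega> (inner_radius m)" for m
  proof -
    let ?r = "inner_radius m"
    have r: "0 \<le> ?r" "?r < 1" "1 - ?r = 1 / real (m + 2)" using inner_radius_bounds[of m] by (auto simp: inner_radius_def)
    have T: "0 < tail \<omega> ?r" "0 < tail (\<lambda>r. \<omega> r * (1 - r) ^ n) ?r" using tail_pos N.tail_pos r by auto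
    have "N.kernel_coeff m \<le> 9 / tail (\<lambda>r. \<omega> r * (1 - r) ^ n) ?r" by (rule N.kernel_coeff_le)
    also have "\<dots> \<le> 9 / (c\<^sub>0 * (1 - ?r) ^ n * tail \<omega> ?r)"
      using c0(2)[OF r(1,2)] T c0(1) r by (intro divide_left_mono mult_pos_pos) auto
    also have "\<dots> = 9 / c\<^sub>0 * real (m + 2) ^ n / tail \<omega> ?r"
      unfolding r(3) by (simp add: power_one_over field_simps)
    finally have k: "N.kernel_coeff m \<le> 9 / c\<^sub>0 * real (m + 2) ^ n / tail \<omega> ?r" .
    have "real (m + 1) ^ q / fact q \<le> bn m" using power_le_binomial[of m q] by (simp add: bn_def field_simps)
    then have "d m \<le> (9 / c\<^sub>0 * real (m + 2) ^ n / tail \<omega> ?r) / (real (m + 1) ^ q / fact q)"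
      unfolding d using k N.kernel_coeff_pos[of m] by (intro frac_le) auto
    then show ?thesis by (simp add: mult_ac)
  qed
  define A1 where "A1 = (E + real q) * (9 / c\<^sub>0 * fact q) * 2 ^ Suc q"
  \<comment> \<open>The second summand is for index 0, where \<open>coeff_diff\<close> is the
    coefficient itself.\<close>
  define A where "A = A1 + d 0 * tail \<omega> (inner_radius 0)"
  have A1: "0 \<le> A1" using E c0 by (simp add: A1_def)
  have T0: "0 < tail \<omega> (inner_radius m)" for m using tail_pos inner_radius_bounds by blast
  have A: "0 \<le> A" using A1 d0[of 0] T0[of 0] by (simp add: A_def)
  have cd: "norm (coeff_diff (\<lambda>m. complex_of_real (d m)) m) \<le> A * real (m + 2) ^ s / tail \<omega> (inner_radius m)" for m
  proof (cases m)
    case 0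
    have "d 0 * tail \<omega> (inner_radius 0) \<le> A * 1" using A1 by (simp add: A_def)
    also have "\<dots> \<le> A * 2 ^ s" using A by (intro mult_left_mono) auto
    finally have "d 0 \<le> A * 2 ^ s / tail \<omega> (inner_radius 0)" using T0[of 0] by (simp add: field_simps)
    then show ?thesis using 0 d0[of 0] by (simp add: coeff_diff_def)
  next
    case (Suc i)
    have "norm (coeff_diff (\<lambda>m. complex_of_real (d m)) m) = \<bar>d (Suc i) - d i\<bar>"
      using Suc by (simp add: coeff_diff_def flip: of_real_diff)
    also have "\<dots> \<le> (E + real q) / real (i + 1) * ((9 / c\<^sub>0 * fact q) * (real (i + 2) ^ n / real (i + 1) ^ q) / tail \<omega> (inner_radius i))"
      using E by (intro order_trans[OF diff] mult_left_mono dle) auto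
    also have "\<dots> = (E + real q) * (9 / c\<^sub>0 * fact q) * (real (i + 2) ^ n / real (i + 1) ^ Suc q) / tail \<omega> (inner_radius i)"
      by (simp add: mult_ac)
    \<comment> \<open>The bound at i is restated at m = i + 1: the estimate i + 2 \<le> 2 (i + 1)
      absorbs q + 1 powers, and the tail at m is smaller than that at i.\<close>
    also have "\<dots> \<le> (E + real q) * (9 / c\<^sub>0 * fact q) * (2 ^ Suc q * real (m + 2) ^ s) / tail \<omega> (inner_radius m)"
    proof (intro frac_le mult_left_mono)
      have "real (i + 2) ^ n = real (i + 2) ^ s * real (i + 2) ^ Suc q" unfolding ns by (rule power_add)
      also have "\<dots> \<le> real (m + 2) ^ s * (2 * real (i + 1)) ^ Suc q"
        using Suc by (intro mult_mono power_mono) auto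
      finally have "real (i + 2) ^ n \<le> (2 ^ Suc q * real (m + 2) ^ s) * real (i + 1) ^ Suc q"
        unfolding power_mult_distrib by (simp add: mult_ac)
      then show "real (i + 2) ^ n / real (i + 1) ^ Suc q \<le> 2 ^ Suc q * real (m + 2) ^ s"
        by (subst pos_divide_le_eq) (auto simp del: power_Suc)
      show "tail \<omega> (inner_radius m) \<le> tail \<omega> (inner_radius i)"
        using Suc by (intro tail_antimono) (auto simp: inner_radius_def field_simps)
      show "0 < tail \<omega> (inner_radius m)" by (rule T0)
    qed (use E c0 in auto)
    also have "\<dots> = A1 * real (m + 2) ^ s / tail \<omega> (inner_radius m)" by (simp add: A1_def)
    also have "\<dots> \<le> A * real (m + 2) ^ s / tail \<omega> (inner_radius m)"
      using T0[of m] T0[of 0] d0[of 0] by (intro divide_right_mono mult_right_mono) (auto simp: A_def)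
    finally show ?thesis .
  qed
  obtain C where C: "0 < C"
    "\<And>x A w. disc_coeffs x \<Longrightarrow> 0 \<le> A \<Longrightarrow>
       (\<And>m. norm (coeff_diff x m) \<le> A * real (m + 2) ^ s / tail \<omega> (inner_radius m)) \<Longrightarrow> norm w < 1 \<Longrightarrow>
       circle_mean (psum x) w \<le> ennreal (C * A / ((1 - norm w) ^ Suc s * tail \<omega> (norm w)))"
    using circle_mean_bound by blast
  show "\<exists>C>0. \<forall>w. norm w < 1 \<longrightarrow> circle_mean (psum (\<lambda>m. of_real (d m))) w
           \<le> ennreal (C / ((1 - norm w) ^ Suc (n - 2 * (\<beta> + 2)) * tail \<omega> (norm w)))"
  \<comment> \<open>The added 1 makes the constant positive.\<close>
  proof (intro exI[of _ "C * A + 1"] conjI allI impI)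
    show "0 < C * A + 1" using C A by (simp add: add_nonneg_pos)
    fix w :: complex assume w: "norm w < 1"
    have "circle_mean (psum (\<lambda>m. of_real (d m))) w \<le> ennreal (C * A / ((1 - norm w) ^ Suc s * tail \<omega> (norm w)))"
      by (rule C(2)[OF dc A cd w])
    also have "\<dots> \<le> ennreal ((C * A + 1) / ((1 - norm w) ^ Suc s * tail \<omega> (norm w)))"
      using w tail_pos[OF w] by (intro ennreal_leI divide_right_mono) auto
    finally show "circle_mean (psum (\<lambda>m. of_real (d m))) w \<le> ennreal ((C * A + 1) / ((1 - norm w) ^ Suc (n - 2 * (\<beta> + 2)) * tail \<omega> (norm w)))"
      by (simp add: s_def)
  qed
qed

text \<open>One Hadamard factor is bounded uniformly on the circle by \<open>pairing_bound\<close>,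
  the other in mean by \<open>quotient_kernel_mean\<close>; their singularities multiply to exactly
  the power of 1 - |z| that the transform carries in front.\<close>

lemma V_op_bound_of_little_hankel:
  assumes p: "1 < p" and n: "2 * (\<beta> + 2) \<le> n"
    and N: "upper_doubling_weight (\<lambda>r. \<omega> r * (1 - r) ^ n) b"
    and c0: "0 < c\<^sub>0" "\<And>r. 0 \<le> r \<Longrightarrow> r < 1 \<Longrightarrow> c\<^sub>0 * (1 - r) ^ n * tail \<omega> r \<le> tail (\<lambda>r. \<omega> r * (1 - r) ^ n) r"
  obtains C where "0 < C" "\<And>f B z. integrable disc_area (\<lambda>z. f z * of_real (\<omega> (norm z))) \<Longrightarrow>
    little_hankel_bound p \<omega> (\<lambda>z. cnj (f z)) B \<Longrightarrow> norm z < 1 \<Longrightarrow>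
    norm (V_op \<omega> (\<lambda>r. (1 - r) ^ n) f z) \<le> C * B"
proof -
  interpret N: upper_doubling_weight "\<lambda>r. \<omega> r * (1 - r) ^ n" b by (rule N)
  define q where "q = p / (p - 1)"
  have pq: "1 < p" "1 < q" "1 / p + 1 / q = 1" using p by (auto simp: q_def field_simps)
  define L where "L = \<beta> + 2"
  define bn where "bn m = real ((2 * \<beta> + 3 + m) choose m)" for m
  define d where "d m = N.kernel_coeff m / bn m" for m
  have bn0: "0 < bn m" for m by (simp add: bn_def)
  have dc: "disc_coeffs (\<lambda>m. of_real (d m))"
    using quotient_kernel_mean(1)[OF n N c0] unfolding d_def bn_def .
  obtain C1 where C1: "0 < C1" "\<And>w. norm w < 1 \<Longrightarrow> circle_mean (psum (\<lambda>m. of_real (d m))) w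
           \<le> ennreal (C1 / ((1 - norm w) ^ Suc (n - 2 * (\<beta> + 2)) * tail \<omega> (norm w)))"
    using quotient_kernel_mean(2)[OF n N c0] unfolding d_def bn_def by blast
  obtain C2 where C2: "0 < C2" "\<And>b. norm b < 1 \<Longrightarrow>
    Lp_norm p \<omega> (test_function b) \<le> C2 * (tail \<omega> (norm b) powr (1 / p) * (1 - norm b) powr (1 / p - real L))"
    using test_function_norm[OF pq(1)] unfolding L_def by blast
  obtain C3 where C3: "0 < C3" "\<And>b. norm b < 1 \<Longrightarrow>
    Lp_norm q \<omega> (test_function b) \<le> C3 * (tail \<omega> (norm b) powr (1 / q) * (1 - norm b) powr (1 / q - real L))"
    using test_function_norm[OF pq(2)] unfolding L_def by blast
  define C where "C = C1 * C2 * C3 * 2 ^ n"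
  have "norm (V_op \<omega> (\<lambda>r. (1 - r) ^ n) f z) \<le> C * B"
    if f: "integrable disc_area (\<lambda>z. f z * of_real (\<omega> (norm z)))"
    and B: "little_hankel_bound p \<omega> (\<lambda>z. cnj (f z)) B" and z: "norm z < 1" for f B z
  proof -
    have B0: "0 \<le> B" using B by (simp add: little_hankel_bound_def)
    define a where "a m = (\<integral>\<zeta>. f \<zeta> * of_real (\<omega> (norm \<zeta>)) * cnj \<zeta> ^ m \<partial>disc_area)" for m
    define x where "x m = of_real (bn m) * a m" for m
    have bc: "disc_coeffs (\<lambda>m. of_real (bn m))"
      using disc_coeffs_binomial[of "2 * \<beta> + 3"] by (simp add: bn_def)
    have xc: "disc_coeffs x" unfolding x_def[abs_def] a_def
      by (rule disc_coeffs_times_bounded[OF bc norm_antimoment_le[OF f]])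
    \<comment> \<open>Both Hadamard factors are evaluated on the circle of radius \<rho> = sqrt |z|,
      hence the square root.\<close>
    define y where "y = csqrt z"
    have yy: "y * y = z" unfolding y_def by (metis power2_csqrt power2_eq_square)
    define \<rho> where "\<rho> = norm y"
    have r2: "\<rho> * \<rho> = norm z" using yy by (simp add: \<rho>_def norm_mult[symmetric])
    have \<rho>: "0 \<le> \<rho>" "\<rho> < 1"
    proof -
      show "0 \<le> \<rho>" by (simp add: \<rho>_def)
      show "\<rho> < 1"
      proof (rule ccontr)
        assume "\<not> \<rho> < 1"
        then have "1 * 1 \<le> \<rho> * \<rho>" by (intro mult_mono) auto
        then show False using r2 z by simp
      qed
    qed
    have T: "0 < tail \<omega> \<rho>" by (rule tail_pos) fact
    \<comment> \<open>The norms of the test function in L^p and L^q multiply to the first power of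
      the tail and to (1 - \<rho>)^(1 - 2 L), because 1/p + 1/q = 1.\<close>
    define S where "S = B * (C2 * C3 * (tail \<omega> \<rho> * (1 - \<rho>) / (1 - \<rho>) ^ (2 * L)))"
    have S0: "0 \<le> S" unfolding S_def using B0 C2 C3 T \<rho> by (intro mult_nonneg_nonneg divide_nonneg_nonneg) auto
    have xS: "norm (psum x u) \<le> S" if u: "norm u = \<rho>" for u
    proof -
      let ?b = "cnj u"
      have b: "norm ?b < 1" "norm ?b = \<rho>" using u \<rho> by auto
      have u1: "norm u < 1" using u \<rho> by simp
      have "psum x u = (\<integral>\<zeta>. f \<zeta> * of_real (\<omega> (norm \<zeta>)) * cnj (psum (\<lambda>m. of_real (bn m)) (cnj u * \<zeta>)) \<partial>disc_area)"
        unfolding x_def[abs_def] a_def by (rule integral_cnj_psum[OF f bc u1, symmetric])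
      also have "\<dots> = (\<integral>\<zeta>. f \<zeta> * of_real (\<omega> (norm \<zeta>)) * cnj (test_function ?b \<zeta> * test_function ?b \<zeta>) \<partial>disc_area)"
      proof (rule Bochner_Integration.integral_cong)
        fix \<zeta> assume "\<zeta> \<in> space disc_area"
        then have "norm (cnj u * \<zeta>) < 1" using b by (intro norm_disc_mult_less) auto
        from negative_binomial_sums[OF this, of "2 * \<beta> + 3"]
        have "psum (\<lambda>m. of_real (bn m)) (cnj u * \<zeta>) = 1 / (1 - cnj u * \<zeta>) ^ Suc (2 * \<beta> + 3)"
          by (simp add: psum_def bn_def sums_iff)
        also have "Suc (2 * \<beta> + 3) = (\<beta> + 2) + (\<beta> + 2)" by simp
        finally have "psum (\<lambda>m. of_real (bn m)) (cnj u * \<zeta>) = test_function ?b \<zeta> * test_function ?b \<zeta>"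
          unfolding test_function_def power_add by simp
        then show "f \<zeta> * of_real (\<omega> (norm \<zeta>)) * cnj (psum (\<lambda>m. of_real (bn m)) (cnj u * \<zeta>))
            = f \<zeta> * of_real (\<omega> (norm \<zeta>)) * cnj (test_function ?b \<zeta> * test_function ?b \<zeta>)" by simp
      qed simp
      finally have "norm (psum x u) \<le> B * Lp_norm p \<omega> (test_function ?b) * Lp_norm q \<omega> (test_function ?b)"
        using pairing_bound[OF pq f B test_function_Hinf[OF b(1)] test_function_Hinf[OF b(1)]] by simp
      also have "\<dots> \<le> B * (C2 * (tail \<omega> \<rho> powr (1 / p) * (1 - \<rho>) powr (1 / p - real L))) * (C3 * (tail \<omega> \<rho> powr (1 / q) * (1 - \<rho>) powr (1 / q - real L)))"
        using C2(2)[OF b(1)] C3(2)[OF b(1)] C2(1) C3(1) B0 unfolding b(2)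
        by (intro mult_mono mult_left_mono) (auto simp: Lp_norm_def)
      also have "\<dots> = B * (C2 * C3 * ((tail \<omega> \<rho> powr (1 / p) * tail \<omega> \<rho> powr (1 / q)) * ((1 - \<rho>) powr (1 / p - real L) * (1 - \<rho>) powr (1 / q - real L))))"
        by (simp add: mult_ac)
      also have "tail \<omega> \<rho> powr (1 / p) * tail \<omega> \<rho> powr (1 / q) = tail \<omega> \<rho>"
        using T pq(3) by (simp add: powr_add[symmetric])
      also have "(1 - \<rho>) powr (1 / p - real L) * (1 - \<rho>) powr (1 / q - real L) = (1 - \<rho>) / (1 - \<rho>) ^ (2 * L)"
      proof -
        have "1 / p - real L + (1 / q - real L) = 1 - real (2 * L)" using pq(3) by simp
        then have "(1 - \<rho>) powr (1 / p - real L) * (1 - \<rho>) powr (1 / q - real L) = (1 - \<rho>) powr (1 - real (2 * L))"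
          by (simp only: powr_add[symmetric])
        also have "\<dots> = (1 - \<rho>) powr 1 / (1 - \<rho>) powr real (2 * L)" by (rule powr_diff)
        finally show ?thesis using \<rho> by (simp only: powr_realpow) simp
      qed
      finally show ?thesis by (simp add: S_def)
    qed
    define Y where "Y m = of_real (N.kernel_coeff m) * a m" for m
    have Yd: "Y = (\<lambda>m. of_real (d m) * x m)"
    proof
      fix m
      have "N.kernel_coeff m = d m * bn m" using bn0[of m] by (simp add: d_def)
      then show "Y m = of_real (d m) * x m" by (simp add: Y_def x_def)
    qed
    have V: "V_op \<omega> (\<lambda>r. (1 - r) ^ n) f z = of_real ((1 - norm z) ^ n) * psum Y z"
      using V_op_eq(2)[OF N f z] unfolding Y_def[abs_def] a_def[abs_def] .
    have "ennreal (norm (psum Y z)) \<le> ennreal S * circle_mean (psum (\<lambda>m. of_real (d m))) y"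
    proof -
      have "psum Y z = (\<integral>t. psum (\<lambda>m. of_real (d m)) (y * unit_cis t) * psum x (y * cnj (unit_cis t)) \<partial>unit_interval)"
        unfolding Yd yy[symmetric] using \<rho> by (intro psum_hadamard dc xc) (simp add: \<rho>_def)
      also have "ennreal (norm \<dots>) \<le> (\<integral>\<^sup>+t. ennreal (norm (psum (\<lambda>m. of_real (d m)) (y * unit_cis t) * psum x (y * cnj (unit_cis t)))) \<partial>unit_interval)"
      proof (cases "integrable unit_interval (\<lambda>t. psum (\<lambda>m. of_real (d m)) (y * unit_cis t) * psum x (y * cnj (unit_cis t)))")
        case True
        then show ?thesis by (rule integral_norm_bound_ennreal)
      qed (simp add: not_integrable_integral_eq)
      also have "\<dots> \<le> (\<integral>\<^sup>+t. ennreal S * ennreal (norm (psum (\<lambda>m. of_real (d m)) (y * unit_cis t))) \<partial>unit_interval)"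
      proof (rule nn_integral_mono)
        fix t
        have "norm (psum x (y * cnj (unit_cis t))) \<le> S" by (rule xS) (simp add: norm_mult \<rho>_def)
        then have "norm (psum (\<lambda>m. of_real (d m)) (y * unit_cis t) * psum x (y * cnj (unit_cis t))) \<le> S * norm (psum (\<lambda>m. of_real (d m)) (y * unit_cis t))"
          unfolding norm_mult by (subst mult.commute) (intro mult_right_mono, auto)
        then show "ennreal (norm (psum (\<lambda>m. of_real (d m)) (y * unit_cis t) * psum x (y * cnj (unit_cis t)))) \<le> ennreal S * ennreal (norm (psum (\<lambda>m. of_real (d m)) (y * unit_cis t)))"
          using S0 by (simp add: ennreal_mult[symmetric] ennreal_leI)
      qed
      also have "\<dots> = ennreal S * circle_mean (psum (\<lambda>m. of_real (d m))) y"
        unfolding circle_mean_def by (rule nn_integral_cmult) measurable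
      finally show ?thesis .
    qed
    also have "\<dots> \<le> ennreal S * ennreal (C1 / ((1 - \<rho>) ^ Suc (n - 2 * (\<beta> + 2)) * tail \<omega> \<rho>))"
      using C1(2)[of y] \<rho> by (intro mult_left_mono) (auto simp: \<rho>_def)
    also have "\<dots> = ennreal (S * (C1 / ((1 - \<rho>) ^ Suc (n - 2 * (\<beta> + 2)) * tail \<omega> \<rho>)))"
      using S0 C1(1) T \<rho> by (intro ennreal_mult[symmetric]) auto
    \<comment> \<open>The tail cancels; the exponents 1 - 2 L from \<open>S\<close> and -(n - 2 L +
      1) from the circle mean add up to -n.\<close>
    also have "S * (C1 / ((1 - \<rho>) ^ Suc (n - 2 * (\<beta> + 2)) * tail \<omega> \<rho>)) = B * (C1 * C2 * C3) / (1 - \<rho>) ^ n"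
    proof -
      have e: "(1 - \<rho>) ^ n = (1 - \<rho>) ^ (2 * L) * (1 - \<rho>) ^ (n - 2 * (\<beta> + 2))"
        unfolding power_add[symmetric] using n by (intro arg_cong[where f="(^) (1 - \<rho>)"]) (simp add: L_def)
      have "X * (Y * (t * u / v)) * (c1 / ((u * w) * t)) = X * (c1 * Y) / (v * w)"
        if "t \<noteq> 0" "u \<noteq> 0" for X Y t u v w c1 :: real using that by (simp add: field_simps)
      then show ?thesis unfolding S_def e power_Suc using T \<rho> by (simp add: mult_ac)
    qed
    finally have "norm (psum Y z) \<le> B * (C1 * C2 * C3) / (1 - \<rho>) ^ n"
      using B0 C1(1) C2(1) C3(1) \<rho> by (simp add: ennreal_le_iff)
    then have "(1 - norm z) ^ n * norm (psum Y z) \<le> (1 - norm z) ^ n * (B * (C1 * C2 * C3) / (1 - \<rho>) ^ n)"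
      using z by (intro mult_left_mono) auto
    moreover have "norm (V_op \<omega> (\<lambda>r. (1 - r) ^ n) f z) = (1 - norm z) ^ n * norm (psum Y z)"
      unfolding V norm_mult norm_of_real using z by simp
    ultimately have "norm (V_op \<omega> (\<lambda>r. (1 - r) ^ n) f z) \<le> (1 - norm z) ^ n * (B * (C1 * C2 * C3) / (1 - \<rho>) ^ n)"
      by simp
    \<comment> \<open>As |z| is the square of \<rho>, replacing (1 - |z|)^n by (1 - \<rho>)^n costs
      (1 + \<rho>)^n, the source of the factor 2^n in \<open>C\<close>.\<close>
    also have "1 - norm z = (1 - \<rho>) * (1 + \<rho>)" unfolding r2[symmetric] by (simp add: algebra_simps)
    also have "((1 - \<rho>) * (1 + \<rho>)) ^ n * (B * (C1 * C2 * C3) / (1 - \<rho>) ^ n) = (1 + \<rho>) ^ n * (B * (C1 * C2 * C3))"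
      using \<rho> by (simp add: power_mult_distrib)
    also have "\<dots> \<le> 2 ^ n * (B * (C1 * C2 * C3))"
      using \<rho> B0 C1(1) C2(1) C3(1) by (intro mult_right_mono power_mono) auto
    finally show ?thesis by (simp add: C_def mult_ac)
  qed
  moreover have "0 < C" using C1(1) C2(1) C3(1) by (simp add: C_def)
  ultimately show ?thesis using that by blast
qed

end

section \<open>The equivalence for weights with two-sided doubling\<close>

lemma two_sided_doubling_locale:
  assumes "\<omega> \<in> two_sided_doubling"
  obtains \<beta> K c where "doubling_weight \<omega> \<beta> K c"
proof -
  have rw: "radial_weight \<omega>" using assms by (simp add: two_sided_doubling_def upper_doubling_def)
  interpret weight \<omega> by unfold_locales (rule rw)
  obtain C where C: "1 < C" "\<And>r. r \<in> {0..<1} \<Longrightarrow> weight_tail \<omega> r \<le> C * weight_tail \<omega> ((1 + r) / 2)"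
    using assms by (auto simp: two_sided_doubling_def upper_doubling_def)
  obtain K c where K: "1 < K" "1 < c" "\<And>r. r \<in> {0..<1} \<Longrightarrow> c * weight_tail \<omega> (1 - (1 - r) / K) \<le> weight_tail \<omega> r"
    using assms by (auto simp: two_sided_doubling_def lower_doubling_def)
  obtain \<beta> where \<beta>: "C < 2 ^ \<beta>" using real_arch_pow[of 2 C] by auto
  have "doubling_weight \<omega> \<beta> K c"
  proof unfold_locales
    fix r :: real assume r: "0 \<le> r" "r < 1"
    have "tail \<omega> r \<le> C * tail \<omega> ((1 + r) / 2)" using C(2)[of r] r by (simp add: weight_tail_eq)
    also have "\<dots> \<le> 2 ^ \<beta> * tail \<omega> ((1 + r) / 2)" using \<beta> tail_pos[of "(1 + r) / 2"] r by (intro mult_right_mono) auto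
    finally show "tail \<omega> r \<le> 2 ^ \<beta> * tail \<omega> ((1 + r) / 2)" .
    have "(1 - r) / K \<le> (1 - r) / 1" using r K by (intro divide_left_mono) auto
    then have "0 \<le> 1 - (1 - r) / K" using r by simp
    then show "c * tail \<omega> (1 - (1 - r) / K) \<le> tail \<omega> r" using K(3)[of r] r by (simp add: weight_tail_eq)
  qed (use K in auto)
  then show ?thesis using that by blast
qed

theorem theorem2:
  fixes \<omega> :: "real \<Rightarrow> real"
  assumes "\<omega> \<in> two_sided_doubling"
  shows "\<exists>n\<^sub>0::nat. \<forall>p::real. 1 < p \<longrightarrow>
    (\<forall>f \<in> L1_log_space \<omega>.
       little_hankel_bounded p \<omega> (\<lambda>z. cnj (f z)) \<longleftrightarrow>
       (\<forall>n\<ge>n\<^sub>0. V_op \<omega> (\<lambda>r. (1 - r) ^ n) f \<in> Linf_space)) \<and>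
    (\<forall>n\<ge>n\<^sub>0. \<exists>C::real. 0 < C \<and>
       (\<forall>f \<in> L1_log_space \<omega>.
          Linf_norm (V_op \<omega> (\<lambda>r. (1 - r) ^ n) f)
            \<le> ennreal C * little_hankel_norm p \<omega> (\<lambda>z. cnj (f z)) \<and>
          little_hankel_norm p \<omega> (\<lambda>z. cnj (f z))
            \<le> ennreal C * Linf_norm (V_op \<omega> (\<lambda>r. (1 - r) ^ n) f)))"
proof -
  obtain \<beta> K c where "doubling_weight \<omega> \<beta> K c" using two_sided_doubling_locale[OF assms] .
  then interpret doubling_weight \<omega> \<beta> K c .
  let ?V = "\<lambda>n. V_op \<omega> (\<lambda>r. (1 - r) ^ n)"
  \<comment> \<open>Formulated with real bounds B and M instead of norms, so that infinite values
    occur only in the final comparison.\<close>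
  have main: "\<exists>C>0. \<forall>f\<in>L1_log_space \<omega>.
      (\<forall>B. little_hankel_bound p \<omega> (\<lambda>z. cnj (f z)) B \<longrightarrow> Linf_norm (?V n f) \<le> ennreal C * ennreal B) \<and>
      (\<forall>M\<ge>0. Linf_norm (?V n f) = ennreal M \<longrightarrow> little_hankel_bound p \<omega> (\<lambda>z. cnj (f z)) (C * M)) \<and>
      ?V n f \<in> borel_measurable disc_area"
    if p: "1 < p" and n: "2 * (\<beta> + 2) \<le> n" for p n
  proof -
    obtain b c0 where N: "0 < c0" "upper_doubling_weight (\<lambda>r. \<omega> r * (1 - r) ^ n) b"
      "\<And>r. 0 \<le> r \<Longrightarrow> r < 1 \<Longrightarrow> c0 * (1 - r) ^ n * tail \<omega> r \<le> tail (\<lambda>r. \<omega> r * (1 - r) ^ n) r"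
    proof (rule power_weight[of n], goal_cases)
      case (1 b c0)
      then show ?case using 1(1)[OF 1(2-4)] by blast
    qed
    obtain C1 where C1: "0 < C1" "\<And>f M. integrable disc_area (\<lambda>z. f z * of_real (\<omega> (norm z))) \<Longrightarrow> 0 \<le> M \<Longrightarrow>
      (AE z in disc_area. norm (?V n f z) \<le> M) \<Longrightarrow> little_hankel_bound p \<omega> (\<lambda>z. cnj (f z)) (C1 * M)"
      using little_hankel_bound_of_V_op[OF p N(2)] by blast
    obtain C2 where C2: "0 < C2" "\<And>f B z. integrable disc_area (\<lambda>z. f z * of_real (\<omega> (norm z))) \<Longrightarrow>
      little_hankel_bound p \<omega> (\<lambda>z. cnj (f z)) B \<Longrightarrow> norm z < 1 \<Longrightarrow> norm (?V n f z) \<le> C2 * B"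
      using V_op_bound_of_little_hankel[OF p n N(2) N(1) N(3)] by blast
    show ?thesis
    proof (intro exI[of _ "C1 + C2"] conjI ballI allI impI)
      show "0 < C1 + C2" using C1 C2 by simp
      fix f assume "f \<in> L1_log_space \<omega>"
      then have f: "integrable disc_area (\<lambda>z. f z * of_real (\<omega> (norm z)))" by (rule L1_log_integrable)
      show Vm[measurable]: "?V n f \<in> borel_measurable disc_area" by (rule V_op_eq(3)[OF N(2) f])
      {
        fix B assume B: "little_hankel_bound p \<omega> (\<lambda>z. cnj (f z)) B"
        then have B0: "0 \<le> B" by (simp add: little_hankel_bound_def)
        have "Linf_norm (?V n f) \<le> ennreal ((C1 + C2) * B)"
          unfolding Linf_norm_def
        proof (rule esssup_I)
          show "AE z in disc_area. ennreal (norm (?V n f z)) \<le> ennreal ((C1 + C2) * B)"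
          proof (rule AE_I2)
            fix z assume "z \<in> space disc_area"
            then have "norm (?V n f z) \<le> C2 * B" using C2(2)[OF f B] by simp
            also have "\<dots> \<le> (C1 + C2) * B" using C1(1) B0 by (intro mult_right_mono) auto
            finally show "ennreal (norm (?V n f z)) \<le> ennreal ((C1 + C2) * B)" by (rule ennreal_leI)
          qed
        qed measurable
        then show "Linf_norm (?V n f) \<le> ennreal (C1 + C2) * ennreal B"
          using C1(1) C2(1) B0 by (simp add: ennreal_mult)
      }
      fix M :: real assume M: "0 \<le> M" and eq: "Linf_norm (?V n f) = ennreal M"
      have "AE z in disc_area. ennreal (norm (?V n f z)) \<le> ennreal M"
        using esssup_AE[of "\<lambda>z. ennreal (norm (?V n f z))" disc_area] eq unfolding Linf_norm_def by simp
      then have "AE z in disc_area. norm (?V n f z) \<le> M" using M by (simp add: ennreal_le_iff)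
      then have "little_hankel_bound p \<omega> (\<lambda>z. cnj (f z)) (C1 * M)" by (rule C1(2)[OF f M])
      moreover have "C1 * M * Lp_norm p \<omega> g \<le> (C1 + C2) * M * Lp_norm p \<omega> g" for g
        using C2(1) M by (intro mult_right_mono) (auto simp: Lp_norm_def)
      ultimately show "little_hankel_bound p \<omega> (\<lambda>z. cnj (f z)) ((C1 + C2) * M)"
        unfolding little_hankel_bound_def using C1(1) C2(1) M by (auto intro: order_trans)
    qed
  qed
  show ?thesis
  \<comment> \<open>The witness precedes the choice of p: \<beta> has been extracted from \<omega>
    alone.\<close>
  proof (intro exI[of _ "2 * (\<beta> + 2)"] allI impI conjI ballI)
    fix p :: real and f assume p: "1 < p" and f: "f \<in> L1_log_space \<omega>"
    show "little_hankel_bounded p \<omega> (\<lambda>z. cnj (f z)) \<longleftrightarrow> (\<forall>n\<ge>2 * (\<beta> + 2). ?V n f \<in> Linf_space)"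
    proof
      assume "little_hankel_bounded p \<omega> (\<lambda>z. cnj (f z))"
      then obtain B where B: "little_hankel_bound p \<omega> (\<lambda>z. cnj (f z)) B" by (auto simp: little_hankel_bounded_def)
      show "\<forall>n\<ge>2 * (\<beta> + 2). ?V n f \<in> Linf_space"
      proof (intro allI impI)
        fix n assume n: "2 * (\<beta> + 2) \<le> n"
        obtain C where "Linf_norm (?V n f) \<le> ennreal C * ennreal B" "?V n f \<in> borel_measurable disc_area"
          using main[OF p n] f B by blast
        moreover have "ennreal C * ennreal B < \<infinity>" by (simp add: ennreal_mult_less_top)
        ultimately show "?V n f \<in> Linf_space" unfolding Linf_space_def by (auto intro: le_less_trans)
      qed
    next
      assume "\<forall>n\<ge>2 * (\<beta> + 2). ?V n f \<in> Linf_space"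
      \<comment> \<open>For boundedness of the operator a single exponent, here the smallest
        admissible one, suffices.\<close>
      then have "?V (2 * (\<beta> + 2)) f \<in> Linf_space" by blast
      then have "Linf_norm (?V (2 * (\<beta> + 2)) f) < \<infinity>" unfolding Linf_space_def by blast
      then obtain M where "0 \<le> M" "Linf_norm (?V (2 * (\<beta> + 2)) f) = ennreal M"
        by (cases "Linf_norm (?V (2 * (\<beta> + 2)) f)") auto
      then show "little_hankel_bounded p \<omega> (\<lambda>z. cnj (f z))"
        using main[OF p order_refl] f unfolding little_hankel_bounded_def by blast
    qed
  next
    fix p :: real and n :: nat assume p: "1 < p" and n: "2 * (\<beta> + 2) \<le> n"
    obtain C where C: "0 < C" "\<forall>f\<in>L1_log_space \<omega>.
      (\<forall>B. little_hankel_bound p \<omega> (\<lambda>z. cnj (f z)) B \<longrightarrow> Linf_norm (?V n f) \<le> ennreal C * ennreal B) \<and>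
      (\<forall>M\<ge>0. Linf_norm (?V n f) = ennreal M \<longrightarrow> little_hankel_bound p \<omega> (\<lambda>z. cnj (f z)) (C * M)) \<and>
      ?V n f \<in> borel_measurable disc_area"
      using main[OF p n] by blast
    show "\<exists>C::real. 0 < C \<and> (\<forall>f \<in> L1_log_space \<omega>.
          Linf_norm (?V n f) \<le> ennreal C * little_hankel_norm p \<omega> (\<lambda>z. cnj (f z)) \<and>
          little_hankel_norm p \<omega> (\<lambda>z. cnj (f z)) \<le> ennreal C * Linf_norm (?V n f))"
    proof (intro exI[of _ C] conjI ballI C(1))
      fix f assume f: "f \<in> L1_log_space \<omega>"
      let ?N = "little_hankel_norm p \<omega> (\<lambda>z. cnj (f z))" and ?L = "Linf_norm (?V n f)"
      have C0: "ennreal C \<noteq> 0" "ennreal C \<noteq> top" using C(1) by auto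
      \<comment> \<open>Dividing by C makes the claim a lower bound for an infimum. This includes
        the unbounded operator, where the infimum over the empty set is infinite.\<close>
      have "?L / ennreal C \<le> ?N"
        unfolding little_hankel_norm_def
      proof (rule Inf_greatest, clarify)
        fix B assume "little_hankel_bound p \<omega> (\<lambda>z. cnj (f z)) B"
        then have "?L \<le> ennreal C * ennreal B" using C(2) f by blast
        then show "?L / ennreal C \<le> ennreal B" using C(1) by (intro divide_le_posI_ennreal) auto
      qed
      then have "ennreal C * (?L / ennreal C) \<le> ennreal C * ?N" by (rule mult_left_mono) simp
      moreover have "ennreal C * (?L / ennreal C) = ?L"
        unfolding ennreal_times_divide mult.commute[of "ennreal C"] using C0 by (rule mult_divide_eq_ennreal)
      ultimately show "?L \<le> ennreal C * ?N" by simp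
      show "?N \<le> ennreal C * ?L"
      proof (cases ?L)
        case (real M)
        then have "little_hankel_bound p \<omega> (\<lambda>z. cnj (f z)) (C * M)" using C(2) f by simp
        then have "?N \<le> ennreal (C * M)" unfolding little_hankel_norm_def by (intro Inf_lower) auto
        then show ?thesis using real C(1) by (simp add: ennreal_mult)
      next
        case top
        then show ?thesis using C0 by (simp add: ennreal_mult_top)
      qed
    qed
  qed
qed

end
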